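(* For each $\mathfrak q$ as in the context there are $c,C\in(0,\infty)$ and $\beta_1>1$ such that $$\forall \beta>\beta_1\ \forall r>1\colon\quad \frac{c}{(\log\beta)^\Delta}\le\phi_\beta(r)\le\frac{C}{(\log\beta)^\Delta}.$$
   Context: Model: $d\ge1$ is an integer, $s\in(d,2d)$, $|\cdot|$ is a norm on $\mathbb R^d$, and $\mathfrak q\colon\mathbb Z^d\to[0,\infty]$ satisfies $\mathfrak q(x)=\mathfrak q(-x)$ for all $x$, $\mathfrak q(x)=+\infty$ whenever $x$ is a nearest neighbor of the origin in $\mathbb Z^d$, and $\mathfrak q(x)|x|^s\to1$ as $|x|\to\infty$. For $\beta>0$ set $\mathfrak p_\beta(x,y):=1-\exp\{-\beta\,\mathfrak q(x-y)\}$ (with $e^{-\infty}:=0$). The long-range percolation graph has vertex set $\mathbb Z^d$ and, for each pair of distinct $x,y\in\mathbb Z^d$, an undirected edge between $x$ and $y$ is present with probability $\mathfrak p_\beta(x,y)$, independently of other edges; its law is $P_\beta$. $D(x,y)$ is the graph (chemical) distance, i.e. the minimal number of edges of a path in this graph connecting $x$ to $y$. $B(x,r):=\{y\in\mathbb Z^d\colon|x-y|<r\}$, $\#$ is cardinality, $\log$ is the natural logarithm. The functions $\phi_\beta$: with $\gamma:=\frac s{2d}$ and $\Delta:=1/\log_2(2d/s)$, $(\phi_\beta)_{\beta>0}$ is the family (whose existence may be taken as known, and which is uniquely determined by the following properties) of continuous functions $\phi_\beta\colon(1,\infty)\to(0,\infty)$ with $\phi_\beta(r^\gamma)=\phi_\beta(r)$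 for all $r>1$, such that $\beta\mapsto\phi_\beta(r)$ is non-increasing and left-continuous for each $r>1$ and such that, for some at most countable $\Sigma\subseteq(0,\infty)$ and all $\beta\in(0,\infty)\smallsetminus\Sigma$, the map $\beta\mapsto\phi_\beta(r)$ is continuous at $\beta$ for each $r>1$ and, for all $\epsilon>0$, $r^{-d}\,\#\{x\in B(0,r)\colon |\frac{D(0,x)}{\phi_\beta(r)(\log r)^\Delta}-1|>\epsilon\}\to0$ in $P_\beta$-probability as $r\to\infty$. *)

theory Defs
  imports "HOL-Probability.Probability"
begin

section \<open>Long-range percolation on the integer lattice\<close>

text \<open>The lattice of dimension \<open>d = CARD('n)\<close> is the type \<open>int ^ 'n\<close>.\<close>

definition is_norm :: "('a::real_vector \<Rightarrow> real) \<Rightarrow> bool" where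
  "is_norm N \<longleftrightarrow>
     (\<forall>v. 0 \<le> N v) \<and> (\<forall>v. N v = 0 \<longleftrightarrow> v = 0) \<and>
     (\<forall>a v. N (a *\<^sub>R v) = \<bar>a\<bar> * N v) \<and> (\<forall>u v. N (u + v) \<le> N u + N v)"

definition real_vec :: "int ^ 'n \<Rightarrow> real ^ 'n" where
  "real_vec x = (\<chi> i. real_of_int (x $ i))"

definition lattice_ball :: "(real ^ 'n \<Rightarrow> real) \<Rightarrow> int ^ 'n \<Rightarrow> real \<Rightarrow> (int ^ 'n) set" where
  "lattice_ball N x r = {y. N (real_vec (x - y)) < r}"

definition nearest_neighbor_of_origin :: "int ^ 'n \<Rightarrow> bool" where
  "nearest_neighbor_of_origin x \<longleftrightarrow> (\<exists>i. x = axis i 1 \<or> x = - axis i 1)"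

definition admissible_q :: "(real ^ 'n \<Rightarrow> real) \<Rightarrow> real \<Rightarrow> (int ^ 'n \<Rightarrow> ennreal) \<Rightarrow> bool" where
  "admissible_q N s q \<longleftrightarrow>
     (\<forall>x. q x = q (- x)) \<and>
     (\<forall>x. nearest_neighbor_of_origin x \<longrightarrow> q x = \<infinity>) \<and>
     ((\<lambda>x. q x * ennreal (N (real_vec x) powr s)) \<longlongrightarrow> 1)
       (filtercomap (\<lambda>x. N (real_vec x)) at_top)"

definition connection_prob :: "(int ^ 'n \<Rightarrow> ennreal) \<Rightarrow> real \<Rightarrow> int ^ 'n \<Rightarrow> int ^ 'n \<Rightarrow> real" where
  "connection_prob q \<beta> x y =
     1 - (if q (x - y) = \<infinity> then 0 else exp (- \<beta> * enn2real (q (x - y))))"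

text \<open>Undirected edges are two-element sets of vertices. For symmetric \<open>q\<close> the following
  does not depend on how the endpoints of the edge are ordered, see \<open>edge_prob_eq\<close> below.\<close>

definition edge_prob :: "(int ^ 'n \<Rightarrow> ennreal) \<Rightarrow> real \<Rightarrow> (int ^ 'n) set \<Rightarrow> real" where
  "edge_prob q \<beta> e = (THE p. \<exists>x y. e = {x, y} \<and> x \<noteq> y \<and> p = connection_prob q \<beta> x y)"

lemma edge_prob_eq:
  assumes "\<And>x. q x = q (- x)" and "x \<noteq> y"
  shows "edge_prob q \<beta> {x, y} = connection_prob q \<beta> x y"
proof -
  have "q (y - x) = q (x - y)"
    using assms(1)[of "y - x"] by simp
  then have "connection_prob q \<beta> y x = connection_prob q \<beta> x y"
    by (simp add: connection_prob_def)
  then show ?thesis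
    unfolding edge_prob_def using assms(2)
    by (intro the_equality) (auto simp: doubleton_eq_iff)
qed

lemma connection_prob_bounds:
  assumes "0 \<le> \<beta>"
  shows "0 \<le> connection_prob q \<beta> x y" and "connection_prob q \<beta> x y \<le> 1"
  using assms by (auto simp: connection_prob_def)

definition all_edges :: "'v set set" where
  "all_edges = {e. card e = 2}"

text \<open>A configuration maps each edge to \<open>True\<close> iff the edge is present.\<close>

definition percolation :: "(int ^ 'n \<Rightarrow> ennreal) \<Rightarrow> real \<Rightarrow> ((int ^ 'n) set \<Rightarrow> bool) measure" where
  "percolation q \<beta> = PiM all_edges (\<lambda>e. measure_pmf (bernoulli_pmf (edge_prob q \<beta> e)))"

lemma prob_space_percolation: "prob_space (percolation q \<beta>)"
  unfolding percolation_def by (intro prob_space_PiM measure_pmf.prob_space_axioms)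

text \<open>A path is given by its vertices, which are pairwise distinct; so it has one edge less
  than vertices.\<close>

definition is_path :: "('v set \<Rightarrow> bool) \<Rightarrow> 'v \<Rightarrow> 'v list \<Rightarrow> 'v \<Rightarrow> bool" where
  "is_path \<omega> x vs y \<longleftrightarrow>
     vs \<noteq> [] \<and> hd vs = x \<and> last vs = y \<and> distinct vs \<and> successively (\<lambda>u v. \<omega> {u, v}) vs"

text \<open>The infimum is \<open>\<infinity>\<close> if \<open>x\<close> and \<open>y\<close> are not connected.\<close>

definition chem_dist :: "('v set \<Rightarrow> bool) \<Rightarrow> 'v \<Rightarrow> 'v \<Rightarrow> enat" where
  "chem_dist \<omega> x y = (INF vs \<in> {vs. is_path \<omega> x vs y}. enat (length vs - 1))"

definition tendsto_in_prob ::
    "'w measure \<Rightarrow> ('i \<Rightarrow> 'w \<Rightarrow> real) \<Rightarrow> real \<Rightarrow> 'i filter \<Rightarrow> bool" where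
  "tendsto_in_prob M X l F \<longleftrightarrow>
     (\<forall>\<eta>>0. ((\<lambda>r. measure M {\<omega> \<in> space M. \<bar>X r \<omega> - l\<bar> > \<eta>}) \<longlongrightarrow> 0) F)"


section \<open>The limiting functions\<close>

definition gamma_exp :: "real \<Rightarrow> real \<Rightarrow> real" where
  "gamma_exp d s = s / (2 * d)"

definition Delta_exp :: "real \<Rightarrow> real \<Rightarrow> real" where
  "Delta_exp d s = 1 / log 2 (2 * d / s)"

definition exceptional_points ::
    "(real ^ 'n \<Rightarrow> real) \<Rightarrow> real \<Rightarrow> (real \<Rightarrow> real) \<Rightarrow> real \<Rightarrow> real \<Rightarrow> ((int ^ 'n) set \<Rightarrow> bool) \<Rightarrow> (int ^ 'n) set"
  where
  "exceptional_points N s f \<epsilon> r \<omega> =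
     {x \<in> lattice_ball N 0 r.
        \<bar>ereal_of_enat (chem_dist \<omega> 0 x) / ereal (f r * ln r powr Delta_exp CARD('n) s) - 1\<bar>
          > ereal \<epsilon>}"

text \<open>\<open>\<phi> \<beta> r\<close> is only meaningful for \<open>\<beta> > 0\<close> and \<open>r > 1\<close>. These properties determine
  \<open>\<phi>\<close> uniquely on this range.\<close>

definition is_phi_family ::
    "(real ^ 'n \<Rightarrow> real) \<Rightarrow> real \<Rightarrow> (int ^ 'n \<Rightarrow> ennreal) \<Rightarrow> (real \<Rightarrow> real \<Rightarrow> real) \<Rightarrow> bool" where
  "is_phi_family N s q \<phi> \<longleftrightarrow>
     (\<forall>\<beta>>0. continuous_on {1<..} (\<phi> \<beta>)) \<and>
     (\<forall>\<beta>>0. \<forall>r>1. \<phi> \<beta> r > 0) \<and>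
     (\<forall>\<beta>>0. \<forall>r>1. \<phi> \<beta> (r powr gamma_exp CARD('n) s) = \<phi> \<beta> r) \<and>
     (\<forall>r>1. antimono_on {0<..} (\<lambda>\<beta>. \<phi> \<beta> r)) \<and>
     (\<forall>r>1. \<forall>\<beta>>0. continuous (at_left \<beta>) (\<lambda>b. \<phi> b r)) \<and>
     (\<exists>\<Sigma>. countable \<Sigma> \<and> \<Sigma> \<subseteq> {0<..} \<and>
        (\<forall>\<beta> \<in> {0<..} - \<Sigma>.
           (\<forall>r>1. isCont (\<lambda>b. \<phi> b r) \<beta>) \<and>
           (\<forall>\<epsilon>>0. tendsto_in_prob (percolation q \<beta>)
              (\<lambda>r \<omega>. r powr (- real CARD('n)) * real (card (exceptional_points N s (\<phi> \<beta>) \<epsilon> r \<omega>)))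
              0 at_top)))"

end

theory Submission
  imports Defs
begin

text \<open>Both bounds compare the logarithm of a distance with \<open>ln \<beta>\<close>: edges are abundant up to
  lengths of a power of \<open>\<beta>\<close>, and the logarithms of the scales at which a shortest path is
  organised shrink by the factor \<open>s / (2 * CARD('n))\<close> from one level to the next, while the number
  of pieces doubles. So a point at distance \<open>r\<close> is reached after about
  \<open>log (2 * CARD('n) / s) (ln r / ln \<beta>)\<close> levels, hence by about
  \<open>(ln r / ln \<beta>) powr Delta_exp CARD('n) s\<close> edges. Since \<open>\<phi> \<beta> r\<close> is determined by the typical distances
  at the scales \<open>r powr ((2 * CARD('n) / s) ^ k)\<close> for \<open>k\<close> tending to infinity, it suffices to show
  this with constants that depend neither on \<open>\<beta>\<close> nor on the distance, and only for a positive
  fraction of the points and with a probability that is bounded below.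

  For the lower bound, let \<open>M n\<close> be the mean number of points within graph distance \<open>n\<close>. A path of
  \<open>n\<close> edges to \<open>x\<close> has an edge of length at least \<open>len x / n\<close>, so the probability that \<open>x\<close> is within
  distance \<open>n\<close> is at most \<open>\<beta> * (n / len x) powr s\<close> times the sum of the products
  \<open>M k * M (n - 1 - k)\<close> (\<open>perc_pr_gball_le\<close>). Summing the minimum of this and \<open>1\<close> over \<open>x\<close> bounds \<open>M n\<close>
  by the power \<open>CARD('n) / s\<close> of the same expression without \<open>len x\<close>. The solution of this recursion
  has \<open>ln (M n)\<close> of order \<open>ln \<beta> * n powr (1 / Delta_exp)\<close> (\<open>mean_gball_size_bound\<close>), so a ball that
  covers a fraction of the points at distance \<open>r\<close> has a radius of at least the claimed order.

  For the upper bound, two points are connected recursively: an edge joins a window around one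
  point to a window around the other one, and its endpoints are connected to the two points
  in the same way, at a smaller scale. The windows are wide enough for the probability that
  no such edge exists to be smaller than the inverse of the distance. When this happens, one
  resorts to a path of nearest neighbours, at bounded cost on average; so the mean distance
  at level \<open>k\<close> is of order \<open>2 ^ k\<close> (\<open>mean_short_dist_scale\<close>).

  The last section turns these two estimates into bounds on \<open>\<phi> \<beta>\<close> for all \<open>\<beta>\<close> outside a countable
  set, and monotonicity in \<open>\<beta>\<close> extends them to all \<open>\<beta>\<close>.\<close>

section \<open>Norms on the lattice\<close>

lemma is_norm_nonneg: "is_norm N \<Longrightarrow> 0 \<le> N v"
  and is_norm_scale: "is_norm N \<Longrightarrow> N (a *\<^sub>R v) = \<bar>a\<bar> * N v"
  and is_norm_triangle: "is_norm N \<Longrightarrow> N (u + v) \<le> N u + N v"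
  and is_norm_eq_0: "is_norm N \<Longrightarrow> N v = 0 \<longleftrightarrow> v = 0"
  by (auto simp: is_norm_def)

lemma is_norm_minus: "is_norm N \<Longrightarrow> N (- v) = N v"
  using is_norm_scale[of N "-1" v] by simp

lemma is_norm_sum:
  assumes "is_norm N" "finite A"
  shows "N (\<Sum>i\<in>A. f i) \<le> (\<Sum>i\<in>A. N (f i))"
  using assms(2)
proof (induction A rule: finite_induct)
  case empty
  then show ?case using is_norm_eq_0[OF assms(1), of 0] by simp
next
  case (insert x F)
  then show ?case using is_norm_triangle[OF assms(1), of "f x" "sum f F"] by simp
qed

lemma is_norm_upper:
  fixes N :: "real ^ 'n \<Rightarrow> real"
  assumes "is_norm N"
  obtains C where "0 < C" "\<And>v. N v \<le> C * (\<Sum>i\<in>UNIV. \<bar>v $ i\<bar>)"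
proof
  define C where "C = 1 + (\<Sum>i\<in>UNIV. N (axis i 1))"
  have le: "N (axis i 1) \<le> C" for i
    using member_le_sum[of i UNIV "\<lambda>i. N (axis i 1)"] is_norm_nonneg[OF assms]
    by (auto simp: C_def)
  show "0 < C"
    unfolding C_def by (intro add_pos_nonneg sum_nonneg is_norm_nonneg[OF assms]) auto
  fix v :: "real ^ 'n"
  have "v = (\<Sum>i\<in>UNIV. (v $ i) *\<^sub>R axis i 1)"
    using basis_expansion[of v] by (simp add: scalar_mult_eq_scaleR)
  then have "N v \<le> (\<Sum>i\<in>UNIV. N ((v $ i) *\<^sub>R axis i 1))"
    using is_norm_sum[OF assms, of UNIV "\<lambda>i. (v $ i) *\<^sub>R axis i 1"] by simp
  also have "\<dots> \<le> (\<Sum>i\<in>UNIV. C * \<bar>v $ i\<bar>)"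
    by (intro sum_mono) (simp add: is_norm_scale[OF assms] mult.commute[of C] mult_left_mono le)
  finally show "N v \<le> C * (\<Sum>i\<in>UNIV. \<bar>v $ i\<bar>)"
    by (simp add: sum_distrib_left)
qed

text \<open>By compactness of the Euclidean unit sphere.\<close>

lemma is_norm_lower:
  fixes N :: "real ^ 'n \<Rightarrow> real"
  assumes "is_norm N"
  obtains c where "0 < c" "\<And>v. c * norm v \<le> N v"
proof -
  obtain C where C: "0 < C" "\<And>v. N v \<le> C * (\<Sum>i\<in>UNIV. \<bar>v $ i\<bar>)"
    using is_norm_upper[OF assms] by blast
  have C': "N v \<le> C * real CARD('n) * norm v" for v
  proof -
    have "(\<Sum>i\<in>UNIV. \<bar>v $ i\<bar>) \<le> (\<Sum>i\<in>(UNIV::'n set). norm v)"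
      by (intro sum_mono component_le_norm_cart)
    then show ?thesis using C(1) order_trans[OF C(2)[of v]]
      by (simp add: mult_left_mono)
  qed
  have diff: "N u - N v \<le> N (u - v)" for u v
    using is_norm_triangle[OF assms, of "u - v" v] by simp
  have lip: "(C * real CARD('n))-lipschitz_on UNIV N"
  proof (rule lipschitz_onI)
    fix u v
    have "\<bar>N u - N v\<bar> \<le> N (u - v)"
      using diff[of u v] diff[of v u] is_norm_minus[OF assms, of "u - v"] by simp
    also have "\<dots> \<le> C * real CARD('n) * norm (u - v)" by (rule C')
    finally show "dist (N u) (N v) \<le> C * real CARD('n) * dist u v"
      by (simp add: dist_norm)
  qed (use C(1) in auto)
  have "continuous_on (sphere 0 1) N"
    using lipschitz_on_continuous_on[OF lip] continuous_on_subset by blast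
  moreover have "sphere (0::real^'n) 1 \<noteq> {}"
    using norm_axis_1 by (metis (no_types) dist_0_norm empty_iff mem_sphere)
  ultimately obtain w where w: "w \<in> sphere 0 1" "\<And>v. v \<in> sphere 0 1 \<Longrightarrow> N w \<le> N v"
    using continuous_attains_inf[of "sphere 0 1" N] compact_sphere by blast
  have "w \<noteq> 0" using w(1) by auto
  then have "0 < N w"
    using is_norm_nonneg[OF assms, of w] is_norm_eq_0[OF assms, of w] by simp
  moreover have "N w * norm v \<le> N v" for v
  proof (cases "v = 0")
    case False
    then have "N w \<le> N ((1 / norm v) *\<^sub>R v)" by (intro w(2)) simp
    also have "\<dots> = N v / norm v" by (subst is_norm_scale[OF assms]) simp
    finally show ?thesis using False by (simp add: pos_le_divide_eq)
  qed (use is_norm_eq_0[OF assms, of 0] in simp)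
  ultimately show ?thesis using that by blast
qed

lemma real_vec_add: "real_vec (x + y) = real_vec x + real_vec y"
  and real_vec_minus: "real_vec (- x) = - real_vec x"
  and real_vec_0 [simp]: "real_vec 0 = 0"
  and real_vec_nth [simp]: "real_vec x $ i = real_of_int (x $ i)"
  by (auto simp: real_vec_def vec_eq_iff)

definition cube :: "nat \<Rightarrow> (int ^ 'n) set" where
  "cube m = {x. \<forall>i. \<bar>x $ i\<bar> \<le> int m}"

lemma cube_bij: "bij_betw vec_nth (cube m :: (int ^ 'n) set) (PiE UNIV (\<lambda>_. {- int m..int m}))"
  by (rule bij_betwI[where g = vec_lambda]) (auto simp: cube_def abs_le_iff PiE_iff minus_le_iff)

lemma finite_cube: "finite (cube m :: (int ^ 'n) set)"
  using bij_betw_finite[OF cube_bij[of m, where 'n = 'n]] by (simp add: finite_PiE)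

lemma card_cube: "card (cube m :: (int ^ 'n) set) = (2 * m + 1) ^ CARD('n)"
  using bij_betw_same_card[OF cube_bij[of m, where 'n = 'n]]
  by (simp add: card_PiE nat_add_distrib nat_mult_distrib)

locale lattice_norm =
  fixes N :: "real ^ 'n \<Rightarrow> real"
  assumes is_norm: "is_norm N"
begin

definition len :: "int ^ 'n \<Rightarrow> real" where
  "len x = N (real_vec x)"

lemma len_nonneg [simp]: "0 \<le> len x"
  by (simp add: len_def is_norm_nonneg[OF is_norm])

lemma len_0 [simp]: "len 0 = 0"
  using is_norm_eq_0[OF is_norm, of 0] by (simp add: len_def)

lemma len_eq_0 [simp]: "len x = 0 \<longleftrightarrow> x = 0"
  by (auto simp: len_def is_norm_eq_0[OF is_norm] vec_eq_iff)

lemma len_pos: "x \<noteq> 0 \<Longrightarrow> 0 < len x"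
  using len_nonneg[of x] len_eq_0[of x] by linarith

lemma len_minus [simp]: "len (- x) = len x"
  by (simp add: len_def real_vec_minus is_norm_minus[OF is_norm])

lemma len_commute: "len (x - y) = len (y - x)"
  using len_minus[of "x - y"] by simp

lemma len_add: "len (x + y) \<le> len x + len y"
  by (simp add: len_def real_vec_add is_norm_triangle[OF is_norm])

lemma len_diff_triangle: "len (x - z) \<le> len (x - y) + len (y - z)"
  using len_add[of "x - y" "y - z"] by simp

lemma len_sum: "len (p (m::nat) - p 0) \<le> (\<Sum>i<m. len (p (Suc i) - p i))"
proof (induction m)
  case (Suc m)
  then show ?case using len_diff_triangle[of "p (Suc m)" "p 0" "p m"] by simp
qed simp

lemma len_ge_l1:
  obtains K where "0 < K" "\<And>x. real_of_int (\<Sum>i\<in>UNIV. \<bar>x $ i\<bar>) \<le> K * len x"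
proof -
  obtain c where c: "0 < c" "\<And>v. c * norm v \<le> N v"
    using is_norm_lower[OF is_norm] by blast
  have "real_of_int (\<Sum>i\<in>UNIV. \<bar>x $ i\<bar>) \<le> (real CARD('n) / c) * len x" for x
  proof -
    have "real_of_int (\<Sum>i\<in>UNIV. \<bar>x $ i\<bar>) \<le> (\<Sum>i\<in>(UNIV::'n set). norm (real_vec x))"
      unfolding of_int_sum
      by (intro sum_mono) (use component_le_norm_cart[of "real_vec x"] in simp)
    also have "\<dots> = real CARD('n) / c * (c * norm (real_vec x))" using c(1) by simp
    also have "\<dots> \<le> real CARD('n) / c * len x"
      using c(1) by (intro mult_left_mono) (auto simp: len_def c(2))
    finally show ?thesis .
  qed
  then show ?thesis using c(1) that[of "real CARD('n) / c"] by simp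
qed

lemma ball_in_cube:
  obtains c where "0 < c" "\<And>r. 0 < r \<Longrightarrow> {x. len x < r} \<subseteq> cube (nat \<lfloor>r / c\<rfloor>)"
proof -
  obtain c where c: "0 < c" "\<And>v. c * norm v \<le> N v"
    using is_norm_lower[OF is_norm] by blast
  have "{x. len x < r} \<subseteq> cube (nat \<lfloor>r / c\<rfloor>)" if r: "0 < r" for r
  proof
    fix x assume "x \<in> {x. len x < r}"
    then have "c * norm (real_vec x) \<le> r" using c(2)[of "real_vec x"] by (simp add: len_def)
    then have "norm (real_vec x) \<le> r / c" using c(1) by (simp add: field_simps)
    then have "\<bar>real_of_int (x $ i)\<bar> \<le> r / c" for i
      using component_le_norm_cart[of "real_vec x" i] by simp
    then have "\<bar>x $ i\<bar> \<le> \<lfloor>r / c\<rfloor>" for i by (simp add: le_floor_iff)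
    then show "x \<in> cube (nat \<lfloor>r / c\<rfloor>)" using r c(1) by (auto simp: cube_def)
  qed
  then show ?thesis using c(1) that by blast
qed

lemma finite_ball: "finite {x. len x < r}"
proof (cases "0 < r")
  case True
  obtain c where "\<And>r. 0 < r \<Longrightarrow> {x. len x < r} \<subseteq> cube (nat \<lfloor>r / c\<rfloor>)"
    using ball_in_cube by blast
  from finite_subset[OF this[OF True] finite_cube] show ?thesis .
next
  case False
  then have "\<not> len x < r" for x using len_nonneg[of x] by linarith
  then have "{x. len x < r} = {}" by blast
  then show ?thesis by simp
qed

lemma card_ball_upper:
  obtains C where "0 < C" "\<And>r. 1 \<le> r \<Longrightarrow> real (card {x. len x < r}) \<le> C * r ^ CARD('n)"
proof -
  obtain c where c: "0 < c" "\<And>r. 0 < r \<Longrightarrow> {x. len x < r} \<subseteq> cube (nat \<lfloor>r / c\<rfloor>)"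
    using ball_in_cube by blast
  have "real (card {x. len x < r}) \<le> (2 / c + 1) ^ CARD('n) * r ^ CARD('n)" if r: "1 \<le> r" for r
  proof -
    have "real (card {x. len x < r}) \<le> real (card (cube (nat \<lfloor>r / c\<rfloor>) :: (int^'n) set))"
      using r by (intro of_nat_mono card_mono finite_cube c(2)) auto
    also have "\<dots> = (2 * real (nat \<lfloor>r / c\<rfloor>) + 1) ^ CARD('n)"
      by (simp add: card_cube add.commute)
    also have "\<dots> \<le> (2 * (r / c) + r) ^ CARD('n)"
      using r c(1) by (intro power_mono add_mono mult_left_mono) auto
    also have "\<dots> = ((2 / c + 1) * r) ^ CARD('n)" by (simp add: algebra_simps)
    finally show ?thesis by (simp add: power_mult_distrib)
  qed
  then show ?thesis using c(1) by (intro that[of "(2 / c + 1) ^ CARD('n)"]) (auto intro!: zero_less_power add_pos_pos)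
qed

lemma card_ball_lower:
  obtains c where "0 < c" "\<And>r. 0 < r \<Longrightarrow> c * r ^ CARD('n) \<le> real (card {x. len x < r})"
proof -
  obtain C where C: "0 < C" "\<And>v. N v \<le> C * (\<Sum>i\<in>UNIV. \<bar>v $ i\<bar>)"
    using is_norm_upper[OF is_norm] by blast
  define D where "D = 2 * C * real CARD('n)"
  have D: "0 < D" using C(1) by (simp add: D_def)
  have "(1 / D) ^ CARD('n) * r ^ CARD('n) \<le> real (card {x. len x < r})" if r: "0 < r" for r
  proof -
    define m where "m = nat \<lfloor>r / D\<rfloor>"
    have "0 \<le> r / D" using r D by simp
    then have m: "real m \<le> r / D" "r / D \<le> real m + 1"
      unfolding m_def by linarith+
    have "cube m \<subseteq> {x. len x < r}"
    proof
      fix x :: "int ^ 'n" assume "x \<in> cube m"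
      then have *: "\<bar>real_of_int (x $ i)\<bar> \<le> real m" for i
        by (auto simp: cube_def) (metis of_int_abs of_int_le_iff of_int_of_nat_eq)
      have "len x \<le> C * (\<Sum>i\<in>UNIV. \<bar>real_vec x $ i\<bar>)" unfolding len_def by (rule C(2))
      also have "\<dots> \<le> C * (\<Sum>i\<in>(UNIV::'n set). real m)"
        using C(1) * by (intro mult_left_mono sum_mono) auto
      also have "\<dots> \<le> C * (real CARD('n) * (r / D))"
        using C(1) mult_left_mono[OF m(1), of "real CARD('n)"] by (intro mult_left_mono) auto
      also have "\<dots> = r / 2" using C(1) by (simp add: D_def)
      finally show "x \<in> {x. len x < r}" using r by simp
    qed
    then have "real (card (cube m :: (int^'n) set)) \<le> real (card {x. len x < r})"
      by (intro of_nat_mono card_mono finite_ball)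
    moreover have "(r / D) ^ CARD('n) \<le> real (card (cube m :: (int^'n) set))"
      unfolding card_cube of_nat_power using r D m(2) by (intro power_mono) auto
    ultimately show ?thesis by (simp add: power_divide)
  qed
  then show ?thesis using D by (intro that[of "(1 / D) ^ CARD('n)"]) auto
qed

text \<open>The volume bounds for balls do not match, but the ball of radius \<open>\<kappa> r\<close> is still
  negligible within the ball of radius \<open>r\<close> once \<open>\<kappa>\<close> is small.\<close>

lemma card_annulus_lower:
  obtains \<kappa> c r\<^sub>1 where "0 < \<kappa>" "\<kappa> < 1" "0 < c" "1 \<le> r\<^sub>1"
    "\<And>r. r\<^sub>1 \<le> r \<Longrightarrow> c * r ^ CARD('n) \<le> real (card {x. \<kappa> * r \<le> len x \<and> len x < r})"
proof -
  obtain c where c: "0 < c" "\<And>r. 0 < r \<Longrightarrow> c * r ^ CARD('n) \<le> real (card {x. len x < r})"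
    using card_ball_lower by blast
  obtain C where C: "0 < C" "\<And>r. 1 \<le> r \<Longrightarrow> real (card {x. len x < r}) \<le> C * r ^ CARD('n)"
    using card_ball_upper by blast
  define \<kappa> where "\<kappa> = min (1/2) (c / (2 * C))"
  have \<kappa>: "0 < \<kappa>" "\<kappa> < 1" using c(1) C(1) by (auto simp: \<kappa>_def)
  have "\<kappa> ^ CARD('n) \<le> \<kappa> ^ 1" using \<kappa> by (intro power_decreasing) (auto simp: Suc_le_eq)
  also have "\<dots> \<le> c / (2 * C)" by (simp add: \<kappa>_def)
  finally have \<kappa>C: "C * \<kappa> ^ CARD('n) \<le> c / 2" using C(1) by (simp add: field_simps)
  have "c / 2 * r ^ CARD('n) \<le> real (card {x. \<kappa> * r \<le> len x \<and> len x < r})" if r: "1 / \<kappa> \<le> r" for r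
  proof -
    have r': "1 \<le> \<kappa> * r" using r \<kappa> by (simp add: field_simps)
    then have r0: "0 < r" using \<kappa> by (smt (verit) mult_nonneg_nonpos)
    have eq: "{x. \<kappa> * r \<le> len x \<and> len x < r} = {x. len x < r} - {x. len x < \<kappa> * r}" by auto
    have sub: "{x. len x < \<kappa> * r} \<subseteq> {x. len x < r}"
      using \<kappa> r0 by (smt (verit, best) Collect_mono mult_less_cancel_right1)
    have "c / 2 * r ^ CARD('n) = c * r ^ CARD('n) - c / 2 * r ^ CARD('n)" by simp
    also have "\<dots> \<le> c * r ^ CARD('n) - C * \<kappa> ^ CARD('n) * r ^ CARD('n)"
      using \<kappa>C r0 by (intro diff_left_mono mult_right_mono) auto
    also have "\<dots> = c * r ^ CARD('n) - C * (\<kappa> * r) ^ CARD('n)"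
      by (simp add: power_mult_distrib)
    also have "\<dots> \<le> real (card {x. len x < r}) - real (card {x. len x < \<kappa> * r})"
      using c(2)[OF r0] C(2)[OF r'] by linarith
    also have "\<dots> = real (card {x. \<kappa> * r \<le> len x \<and> len x < r})"
      unfolding eq using card_Diff_subset[OF finite_ball sub] card_mono[OF finite_ball sub]
      by simp
    finally show ?thesis .
  qed
  moreover have "1 \<le> 1 / \<kappa>" using \<kappa> by simp
  ultimately show ?thesis using \<kappa> c(1) by (intro that[of \<kappa> "c/2" "1/\<kappa>"]) auto
qed

text \<open>The sum is dominated by the points with \<open>len x\<close> up to \<open>A powr (1 / s)\<close>, where the minimum
  is \<open>1\<close>; the dyadic shells beyond that radius contribute a geometric series because
  \<open>s > CARD('n)\<close>.\<close>

lemma sum_truncated_power_law: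
  assumes s: "real CARD('n) < s"
  obtains C where "0 < C"
    "\<And>A. 1 \<le> A \<Longrightarrow> (\<integral>\<^sup>+x. ennreal (min 1 (A * len x powr (- s))) \<partial>count_space UNIV)
        \<le> ennreal (C * A powr (real CARD('n) / s))"
proof -
  obtain C where C: "0 < C" "\<And>r. 1 \<le> r \<Longrightarrow> real (card {x. len x < r}) \<le> C * r ^ CARD('n)"
    using card_ball_upper by blast
  define d where "d = real CARD('n)"
  have s0: "0 < s" using s by (smt (verit) of_nat_0_le_iff)
  define \<rho> where "\<rho> = 2 powr (d - s)"
  have \<rho>: "0 < \<rho>" "\<rho> < 1" using s powr_less_mono[of "d - s" 0 2] by (auto simp: \<rho>_def d_def)
  define K where "K = C * 2 powr s / (1 - \<rho>)"
  have K: "0 < K" using C \<rho> by (simp add: K_def)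
  have "(\<integral>\<^sup>+x. ennreal (min 1 (A * len x powr (- s))) \<partial>count_space UNIV) \<le> ennreal (K * A powr (d / s))"
    if A: "1 \<le> A" for A
  proof -
    define R where "R = A powr (1 / s)"
    have R: "1 \<le> R" using A s0 by (simp add: R_def ge_one_powr_ge_zero)
    have AR: "A = R powr s" using A s0 by (simp add: R_def powr_powr)
    define t where "t j x = 2 powr ((1 - real j) * s) * indicator {x. len x < 2 ^ j * R} x" for j x
    have dom: "ennreal (min 1 (A * len x powr (- s))) \<le> (\<Sum>j. ennreal (t j x))" for x
    proof -
      have "\<exists>j. min 1 (A * len x powr (- s)) \<le> t j x"
      proof (cases "len x < R")
        case True
        then have "t 0 x = 2 powr s" by (simp add: t_def)
        moreover have "1 \<le> 2 powr s" using s0 by (simp add: ge_one_powr_ge_zero)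
        ultimately show ?thesis by (intro exI[of _ 0]) linarith
      next
        case False
        obtain j0 where "len x / R < 2 ^ j0" using real_arch_pow[of 2 "len x / R"] by auto
        then have ex: "\<exists>j. len x < 2 ^ j * R" using R by (auto simp: field_simps)
        define j where "j = (LEAST j. len x < 2 ^ j * R)"
        have j: "len x < 2 ^ j * R" unfolding j_def using ex by (rule LeastI_ex)
        have "j \<noteq> 0" using False j by (intro notI) auto
        then obtain i where i: "j = Suc i" using not0_implies_Suc by blast
        then have "2 ^ i * R \<le> len x" using not_less_Least[of i "\<lambda>j. len x < 2 ^ j * R"] j_def by auto
        then have "len x powr (- s) \<le> (2 ^ i * R) powr (- s)"
          using R s0 by (intro powr_mono2') auto
        then have "A * len x powr (- s) \<le> A * ((2 ^ i) powr (- s) * R powr (- s))"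
          using A R by (intro mult_left_mono) (auto simp: powr_mult)
        also have "\<dots> = (2 ^ i) powr (- s)" using R by (simp add: AR powr_minus)
        also have "\<dots> = 2 powr ((1 - real j) * s)"
          by (simp add: i powr_powr flip: powr_realpow)
        also have "\<dots> = t j x" using j by (simp add: t_def)
        finally show ?thesis by (intro exI[of _ j]) linarith
      qed
      then obtain j where "min 1 (A * len x powr (- s)) \<le> t j x" by blast
      then have "ennreal (min 1 (A * len x powr (- s))) \<le> ennreal (t j x)" by (rule ennreal_leI)
      also have "\<dots> = (\<Sum>j\<in>{j}. ennreal (t j x))" by simp
      also have "\<dots> \<le> (\<Sum>j. ennreal (t j x))" by (rule sum_le_suminf) auto
      finally show ?thesis .
    qed
    have "(\<integral>\<^sup>+x. ennreal (min 1 (A * len x powr (- s))) \<partial>count_space UNIV)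
        \<le> (\<integral>\<^sup>+x. (\<Sum>j. ennreal (t j x)) \<partial>count_space UNIV)"
      by (intro nn_integral_mono dom)
    also have "\<dots> = (\<Sum>j. \<integral>\<^sup>+x. ennreal (t j x) \<partial>count_space UNIV)"
      by (intro nn_integral_suminf) auto
    also have "\<dots> \<le> (\<Sum>j. ennreal (C * 2 powr s * A powr (d / s) * \<rho> ^ j))"
    proof (intro suminf_le)
      fix j :: nat
      have "(\<integral>\<^sup>+x. ennreal (t j x) \<partial>count_space UNIV)
          = (\<integral>\<^sup>+x. ennreal (2 powr ((1 - real j) * s)) * indicator {x. len x < 2 ^ j * R} x \<partial>count_space UNIV)"
        by (intro nn_integral_cong) (auto simp: t_def split: split_indicator)
      also have "\<dots> = ennreal (2 powr ((1 - real j) * s)) * ennreal (real (card {x. len x < 2 ^ j * R}))"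
        by (subst nn_integral_cmult_indicator)
           (auto simp: emeasure_count_space_finite finite_ball ennreal_of_nat_eq_real_of_nat)
      also have "\<dots> \<le> ennreal (2 powr ((1 - real j) * s)) * ennreal (C * (2 ^ j * R) ^ CARD('n))"
      proof (intro mult_left_mono ennreal_leI C(2))
        have "1 * 1 \<le> 2 ^ j * R" using R by (intro mult_mono) auto
        then show "1 \<le> 2 ^ j * R" by simp
      qed auto
      also have "\<dots> = ennreal (2 powr ((1 - real j) * s) * (C * (2 ^ j * R) ^ CARD('n)))"
        using C(1) R by (subst ennreal_mult) auto
      also have "2 powr ((1 - real j) * s) * (C * (2 ^ j * R) ^ CARD('n))
          = C * 2 powr s * A powr (d / s) * \<rho> ^ j"
      proof -
        have "(2 ^ j * R) ^ CARD('n) = 2 powr (real j * d) * A powr (d / s)"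
        proof -
          have "(2 ^ j * R) ^ CARD('n) = (2 ^ j * R) powr d"
            using R by (simp add: powr_realpow d_def)
          also have "\<dots> = (2 powr real j) powr d * R powr d" using R by (simp add: powr_mult powr_realpow)
          finally show ?thesis by (simp add: powr_powr R_def)
        qed
        moreover have "\<rho> ^ j = 2 powr ((d - s) * real j)"
          using \<rho>(1) by (simp add: \<rho>_def powr_powr flip: powr_realpow)
        moreover have "2 powr ((1 - real j) * s) * 2 powr (real j * d) = 2 powr s * 2 powr ((d - s) * real j)"
          by (simp add: algebra_simps flip: powr_add)
        ultimately show ?thesis by (simp add: algebra_simps)
      qed
      finally show "(\<integral>\<^sup>+x. ennreal (t j x) \<partial>count_space UNIV)
        \<le> ennreal (C * 2 powr s * A powr (d / s) * \<rho> ^ j)" .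
    qed auto
    also have "\<dots> = ennreal (\<Sum>j. C * 2 powr s * A powr (d / s) * \<rho> ^ j)"
      using C(1) \<rho> by (intro suminf_ennreal2) (auto intro!: summable_mult summable_geometric)
    also have "(\<Sum>j. C * 2 powr s * A powr (d / s) * \<rho> ^ j) = C * 2 powr s * A powr (d / s) * (1 / (1 - \<rho>))"
      using \<rho> by (subst suminf_mult) (auto simp: suminf_geometric intro!: summable_geometric)
    also have "\<dots> = K * A powr (d / s)" by (simp add: K_def)
    finally show ?thesis .
  qed
  then show ?thesis using K that by (auto simp: d_def)
qed

end

section \<open>Balls in the graph metric\<close>

primrec gball :: "('v set \<Rightarrow> bool) \<Rightarrow> nat \<Rightarrow> 'v \<Rightarrow> 'v set" where
  "gball G 0 x = {x}"
| "gball G (Suc n) x = gball G n x \<union> {z. \<exists>y\<in>gball G n x. y \<noteq> z \<and> G {y, z}}"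

lemma gball_mono: "m \<le> n \<Longrightarrow> gball G m x \<subseteq> gball G n x"
  by (induction n rule: dec_induct) auto

lemma gball_center: "x \<in> gball G n x"
  using gball_mono[of 0 n G x] by auto

lemma gball_step: "y \<in> gball G n x \<Longrightarrow> y \<noteq> z \<Longrightarrow> G {y, z} \<Longrightarrow> z \<in> gball G (Suc n) x"
  by auto

lemma gball_trans: "y \<in> gball G m x \<Longrightarrow> z \<in> gball G n y \<Longrightarrow> z \<in> gball G (m + n) x"
  by (induction n arbitrary: z) auto

lemma gball_sym: "y \<in> gball G n x \<Longrightarrow> x \<in> gball G n y"
proof (induction n arbitrary: y)
  case (Suc n)
  then consider "y \<in> gball G n x" | w where "w \<in> gball G n x" "w \<noteq> y" "G {w, y}" by auto
  then show ?case
  proof cases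
    case 1
    then show ?thesis using Suc.IH by auto
  next
    case 2
    then have "w \<in> gball G 1 y" by (auto simp: insert_commute)
    then show ?thesis using gball_trans[of w G 1 y x n] Suc.IH[OF 2(1)] by simp
  qed
qed simp

lemma gball_sym_iff: "y \<in> gball G n x \<longleftrightarrow> x \<in> gball G n y"
  using gball_sym by metis

lemma gball_mono_config:
  assumes "\<And>y z. y \<noteq> z \<Longrightarrow> G {y, z} \<Longrightarrow> G' {y, z}"
  shows "gball G n x \<subseteq> gball G' n x"
proof (induction n)
  case (Suc n)
  then show ?case using assms by auto
qed simp

lemma path_in_gball:
  assumes "vs \<noteq> []" "distinct vs" "successively (\<lambda>u v. G {u, v}) vs"
  shows "last vs \<in> gball G (length vs - 1) (hd vs)"
  using assms
proof (induction vs rule: induct_list012)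
  case (3 a b vs)
  then have "b \<in> gball G 1 a" by auto
  moreover have "last (b # vs) \<in> gball G (length vs) b" using 3 by simp
  ultimately show ?case using gball_trans[of b G 1 a "last (b # vs)" "length vs"] by simp
qed auto

lemma gball_imp_path:
  assumes "y \<in> gball G n x"
  shows "\<exists>vs. is_path G x vs y \<and> length vs - 1 \<le> n \<and> set vs \<subseteq> gball G n x"
  using assms
proof (induction n arbitrary: y)
  case 0
  then show ?case by (intro exI[of _ "[x]"]) (auto simp: is_path_def)
next
  case (Suc n)
  show ?case
  proof (cases "y \<in> gball G n x")
    case True
    then obtain vs where "is_path G x vs y" "length vs - 1 \<le> n" "set vs \<subseteq> gball G n x"
      using Suc.IH by blast
    then show ?thesis by (intro exI[of _ vs]) auto
  next
    case False
    then obtain w where w: "w \<in> gball G n x" "w \<noteq> y" "G {w, y}" using Suc.prems by auto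
    obtain vs where vs: "is_path G x vs w" "length vs - 1 \<le> n" "set vs \<subseteq> gball G n x"
      using Suc.IH[OF w(1)] by blast
    have "is_path G x (vs @ [y]) y"
      using vs False w by (auto simp: is_path_def successively_append_iff)
    moreover have "set (vs @ [y]) \<subseteq> gball G (Suc n) x" using vs(3) Suc.prems by auto
    moreover have "length (vs @ [y]) - 1 \<le> Suc n" using vs(2) by simp
    ultimately show ?thesis by blast
  qed
qed

lemma chem_dist_le_iff: "chem_dist G x y \<le> enat n \<longleftrightarrow> y \<in> gball G n x"
proof
  assume le: "chem_dist G x y \<le> enat n"
  then have "{vs. is_path G x vs y} \<noteq> {}"
    by (intro notI) (simp add: chem_dist_def top_enat_def)
  then have "chem_dist G x y \<in> (\<lambda>vs. enat (length vs - 1)) ` {vs. is_path G x vs y}"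
    unfolding chem_dist_def using wellorder_InfI by (metis (no_types, lifting) ex_in_conv image_is_empty)
  then obtain vs where vs: "is_path G x vs y" "chem_dist G x y = enat (length vs - 1)" by blast
  then have *: "y \<in> gball G (length vs - 1) x"
    using path_in_gball[of vs G] by (simp add: is_path_def)
  have "length vs - 1 \<le> n" using le unfolding vs(2) by (simp only: enat_ord_simps)
  from subsetD[OF gball_mono[OF this] *] show "y \<in> gball G n x" .
next
  assume "y \<in> gball G n x"
  from gball_imp_path[OF this] obtain vs where "is_path G x vs y" "length vs - 1 \<le> n" by blast
  then show "chem_dist G x y \<le> enat n"
    unfolding chem_dist_def by (intro INF_lower2[of vs]) simp_all
qed

text \<open>The vertex with number \<open>i\<close> of a shortest path has distance exactly \<open>i\<close> from its start. Hence
  the part of the path behind this vertex stays outside the ball of radius \<open>i\<close>, which is what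
  makes the two parts independent below.\<close>

lemma gball_geodesic:
  assumes "x \<in> gball G n v"
  obtains m p where "m \<le> n" "p 0 = v" "p m = x"
    "\<And>i. i < m \<Longrightarrow> p i \<noteq> p (Suc i) \<and> G {p i, p (Suc i)}"
    "\<And>i. i \<le> m \<Longrightarrow> p i \<in> gball G i v"
    "\<And>i j. i \<le> m \<Longrightarrow> j < i \<Longrightarrow> p i \<notin> gball G j v"
proof -
  have *: "\<exists>p. p 0 = v \<and> p m = x \<and> (\<forall>i<m. p i \<noteq> p (Suc i) \<and> G {p i, p (Suc i)}) \<and>
      (\<forall>i\<le>m. p i \<in> gball G i v) \<and> (\<forall>i\<le>m. \<forall>j<i. p i \<notin> gball G j v)"
    if "x \<in> gball G m v" "\<forall>j<m. x \<notin> gball G j v" for m x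
    using that
  proof (induction m arbitrary: x)
    case 0
    then show ?case by (intro exI[of _ "\<lambda>_. v"]) auto
  next
    case (Suc m)
    then obtain y where y: "y \<in> gball G m v" "y \<noteq> x" "G {y, x}" by auto
    have "\<forall>j<m. y \<notin> gball G j v"
    proof (intro allI impI notI)
      fix j assume "j < m" "y \<in> gball G j v"
      then show False using y gball_step[of y G j v x] Suc.prems(2)[rule_format, of "Suc j"] by auto
    qed
    then obtain p where p: "p 0 = v" "p m = y" "\<forall>i<m. p i \<noteq> p (Suc i) \<and> G {p i, p (Suc i)}"
      "\<forall>i\<le>m. p i \<in> gball G i v" "\<forall>i\<le>m. \<forall>j<i. p i \<notin> gball G j v"
      using Suc.IH[OF y(1)] by blast
    define p' where "p' = p(Suc m := x)"
    have p': "p' (Suc m) = x" "\<And>i. i \<le> m \<Longrightarrow> p' i = p i" by (auto simp: p'_def)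
    have "p' 0 = v" using p(1) p'(2) by simp
    moreover have "p' i \<noteq> p' (Suc i) \<and> G {p' i, p' (Suc i)}" if "i < Suc m" for i
      using p(2,3) y(2,3) p' that by (cases "i = m") simp_all
    moreover have "p' i \<in> gball G i v \<and> (\<forall>j<i. p' i \<notin> gball G j v)" if "i \<le> Suc m" for i
    proof (cases "i = Suc m")
      case True
      then show ?thesis unfolding True p'(1) using Suc.prems by blast
    next
      case False
      then have "i \<le> m" using that by simp
      then show ?thesis using p(4,5) p'(2) by simp
    qed
    ultimately show ?case using p'(1) by (intro exI[of _ p']) blast
  qed
  define m where "m = (LEAST m. x \<in> gball G m v)"
  have "x \<in> gball G m v" unfolding m_def using assms by (rule LeastI)
  moreover have "\<forall>j<m. x \<notin> gball G j v" unfolding m_def by (auto dest: not_less_Least)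
  moreover have "m \<le> n" unfolding m_def using assms by (rule Least_le)
  ultimately show ?thesis using *[of x m] that[of m] by metis
qed

definition gball_lt :: "('v set \<Rightarrow> bool) \<Rightarrow> nat \<Rightarrow> 'v \<Rightarrow> 'v set" where
  "gball_lt G k v = (\<Union>j<k. gball G j v)"

text \<open>The configuration in which all edges that meet \<open>T\<close> are closed.\<close>

definition off :: "'v set \<Rightarrow> ('v set \<Rightarrow> bool) \<Rightarrow> 'v set \<Rightarrow> bool" where
  "off T G e \<longleftrightarrow> G e \<and> e \<inter> T = {}"

lemma gball_off_subset: "gball (off T G) n x \<subseteq> gball G n x"
  by (rule gball_mono_config) (auto simp: off_def)

text \<open>A path of at most \<open>n\<close> edges from \<open>v\<close> to \<open>x\<close> must contain an edge of at least an \<open>n\<close>-th of the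
  length of \<open>x - v\<close>. What precedes this edge lies within the ball of radius \<open>k\<close>, and what follows it
  can be found without the vertices of \<open>gball_lt G k v\<close> and without \<open>y\<close>.\<close>

lemma (in lattice_norm) long_edge_on_geodesic:
  assumes "x \<in> gball G n v" "x \<noteq> v"
  obtains k y z where "k < n" "y \<in> gball G k v" "y \<notin> gball_lt G k v" "z \<notin> gball_lt G k v"
    "y \<noteq> z" "G {y, z}" "x \<in> gball (off (insert y (gball_lt G k v)) G) (n - 1 - k) z"
    "len (x - v) \<le> real n * len (y - z)"
proof -
  obtain m p where mp: "m \<le> n" "p 0 = v" "p m = x"
    "\<And>i. i < m \<Longrightarrow> p i \<noteq> p (Suc i) \<and> G {p i, p (Suc i)}"
    "\<And>i. i \<le> m \<Longrightarrow> p i \<in> gball G i v"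
    "\<And>i j. i \<le> m \<Longrightarrow> j < i \<Longrightarrow> p i \<notin> gball G j v"
    using gball_geodesic[OF assms(1)] by metis
  have m: "0 < m" using mp(2,3) assms(2) by (cases m) auto
  have "\<exists>i<m. len (x - v) \<le> real m * len (p (Suc i) - p i)"
  proof (rule ccontr)
    assume "\<not> ?thesis"
    then have *: "\<And>i. i < m \<Longrightarrow> len (p (Suc i) - p i) < len (x - v) / real m"
      using m by (auto simp: field_simps not_le)
    have "len (x - v) \<le> (\<Sum>i<m. len (p (Suc i) - p i))" using len_sum[of p m] mp by simp
    also have "\<dots> < (\<Sum>i<m. len (x - v) / real m)"
      using m * by (intro sum_strict_mono) auto
    finally show False using m by simp
  qed
  then obtain k where k: "k < m" "len (x - v) \<le> real m * len (p (Suc k) - p k)" by blast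
  define T where "T = insert (p k) (gball_lt G k v)"
  have out: "p i \<notin> T" if "k < i" "i \<le> m" for i
  proof -
    have "p i \<notin> gball G k v" using mp(6) that by auto
    moreover have "T \<subseteq> gball G k v"
      using mp(5)[of k] k(1) gball_mono[of _ k G v]
      by (auto simp: T_def gball_lt_def intro: less_imp_le)
    ultimately show ?thesis by blast
  qed
  have walk: "p (Suc k + j) \<in> gball (off T G) j (p (Suc k))" if "Suc k + j \<le> m" for j
    using that
  proof (induction j)
    case (Suc j)
    then have "p (Suc k + j) \<in> gball (off T G) j (p (Suc k))" by simp
    moreover have "off T G {p (Suc k + j), p (Suc k + Suc j)}"
      using mp(4)[of "Suc k + j"] Suc.prems out by (auto simp: off_def)
    ultimately show ?case
      using gball_step mp(4)[of "Suc k + j"] Suc.prems by (metis Suc_le_lessD add_Suc_right)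
  qed simp
  have "x \<in> gball (off T G) (m - Suc k) (p (Suc k))"
    using walk[of "m - Suc k"] k(1) mp(3) by simp
  then have "x \<in> gball (off T G) (n - 1 - k) (p (Suc k))"
    using gball_mono[of "m - Suc k" "n - 1 - k" "off T G" "p (Suc k)"] mp(1)
    by (simp add: subset_iff)
  moreover have "len (x - v) \<le> real n * len (p k - p (Suc k))"
    using k(2) mp(1) len_commute[of "p k"] by (smt (verit) len_nonneg mult_right_mono of_nat_mono)
  moreover have "p k \<notin> gball_lt G k v" using mp(6)[of k] k(1) by (auto simp: gball_lt_def)
  moreover have "p (Suc k) \<notin> gball_lt G k v" using out[of "Suc k"] k(1) by (simp add: T_def)
  moreover have "k < n" "p k \<in> gball G k v" using k(1) mp(1) mp(5)[of k] by simp_all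
  ultimately show ?thesis
    using that[of k "p k" "p (Suc k)"] mp(4)[OF k(1)] unfolding T_def by blast
qed

text \<open>Exploring the graph from \<open>v\<close> up to distance \<open>k\<close> inspects no edge that avoids all points
  at distance less than \<open>k\<close>.\<close>

lemma gball_explore:
  assumes "gball_lt G k v = T"
    and agree: "\<And>e. card e = 2 \<Longrightarrow> e \<inter> T \<noteq> {} \<Longrightarrow> G e = G' e"
  shows "gball_lt G' k v = T" and "gball G' k v = gball G k v"
proof -
  have *: "gball G' j v = gball G j v" if "j \<le> k" for j
    using that
  proof (induction j)
    case (Suc j)
    then have IH: "gball G' j v = gball G j v" by simp
    have "gball G j v \<subseteq> T"
      unfolding assms(1)[symmetric] gball_lt_def using Suc.prems by (intro UN_upper) simp
    then have "G' {y, z} = G {y, z}" if "y \<in> gball G j v" "y \<noteq> z" for y z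
      using that agree[of "{y, z}"] by (simp add: disjoint_iff subset_iff)
    then have "{z. \<exists>y\<in>gball G j v. y \<noteq> z \<and> G' {y, z}} = {z. \<exists>y\<in>gball G j v. y \<noteq> z \<and> G {y, z}}"
      by (intro Collect_cong bex_cong conj_cong refl)
    then show ?case by (simp add: IH)
  qed simp
  show "gball G' k v = gball G k v" by (rule *) simp
  show "gball_lt G' k v = T" unfolding assms(1)[symmetric] gball_lt_def
    by (intro SUP_cong refl *) simp
qed

section \<open>Independence and measurability\<close>

text \<open>Agreement is asked of arbitrary configurations, also of those outside the space of the product
  measure, which only has functions that are undefined off the index set. This suits functions
  like \<open>gball\<close> that are defined for every configuration.\<close>

definition depends_on :: "'e set \<Rightarrow> (('e \<Rightarrow> 'a) \<Rightarrow> 'b) \<Rightarrow> bool" where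
  "depends_on J f \<longleftrightarrow> (\<forall>G G'. (\<forall>e\<in>J. G e = G' e) \<longrightarrow> f G = f G')"

lemma depends_onI:
  "(\<And>G G'. (\<And>e. e \<in> J \<Longrightarrow> G e = G' e) \<Longrightarrow> f G = f G') \<Longrightarrow> depends_on J f"
  unfolding depends_on_def by blast

lemma depends_onD:
  "depends_on J f \<Longrightarrow> (\<And>e. e \<in> J \<Longrightarrow> G e = G' e) \<Longrightarrow> f G = f G'"
  unfolding depends_on_def by blast

lemma depends_on_mono: "depends_on J f \<Longrightarrow> J \<subseteq> J' \<Longrightarrow> depends_on J' f"
  unfolding depends_on_def by (meson subsetD)

lemma depends_on_compose: "depends_on J f \<Longrightarrow> depends_on J (\<lambda>G. h (f G))"
  unfolding depends_on_def by metis

lemma depends_on_compose2: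
  "depends_on J f \<Longrightarrow> depends_on J g \<Longrightarrow> depends_on J (\<lambda>G. h (f G) (g G))"
  unfolding depends_on_def by metis

lemma indep_vars_PiM_coordinates:
  assumes "\<And>i. prob_space (M i)"
  shows "prob_space.indep_vars (PiM I M) M (\<lambda>i G. G i) I"
proof -
  interpret prob_space "PiM I M" by (intro prob_space_PiM assms)
  show ?thesis
  proof (cases "I = {}")
    case True
    then show ?thesis unfolding indep_vars_def indep_sets_def by auto
  next
    case False
    have "distr (PiM I M) (PiM I M) (\<lambda>x. \<lambda>i\<in>I. x i) = distr (PiM I M) (PiM I M) (\<lambda>x. x)"
      by (intro distr_cong) (auto simp: space_PiM PiE_def extensional_def restrict_def)
    also have "\<dots> = PiM I M" by simp
    also have "\<dots> = PiM I (\<lambda>i. distr (PiM I M) (M i) (\<lambda>x. x i))"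
      by (intro PiM_cong refl) (simp add: distr_PiM_component assms)
    finally show ?thesis
      using False by (subst indep_vars_iff_distr_eq_PiM') auto
  qed
qed

lemma nn_integral_PiM_indep:
  fixes f g :: "('i \<Rightarrow> 'a) \<Rightarrow> ennreal"
  assumes M: "\<And>i. prob_space (M i)"
    and f[measurable]: "f \<in> borel_measurable (PiM I M)"
    and g[measurable]: "g \<in> borel_measurable (PiM I M)"
    and fJ: "depends_on J f" and gK: "depends_on K g" and JK: "J \<inter> K = {}"
  shows "(\<integral>\<^sup>+G. f G * g G \<partial>PiM I M) = (\<integral>\<^sup>+G. f G \<partial>PiM I M) * (\<integral>\<^sup>+G. g G \<partial>PiM I M)"
proof -
  interpret prob_space "PiM I M" by (intro prob_space_PiM M)
  have "\<forall>i. \<exists>x. x \<in> space (M i)" using M prob_space.not_empty by blast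
  then obtain c where c: "\<And>i. c i \<in> space (M i)" by metis
  (* Extending a partial configuration by constants makes f and g functions of the coordinates
     in J and in K alone. *)
  define ext where "ext A x = (\<lambda>i\<in>I. if i \<in> A then x i else c i)" for A and x :: "'i \<Rightarrow> 'a"
  have [measurable]: "ext A \<in> measurable (PiM (A \<inter> I) M) (PiM I M)" for A
    unfolding ext_def
  proof (rule measurable_restrict)
    fix i assume "i \<in> I"
    then show "(\<lambda>x. if i \<in> A then x i else c i) \<in> measurable (PiM (A \<inter> I) M) (M i)"
      using c by (cases "i \<in> A") auto
  qed
  have ext_eq: "h (ext A (\<lambda>i\<in>A \<inter> I. G i)) = h G"
    if "depends_on A h" "G \<in> space (PiM I M)" for A G and h :: "('i \<Rightarrow> 'a) \<Rightarrow> ennreal"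
  proof (rule depends_onD[OF that(1)])
    fix e assume "e \<in> A"
    then show "ext A (\<lambda>i\<in>A \<inter> I. G i) e = G e"
      using that(2) by (auto simp: ext_def space_PiM PiE_def extensional_def)
  qed
  have "indep_var (PiM (J \<inter> I) M) (\<lambda>G. \<lambda>i\<in>J \<inter> I. G i) (PiM (K \<inter> I) M) (\<lambda>G. \<lambda>i\<in>K \<inter> I. G i)"
    using JK by (intro indep_var_restrict[OF indep_vars_PiM_coordinates[OF M]]) auto
  then have "indep_var borel ((\<lambda>x. f (ext J x)) \<circ> (\<lambda>G. \<lambda>i\<in>J \<inter> I. G i))
      borel ((\<lambda>x. g (ext K x)) \<circ> (\<lambda>G. \<lambda>i\<in>K \<inter> I. G i))"
    by (rule indep_var_compose) measurable
  then have iv: "indep_vars (\<lambda>_. borel) (case_bool ((\<lambda>x. f (ext J x)) \<circ> (\<lambda>G. \<lambda>i\<in>J \<inter> I. G i))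
      ((\<lambda>x. g (ext K x)) \<circ> (\<lambda>G. \<lambda>i\<in>K \<inter> I. G i))) UNIV"
    unfolding indep_var_def by (rule back_subst[of "\<lambda>M. indep_vars M _ _"]) (auto split: bool.split)
  let ?f = "\<lambda>G. f (ext J (\<lambda>i\<in>J \<inter> I. G i))" and ?g = "\<lambda>G. g (ext K (\<lambda>i\<in>K \<inter> I. G i))"
  from indep_vars_nn_integral[OF _ iv]
  have "(\<integral>\<^sup>+G. ?f G * ?g G \<partial>PiM I M)
      = (\<integral>\<^sup>+G. ?f G \<partial>PiM I M) * (\<integral>\<^sup>+G. ?g G \<partial>PiM I M)"
    by (simp add: UNIV_bool mult.commute comp_def)
  also have "(\<integral>\<^sup>+G. ?f G * ?g G \<partial>PiM I M)
      = (\<integral>\<^sup>+G. f G * g G \<partial>PiM I M)"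
    by (intro nn_integral_cong arg_cong2[where f = "(*)"] ext_eq fJ gK)
  also have "(\<integral>\<^sup>+G. ?f G \<partial>PiM I M) = (\<integral>\<^sup>+G. f G \<partial>PiM I M)"
    by (intro nn_integral_cong ext_eq fJ)
  also have "(\<integral>\<^sup>+G. ?g G \<partial>PiM I M) = (\<integral>\<^sup>+G. g G \<partial>PiM I M)"
    by (intro nn_integral_cong ext_eq gK)
  finally show ?thesis .
qed

lemma nn_integral_percolation_indep:
  fixes f g :: "((int ^ 'n) set \<Rightarrow> bool) \<Rightarrow> ennreal"
  assumes "f \<in> borel_measurable (percolation q \<beta>)" "g \<in> borel_measurable (percolation q \<beta>)"
    and "depends_on J f" "depends_on K g" "J \<inter> K = {}"
  shows "(\<integral>\<^sup>+G. f G * g G \<partial>percolation q \<beta>)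
    = (\<integral>\<^sup>+G. f G \<partial>percolation q \<beta>) * (\<integral>\<^sup>+G. g G \<partial>percolation q \<beta>)"
  using assms unfolding percolation_def
  by (intro nn_integral_PiM_indep measure_pmf.prob_space_axioms)

abbreviation perc_event :: "(int ^ 'n \<Rightarrow> ennreal) \<Rightarrow> real \<Rightarrow> (((int ^ 'n) set \<Rightarrow> bool) \<Rightarrow> bool) \<Rightarrow> bool" where
  "perc_event q \<beta> \<equiv> Measurable.pred (percolation q \<beta>)"

abbreviation perc_pr :: "(int ^ 'n \<Rightarrow> ennreal) \<Rightarrow> real \<Rightarrow> (((int ^ 'n) set \<Rightarrow> bool) \<Rightarrow> bool) \<Rightarrow> ennreal" where
  "perc_pr q \<beta> A \<equiv> emeasure (percolation q \<beta>) {G \<in> space (percolation q \<beta>). A G}"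

abbreviation reach_pr :: "(int ^ 'n \<Rightarrow> ennreal) \<Rightarrow> real \<Rightarrow> nat \<Rightarrow> int ^ 'n \<Rightarrow> int ^ 'n \<Rightarrow> ennreal" where
  "reach_pr q \<beta> n v x \<equiv> perc_pr q \<beta> (\<lambda>G. x \<in> gball G n v)"

lemma emeasure_percolation_space: "emeasure (percolation q \<beta>) (space (percolation q \<beta>)) = 1"
  by (rule prob_space.emeasure_space_1[OF prob_space_percolation])

lemma perc_pr_le_1: "perc_pr q \<beta> A \<le> 1"
  by (rule prob_space.emeasure_le_1[OF prob_space_percolation])

lemma perc_pr_mono:
  assumes "perc_event q \<beta> B" "\<And>G. A G \<Longrightarrow> B G"
  shows "perc_pr q \<beta> A \<le> perc_pr q \<beta> B"
  using assms by (intro emeasure_mono) auto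

lemma perc_pr_indep:
  fixes A B :: "((int ^ 'n) set \<Rightarrow> bool) \<Rightarrow> bool"
  assumes [measurable]: "perc_event q \<beta> A" "perc_event q \<beta> B"
    and "depends_on J A" "depends_on K B" "J \<inter> K = {}"
  shows "perc_pr q \<beta> (\<lambda>G. A G \<and> B G) = perc_pr q \<beta> A * perc_pr q \<beta> B"
proof -
  let ?P = "percolation q \<beta>"
  have ind: "(\<integral>\<^sup>+G. indicator {G. X G} G \<partial>?P) = perc_pr q \<beta> X"
    if "perc_event q \<beta> X" for X
  proof -
    have "(\<integral>\<^sup>+G. indicator {G. X G} G \<partial>?P) = (\<integral>\<^sup>+G. indicator {G\<in>space ?P. X G} G \<partial>?P)"
      by (intro nn_integral_cong) (auto split: split_indicator)
    also have "\<dots> = perc_pr q \<beta> X" using that by (intro nn_integral_indicator) measurable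
    finally show ?thesis .
  qed
  have "perc_pr q \<beta> (\<lambda>G. A G \<and> B G)
      = (\<integral>\<^sup>+G. indicator {G. A G} G * indicator {G. B G} G \<partial>?P)"
    by (subst ind[symmetric]) (auto intro!: nn_integral_cong split: split_indicator)
  also have "\<dots> = (\<integral>\<^sup>+G. indicator {G. A G} G \<partial>?P) * (\<integral>\<^sup>+G. indicator {G. B G} G \<partial>?P)"
  proof (rule nn_integral_percolation_indep)
    show "depends_on J (indicator {G. A G} :: _ \<Rightarrow> ennreal)"
      using assms(3) by (auto simp: depends_on_def indicator_def)
    show "depends_on K (indicator {G. B G} :: _ \<Rightarrow> ennreal)"
      using assms(4) by (auto simp: depends_on_def indicator_def)
  qed (use assms(5) in \<open>auto intro!: borel_measurable_indicator'\<close>)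
  finally show ?thesis by (simp add: ind)
qed

lemma pred_edge [measurable]:
  assumes "e \<in> all_edges"
  shows "perc_event q \<beta> (\<lambda>G. G e)"
proof -
  have "(\<lambda>G. G e) \<in> measurable (percolation q \<beta>) (measure_pmf (bernoulli_pmf (edge_prob q \<beta> e)))"
    unfolding percolation_def using assms by measurable
  then show ?thesis by (simp cong: measurable_cong_sets)
qed

lemma doubleton_in_all_edges [simp]: "{x, y} \<in> all_edges \<longleftrightarrow> x \<noteq> y"
  by (auto simp: all_edges_def card_2_iff)

lemma pred_gball:
  fixes h :: "'w \<Rightarrow> ('v::countable) set \<Rightarrow> bool"
  assumes [measurable]: "\<And>e. card e = 2 \<Longrightarrow> Measurable.pred M (\<lambda>G. h G e)"
  shows "Measurable.pred M (\<lambda>G. x \<in> gball (h G) n v)"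
proof (induction n arbitrary: x)
  case (Suc n)
  have [measurable]: "Measurable.pred M (\<lambda>G. y \<noteq> x \<and> h G {y, x})" for y
    by (cases "y = x") (use assms[of "{y, x}"] in auto)
  have "(\<lambda>G. x \<in> gball (h G) (Suc n) v)
      = (\<lambda>G. x \<in> gball (h G) n v \<or> (\<exists>y. y \<in> gball (h G) n v \<and> (y \<noteq> x \<and> h G {y, x})))"
    by auto
  also have "Measurable.pred M \<dots>" using Suc[measurable] by measurable
  finally show ?case .
qed simp

lemma pred_gball_percolation [measurable]:
  "perc_event q \<beta> (\<lambda>G. x \<in> gball G n v)"
  by (rule pred_gball) (simp add: pred_edge all_edges_def)

lemma pred_gball_off_percolation [measurable]:
  "perc_event q \<beta> (\<lambda>G. x \<in> gball (off T G) n v)"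
  by (rule pred_gball) (auto simp: off_def intro!: pred_intros_logic pred_edge simp: all_edges_def)

lemma pred_gball_lt_eq [measurable]:
  "perc_event q \<beta> (\<lambda>G. gball_lt G k v = T)"
proof -
  have "(\<lambda>G. gball_lt G k v = T) = (\<lambda>G. \<forall>x. (\<exists>j<k. x \<in> gball G j v) \<longleftrightarrow> x \<in> T)"
    by (auto simp: gball_lt_def fun_eq_iff set_eq_iff)
  also have "perc_event q \<beta> \<dots>" by measurable
  finally show ?thesis .
qed

lemma edge_prob_bounds:
  assumes "\<And>x. q x = q (- x)" "0 \<le> \<beta>" "e \<in> all_edges"
  shows "0 \<le> edge_prob q \<beta> e" "edge_prob q \<beta> e \<le> 1"
proof -
  obtain x y where "e = {x, y}" "x \<noteq> y" using assms(3) by (auto simp: all_edges_def card_2_iff)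
  then have "edge_prob q \<beta> e = connection_prob q \<beta> x y" using edge_prob_eq[where q = q, OF assms(1)] by blast
  then show "0 \<le> edge_prob q \<beta> e" "edge_prob q \<beta> e \<le> 1"
    using connection_prob_bounds[OF assms(2)] by simp_all
qed

lemma perc_pr_edge:
  assumes "\<And>x. q x = q (- x)" "0 \<le> \<beta>" "x \<noteq> y"
  shows "perc_pr q \<beta> (\<lambda>G. G {x, y}) = ennreal (connection_prob q \<beta> x y)"
    and "perc_pr q \<beta> (\<lambda>G. \<not> G {x, y}) = ennreal (1 - connection_prob q \<beta> x y)"
proof -
  let ?M = "\<lambda>e. measure_pmf (bernoulli_pmf (edge_prob q \<beta> e))"
  have e: "{x, y} \<in> all_edges" using assms(3) by simp
  have p: "0 \<le> edge_prob q \<beta> {x, y}" "edge_prob q \<beta> {x, y} \<le> 1"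
    using edge_prob_bounds[where q = q, OF assms(1,2) e] by auto
  have *: "perc_pr q \<beta> (\<lambda>G. G {x, y} = b) = ennreal (pmf (bernoulli_pmf (edge_prob q \<beta> {x, y})) b)" for b
  proof -
    have "ennreal (pmf (bernoulli_pmf (edge_prob q \<beta> {x, y})) b) = emeasure (?M {x, y}) {b}"
      by (simp add: emeasure_pmf_single)
    also have "\<dots> = emeasure (distr (PiM all_edges ?M) (?M {x, y}) (\<lambda>G. G {x, y})) {b}"
      using e by (subst distr_PiM_component) (auto intro: measure_pmf.prob_space_axioms)
    also have "\<dots> = emeasure (PiM all_edges ?M) ((\<lambda>G. G {x, y}) -` {b} \<inter> space (PiM all_edges ?M))"
      using pred_edge[OF e, of q \<beta>] unfolding percolation_def
      by (intro emeasure_distr) (simp_all cong: measurable_cong_sets)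
    also have "\<dots> = perc_pr q \<beta> (\<lambda>G. G {x, y} = b)"
      unfolding percolation_def by (intro arg_cong2[where f = emeasure]) auto
    finally show ?thesis ..
  qed
  show "perc_pr q \<beta> (\<lambda>G. G {x, y}) = ennreal (connection_prob q \<beta> x y)"
    using *[of True] p edge_prob_eq[where q = q, OF assms(1,3), of \<beta>] by simp
  show "perc_pr q \<beta> (\<lambda>G. \<not> G {x, y}) = ennreal (1 - connection_prob q \<beta> x y)"
    using *[of False] p edge_prob_eq[where q = q, OF assms(1,3), of \<beta>] by simp
qed

locale long_range_percolation = lattice_norm N for N :: "real ^ 'n \<Rightarrow> real" +
  fixes s :: real and q :: "int ^ 'n \<Rightarrow> ennreal"
  assumes s_gt: "real CARD('n) < s" and s_lt: "s < 2 * real CARD('n)"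
    and admissible: "admissible_q N s q"
begin

lemma q_sym: "q x = q (- x)"
  using admissible unfolding admissible_q_def by blast

lemma s_ge_1: "1 \<le> s"
  using s_gt by (smt (verit) One_nat_def Suc_leI of_nat_1 of_nat_mono zero_less_card_finite)

lemma s_pos: "0 < s"
  using s_ge_1 by linarith

lemma q_asymptotics:
  obtains \<rho> where "1 \<le> \<rho>"
    "\<And>x. \<rho> \<le> len x \<Longrightarrow> q x \<noteq> \<infinity> \<and> len x powr (- s) / 2 \<le> enn2real (q x) \<and> enn2real (q x) \<le> 2 * len x powr (- s)"
proof -
  have lim: "((\<lambda>x. q x * ennreal (N (real_vec x) powr s)) \<longlongrightarrow> 1)
       (filtercomap (\<lambda>x. N (real_vec x)) at_top)"
    using admissible unfolding admissible_q_def by blast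
  have "eventually (\<lambda>x. ennreal (1/2) < q x * ennreal (N (real_vec x) powr s) \<and>
      q x * ennreal (N (real_vec x) powr s) < ennreal 2) (filtercomap (\<lambda>x. N (real_vec x)) at_top)"
  proof (intro eventually_conj order_tendstoD[OF lim])
    show "ennreal (1/2) < 1" "1 < ennreal 2"
      using ennreal_lessI[of 1 "1/2"] ennreal_lessI[of 2 1] by simp_all
  qed
  then obtain \<rho>\<^sub>0 where \<rho>0: "\<And>x. \<rho>\<^sub>0 \<le> len x \<Longrightarrow> ennreal (1/2) < q x * ennreal (len x powr s) \<and>
      q x * ennreal (len x powr s) < ennreal 2"
    unfolding eventually_filtercomap_at_top_linorder len_def by blast
  show ?thesis
  proof (rule that[of "max 1 \<rho>\<^sub>0"])
    fix x assume x: "max 1 \<rho>\<^sub>0 \<le> len x"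
    define L where "L = len x powr s"
    have "0 < len x" using x by linarith
    then have L: "0 < L" unfolding L_def by (simp only: powr_gt_zero)
    have b: "ennreal (1/2) < q x * ennreal L" "q x * ennreal L < ennreal 2"
      using \<rho>0[of x] x by (auto simp: L_def)
    have fin: "q x \<noteq> \<infinity>"
    proof
      assume "q x = \<infinity>"
      then have "q x * ennreal L = \<infinity>" using L by (simp add: ennreal_top_mult)
      then show False using b(2) by simp
    qed
    define r where "r = enn2real (q x)"
    have qr: "q x = ennreal r" "0 \<le> r" using fin by (auto simp: r_def less_top)
    have "q x * ennreal L = ennreal (r * L)" using qr L by (simp add: ennreal_mult)
    then have "ennreal (1/2) < ennreal (r * L)" "ennreal (r * L) < ennreal 2" using b by simp_all
    then have "1/2 < r * L" "r * L < 2"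
      using ennreal_less_iff[of "1/2" "r * L"] ennreal_less_iff[of "r * L" 2] qr(2) L by simp_all
    then show "q x \<noteq> \<infinity> \<and> len x powr (- s) / 2 \<le> enn2real (q x) \<and> enn2real (q x) \<le> 2 * len x powr (- s)"
      using fin L by (simp add: powr_minus field_simps r_def flip: L_def)
  qed simp
qed

lemma connection_prob_lower:
  obtains \<rho> where "1 \<le> \<rho>"
    "\<And>\<beta> x y. 0 \<le> \<beta> \<Longrightarrow> \<rho> \<le> len (x - y) \<Longrightarrow>
       1 - connection_prob q \<beta> x y \<le> exp (- (\<beta> / 2 * len (x - y) powr (- s)))"
proof -
  obtain \<rho> where \<rho>: "1 \<le> \<rho>" "\<And>x. \<rho> \<le> len x \<Longrightarrow> q x \<noteq> \<infinity> \<and> len x powr (- s) / 2 \<le> enn2real (q x)"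
    using q_asymptotics by metis
  show ?thesis
  proof (rule that[OF \<rho>(1)])
    fix \<beta> :: real and x y assume "0 \<le> \<beta>" "\<rho> \<le> len (x - y)"
    then show "1 - connection_prob q \<beta> x y \<le> exp (- (\<beta> / 2 * len (x - y) powr (- s)))"
      using \<rho>(2)[of "x - y"] mult_left_mono[of "len (x - y) powr (- s) / 2" "enn2real (q (x - y))" \<beta>]
      by (simp add: connection_prob_def)
  qed
qed

lemma connection_prob_upper:
  obtains C where "1 \<le> C"
    "\<And>\<beta> x y. 1 \<le> \<beta> \<Longrightarrow> x \<noteq> y \<Longrightarrow> connection_prob q \<beta> x y \<le> C * \<beta> * len (x - y) powr (- s)"
proof -
  obtain \<rho> where \<rho>: "1 \<le> \<rho>" "\<And>x. \<rho> \<le> len x \<Longrightarrow> q x \<noteq> \<infinity> \<and> enn2real (q x) \<le> 2 * len x powr (- s)"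
    using q_asymptotics by metis
  define C where "C = 2 * \<rho> powr s"
  have C: "2 \<le> C" "\<rho> powr s \<le> C" using \<rho>(1) s_pos ge_one_powr_ge_zero[of \<rho> s] by (auto simp: C_def)
  show ?thesis
  proof (rule that)
    show "1 \<le> C" using C by simp
    fix \<beta> :: real and x y :: "int ^ 'n" assume \<beta>: "1 \<le> \<beta>" and xy: "x \<noteq> y"
    have L: "0 < len (x - y)" using xy by (intro len_pos) simp
    show "connection_prob q \<beta> x y \<le> C * \<beta> * len (x - y) powr (- s)"
    proof (cases "\<rho> \<le> len (x - y)")
      case True
      have "connection_prob q \<beta> x y \<le> \<beta> * enn2real (q (x - y))"
        using \<rho>(2)[OF True] exp_ge_add_one_self[of "- \<beta> * enn2real (q (x - y))"]
        by (simp add: connection_prob_def)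
      also have "\<dots> \<le> \<beta> * (2 * len (x - y) powr (- s))"
        using \<rho>(2)[OF True] \<beta> by (intro mult_left_mono) auto
      also have "\<dots> \<le> \<beta> * (C * len (x - y) powr (- s))"
        using \<beta> C(1) by (intro mult_left_mono mult_right_mono) auto
      finally show ?thesis by (simp add: ac_simps)
    next
      case False
      then have "len (x - y) powr s \<le> \<rho> powr s" using L s_pos by (intro powr_mono2) auto
      then have "len (x - y) powr s \<le> C" using C(2) by simp
      then have "1 \<le> C * len (x - y) powr (- s)"
        using xy by (simp add: powr_minus_divide pos_le_divide_eq)
      also have "\<dots> \<le> \<beta> * (C * len (x - y) powr (- s))"
        using \<beta> C(1) mult_right_mono[of 1 \<beta> "C * len (x - y) powr (- s)"] by simp
      finally show ?thesis using connection_prob_bounds(2)[of \<beta> q x y] \<beta> by (simp add: ac_simps)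
    qed
  qed
qed

end

section \<open>A subexponential solution of the growth recursion\<close>

text \<open>Concavity of the power, from the convexity of \<open>exp\<close>.\<close>

lemma powr_add_le_midpoint:
  fixes x y \<theta> :: real
  assumes "0 < x" "0 < y" "0 < \<theta>" "\<theta> < 1"
  shows "x powr \<theta> + y powr \<theta> \<le> 2 * ((x + y) / 2) powr \<theta>"
proof -
  have *: "t powr \<theta> \<le> \<theta> * t + (1 - \<theta>)" if "0 < t" for t :: real
    using convex_onD[OF exp_convex, of \<theta> 0 "ln t"] assms that by (simp add: powr_def)
  define m where "m = (x + y) / 2"
  have m: "0 < m" using assms by (simp add: m_def)
  have "(x / m) powr \<theta> + (y / m) powr \<theta> \<le> \<theta> * (x / m) + (1 - \<theta>) + (\<theta> * (y / m) + (1 - \<theta>))"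
    using assms m by (intro add_mono *) auto
  also have "\<dots> = \<theta> * ((x + y) / m) + 2 * (1 - \<theta>)" by (simp add: algebra_simps add_divide_distrib)
  also have "x + y = 2 * m" by (simp add: m_def)
  finally have "(x / m) powr \<theta> + (y / m) powr \<theta> \<le> 2" using m by (simp add: algebra_simps)
  then show ?thesis using assms m by (simp add: powr_divide field_simps flip: m_def)
qed

text \<open>The function \<open>h\<close> will bound the logarithm of the mean size of a ball of radius \<open>m - 1\<close>, and \<open>\<Lambda>\<close> is
  of order \<open>ln \<beta>\<close>. The solution is \<open>h m = a * m powr \<theta> - b * ln m - e\<close>. By the choice of \<open>\<theta>\<close>,
  \<open>\<mu> * (i powr \<theta> + j powr \<theta>) \<le> (i + j) powr \<theta>\<close> with equality for \<open>i = j\<close>, so the leading terms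
  leave no room when \<open>i\<close> and \<open>j\<close> are equal. If both are at least the fraction \<open>\<delta>\<close> of their sum, the
  logarithmic and the constant term occur \<open>2 * \<mu> > 1\<close> times on the left, and this gains what is
  needed for \<open>\<sigma> * ln (i + j)\<close> and \<open>\<Lambda>\<close>. If one of them is smaller, the inequality between the
  leading terms is strict by a fixed fraction of \<open>(i + j) powr \<theta>\<close>, which exceeds any logarithm
  once \<open>a\<close> is large.\<close>

lemma growth_recursion_solution:
  fixes \<mu> \<sigma> \<theta> :: real
  assumes \<mu>: "1/2 < \<mu>" "\<mu> < 1" and \<sigma>: "0 \<le> \<sigma>" and \<theta>: "2 powr \<theta> = 2 * \<mu>"
  obtains K where "0 < K"
    "\<And>\<Lambda>. 1 \<le> \<Lambda> \<Longrightarrow> \<exists>h :: nat \<Rightarrow> real. 0 \<le> h 1 \<and> (\<forall>m\<ge>1. h m \<le> K * \<Lambda> * real m powr \<theta>) \<and>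
       (\<forall>i\<ge>1. \<forall>j\<ge>1. h i + h j + \<sigma> * ln (real (i + j)) \<le> (h (i + j) - \<Lambda>) / \<mu>)"
proof -
  have \<theta>01: "0 < \<theta>" "\<theta> < 1"
    using \<theta> \<mu> powr_less_mono[of 1 \<theta> 2] powr_mono[of \<theta> 0 2] powr_mono[of 1 \<theta> 2]
    by (auto simp: not_less[symmetric])
  have conc: "\<mu> * (x powr \<theta> + y powr \<theta>) \<le> (x + y) powr \<theta>" if "0 < x" "0 < y" for x y :: real
  proof -
    have "\<mu> * (x powr \<theta> + y powr \<theta>) \<le> \<mu> * (2 * ((x + y) / 2) powr \<theta>)"
      using \<mu> that \<theta>01 by (intro mult_left_mono powr_add_le_midpoint) auto
    also have "\<dots> = (x + y) powr \<theta>" using that \<mu> by (simp add: powr_divide \<theta>)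
    finally show ?thesis .
  qed
  (* b and, further below, e are the solutions of the linear equations that the case of comparable
     i and j imposes; k2 is the surplus of a over e that the other case requires. *)
  define b where "b = \<mu> * \<sigma> / (2 * \<mu> - 1)"
  have b: "0 \<le> b" "(2 * \<mu> - 1) * b = \<mu> * \<sigma>" using \<mu> \<sigma> by (auto simp: b_def)
  define \<delta> where "\<delta> = ((1 - \<mu>) / (2 * \<mu>)) powr (1 / \<theta>)"
  have \<delta>\<theta>: "\<delta> powr \<theta> = (1 - \<mu>) / (2 * \<mu>)" using \<mu> \<theta>01 by (simp add: \<delta>_def powr_powr)
  have \<delta>: "0 < \<delta>" using \<mu> by (simp add: \<delta>_def)
  have "(1 - \<mu>) / (2 * \<mu>) \<le> 1" using \<mu> by (simp add: divide_le_eq)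
  then have \<delta>1: "\<delta> \<le> 1" using \<mu> \<theta>01 unfolding \<delta>_def by (intro powr_le1) auto
  define k1 where "k1 = 2 * \<mu> * b * (- ln \<delta>)"
  have k1: "0 \<le> k1" using \<mu> b \<delta> \<delta>1 unfolding k1_def by (intro mult_nonneg_nonneg) auto
  define k2 where "k2 = (\<mu> * \<sigma> + b) / ((1 - \<mu>) / 2 * \<theta>)"
  have k2: "0 \<le> k2" using \<mu> b \<sigma> \<theta>01 unfolding k2_def by (intro divide_nonneg_nonneg) auto
  define K where "K = (1 + k1) / (2 * \<mu> - 1) + k2"
  have "0 < K" using k1 k2 \<mu> by (auto simp: K_def intro!: add_pos_nonneg)
  moreover have "\<exists>h :: nat \<Rightarrow> real. 0 \<le> h 1 \<and> (\<forall>m\<ge>1. h m \<le> K * \<Lambda> * real m powr \<theta>) \<and>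
       (\<forall>i\<ge>1. \<forall>j\<ge>1. h i + h j + \<sigma> * ln (real (i + j)) \<le> (h (i + j) - \<Lambda>) / \<mu>)" if \<Lambda>: "1 \<le> \<Lambda>" for \<Lambda>
  proof -
    define e where "e = (\<Lambda> + k1) / (2 * \<mu> - 1)"
    have e: "0 \<le> e" "(2 * \<mu> - 1) * e = \<Lambda> + k1" using \<mu> \<Lambda> k1 by (auto simp: e_def)
    define a where "a = e + k2"
    have a: "0 \<le> a" using e k2 by (simp add: a_def)
    have aK: "a \<le> K * \<Lambda>"
    proof -
      have "e \<le> (1 + k1) / (2 * \<mu> - 1) * \<Lambda>"
        using \<mu> \<Lambda> k1 mult_left_mono[OF \<Lambda> k1] by (simp add: e_def divide_right_mono algebra_simps)
      moreover have "k2 \<le> k2 * \<Lambda>" using mult_left_mono[OF \<Lambda> k2] by simp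
      ultimately show ?thesis by (simp add: a_def K_def algebra_simps)
    qed
    define h where "h m = a * real m powr \<theta> - b * ln (real m) - e" for m :: nat
    have main: "h i + h j + \<sigma> * ln (real (i + j)) \<le> (h (i + j) - \<Lambda>) / \<mu>"
      if ij: "1 \<le> j" "j \<le> i" for i j
    proof -
      define m where "m = real (i + j)"
      have pos: "0 < real i" "0 < real j" "1 \<le> m" "real i \<le> m" "m = real i + real j"
        using ij by (auto simp: m_def)
      have "\<mu> * (h i + h j) + \<mu> * \<sigma> * ln m + \<Lambda> \<le> h (i + j)"
      proof (cases "\<delta> * m \<le> real j")
        case True
        have l: "ln \<delta> + ln m \<le> ln (real k)" if "real k \<ge> \<delta> * m" for k
        proof -
          have "ln (\<delta> * m) \<le> ln (real k)" using that \<delta> pos by (intro ln_mono) auto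
          then show ?thesis using \<delta> pos by (simp add: ln_mult)
        qed
        have "2 * (ln \<delta> + ln m) \<le> ln (real i) + ln (real j)"
          using l[of i] l[of j] True ij by simp
        then have "\<mu> * b * (2 * (ln \<delta> + ln m)) \<le> \<mu> * b * (ln (real i) + ln (real j))"
          using \<mu> b by (intro mult_left_mono) auto
        moreover have "a * (\<mu> * (real i powr \<theta> + real j powr \<theta>)) \<le> a * m powr \<theta>"
          using conc[of "real i" "real j"] pos a by (intro mult_left_mono) auto
        moreover have "2 * \<mu> * b * ln m = b * ln m + \<mu> * \<sigma> * ln m"
          unfolding b(2)[symmetric] by (simp add: algebra_simps)
        ultimately show ?thesis
          using e(2) unfolding h_def k1_def m_def[symmetric] by (simp add: algebra_simps)
      next
        case False
        have c0: "0 < (1 - \<mu>) / 2" using \<mu> by simp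
        have "real j powr \<theta> \<le> (\<delta> * m) powr \<theta>" using False pos \<theta>01 by (intro powr_mono2) auto
        also have "\<dots> = (1 - \<mu>) / (2 * \<mu>) * m powr \<theta>" using \<delta> pos by (simp add: powr_mult \<delta>\<theta>)
        finally have "\<mu> * real j powr \<theta> \<le> (1 - \<mu>) / 2 * m powr \<theta>" using \<mu> by (simp add: field_simps)
        moreover have "\<mu> * real i powr \<theta> \<le> \<mu> * m powr \<theta>"
          using pos \<theta>01 \<mu> by (intro mult_left_mono powr_mono2) auto
        moreover have "\<mu> * m powr \<theta> = m powr \<theta> - 2 * ((1 - \<mu>) / 2 * m powr \<theta>)"
          by (simp add: field_simps)
        ultimately have "\<mu> * (real i powr \<theta> + real j powr \<theta>) \<le> m powr \<theta> - (1 - \<mu>) / 2 * m powr \<theta>"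
          unfolding distrib_left by linarith
        then have 1: "a * (\<mu> * (real i powr \<theta> + real j powr \<theta>)) \<le> a * (m powr \<theta> - (1 - \<mu>) / 2 * m powr \<theta>)"
          using a by (rule mult_left_mono)
        have "\<theta> * ln m \<le> m powr \<theta>" using ln_powr_bound[of m \<theta>] pos \<theta>01 by (simp add: field_simps)
        then have "(\<mu> * \<sigma> + b) * (\<theta> * ln m) \<le> (\<mu> * \<sigma> + b) * m powr \<theta>"
          using \<mu> \<sigma> b by (intro mult_left_mono) auto
        also have "\<mu> * \<sigma> + b = k2 * ((1 - \<mu>) / 2) * \<theta>" using c0 \<theta>01 by (simp add: k2_def)
        finally have "k2 * ((1 - \<mu>) / 2) * \<theta> * ln m * \<theta> \<le> k2 * ((1 - \<mu>) / 2) * m powr \<theta> * \<theta>"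
          by (simp only: ac_simps)
        then have "k2 * ((1 - \<mu>) / 2) * \<theta> * ln m \<le> k2 * ((1 - \<mu>) / 2) * m powr \<theta>"
          using \<theta>01(1) by (rule mult_right_le_imp_le)
        moreover have "k2 * ((1 - \<mu>) / 2) * \<theta> = \<mu> * \<sigma> + b" using c0 \<theta>01 by (simp add: k2_def)
        ultimately have "(\<mu> * \<sigma> + b) * ln m \<le> k2 * ((1 - \<mu>) / 2) * m powr \<theta>" by (simp only:)
        also have "\<dots> \<le> a * ((1 - \<mu>) / 2) * m powr \<theta>"
          using c0 e by (intro mult_right_mono) (auto simp: a_def)
        finally have 2: "(\<mu> * \<sigma> + b) * ln m \<le> a * ((1 - \<mu>) / 2) * m powr \<theta>" .
        define w where "w = a * ((1 - \<mu>) / 2) * m powr \<theta>"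
        have w1: "a * (\<mu> * (real i powr \<theta> + real j powr \<theta>)) \<le> a * m powr \<theta> - w"
          using 1 by (simp only: w_def right_diff_distrib mult.assoc)
        have w2: "(\<mu> * \<sigma> + b) * ln m \<le> w" using 2 by (simp only: w_def)
        have 3: "0 \<le> \<mu> * b * (ln (real i) + ln (real j))" using \<mu> b ij by (intro mult_nonneg_nonneg) auto
        show ?thesis
          using w1 w2 3 e(2) k1 unfolding h_def m_def[symmetric] by (simp add: algebra_simps)
      qed
      then show ?thesis using \<mu> by (simp add: m_def field_simps)
    qed
    have "h i + h j + \<sigma> * ln (real (i + j)) \<le> (h (i + j) - \<Lambda>) / \<mu>" if "1 \<le> i" "1 \<le> j" for i j
      using main[of j i] main[of i j] that by (cases "j \<le> i") (simp_all add: add.commute)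
    moreover have "0 \<le> h 1" using k2 by (simp add: h_def a_def)
    moreover have "h m \<le> K * \<Lambda> * real m powr \<theta>" if "1 \<le> m" for m
    proof -
      have "0 \<le> b * ln (real m)" using b(1) that by (intro mult_nonneg_nonneg) auto
      then have "h m \<le> a * real m powr \<theta>" using e(1) unfolding h_def by linarith
      also have "\<dots> \<le> K * \<Lambda> * real m powr \<theta>" using aK by (intro mult_right_mono) auto
      finally show ?thesis .
    qed
    ultimately show ?thesis by blast
  qed
  ultimately show ?thesis using that by blast
qed

section \<open>Expected size of the balls in the graph metric\<close>

lemma emeasure_UN_count_space_le:
  assumes I: "countable I" and [measurable]: "\<And>i. i \<in> I \<Longrightarrow> X i \<in> sets M"
  shows "emeasure M (\<Union>i\<in>I. X i) \<le> (\<integral>\<^sup>+i. emeasure M (X i) \<partial>count_space I)"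
proof -
  have "emeasure M (\<Union>i\<in>I. X i) = (\<integral>\<^sup>+x. indicator (\<Union>i\<in>I. X i) x \<partial>M)"
    using I by (intro nn_integral_indicator[symmetric]) auto
  also have "\<dots> \<le> (\<integral>\<^sup>+x. (\<integral>\<^sup>+i. indicator (X i) x \<partial>count_space I) \<partial>M)"
  proof (intro nn_integral_mono)
    fix x
    show "indicator (\<Union>i\<in>I. X i) x \<le> (\<integral>\<^sup>+i. indicator (X i) x \<partial>count_space I)"
    proof (cases "\<exists>i\<in>I. x \<in> X i")
      case True
      then obtain i where i: "i \<in> I" "x \<in> X i" by blast
      have "1 = (\<integral>\<^sup>+j. indicator {i} j \<partial>count_space I)"
        using i by (subst nn_integral_indicator) (auto simp: emeasure_count_space_finite)
      also have "\<dots> \<le> (\<integral>\<^sup>+i. indicator (X i) x \<partial>count_space I)"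
        using i by (intro nn_integral_mono) (auto split: split_indicator)
      finally show ?thesis using i by (auto simp: indicator_def)
    qed auto
  qed
  also have "\<dots> = (\<integral>\<^sup>+i. emeasure M (X i) \<partial>count_space I)"
    using I by (subst nn_integral_count_space_nn_integral) (auto intro!: nn_integral_cong)
  finally show ?thesis .
qed

lemma perc_pr_Bex_le:
  assumes "countable I" "\<And>i. i \<in> I \<Longrightarrow> perc_event q \<beta> (A i)"
  shows "perc_pr q \<beta> (\<lambda>G. \<exists>i\<in>I. A i G) \<le> (\<integral>\<^sup>+i. perc_pr q \<beta> (A i) \<partial>count_space I)"
proof -
  have "{G \<in> space (percolation q \<beta>). \<exists>i\<in>I. A i G} = (\<Union>i\<in>I. {G \<in> space (percolation q \<beta>). A i G})"
    by auto
  then show ?thesis using assms emeasure_UN_count_space_le[of I "\<lambda>i. {G \<in> space (percolation q \<beta>). A i G}"]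
    by (simp add: pred_def)
qed

definition mean_gball_size :: "(int ^ 'n \<Rightarrow> ennreal) \<Rightarrow> real \<Rightarrow> nat \<Rightarrow> int ^ 'n \<Rightarrow> ennreal" where
  "mean_gball_size q \<beta> n v = (\<integral>\<^sup>+x. reach_pr q \<beta> n v x \<partial>count_space UNIV)"

lemma AE_finite_gball:
  assumes "mean_gball_size q \<beta> n v \<noteq> \<infinity>"
  shows "AE G in percolation q \<beta>. finite (gball G n v)"
proof -
  let ?P = "percolation q \<beta>"
  have meas: "(\<lambda>G. indicator (gball G n v) x :: ennreal) \<in> borel_measurable ?P" for x
    by (rule borel_measurable_indicator') measurable
  have "(\<integral>\<^sup>+G. (\<integral>\<^sup>+x. indicator (gball G n v) x \<partial>count_space UNIV) \<partial>?P)
      = (\<integral>\<^sup>+x. (\<integral>\<^sup>+G. indicator (gball G n v) x \<partial>?P) \<partial>count_space UNIV)"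
    using meas by (intro nn_integral_count_space_nn_integral) auto
  also have "\<dots> = mean_gball_size q \<beta> n v"
    unfolding mean_gball_size_def
  proof (intro nn_integral_cong)
    fix x
    have "(\<integral>\<^sup>+G. indicator (gball G n v) x \<partial>?P)
        = (\<integral>\<^sup>+G. indicator {G\<in>space ?P. x \<in> gball G n v} G \<partial>?P)"
      by (intro nn_integral_cong) (auto split: split_indicator)
    also have "\<dots> = reach_pr q \<beta> n v x" by (intro nn_integral_indicator) measurable
    finally show "(\<integral>\<^sup>+G. indicator (gball G n v) x \<partial>?P) = reach_pr q \<beta> n v x" .
  qed
  finally have "AE G in ?P. (\<integral>\<^sup>+x. indicator (gball G n v) x \<partial>count_space UNIV) \<noteq> \<infinity>"
  proof (intro nn_integral_PInf_AE)
    interpret sigma_finite_measure "count_space (UNIV :: (int ^ 'n) set)"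
      by (intro sigma_finite_measure_count_space_countable) simp
    have "(\<lambda>(x, G). indicator (gball G n v) x :: ennreal) \<in> borel_measurable (count_space UNIV \<Otimes>\<^sub>M ?P)"
      using meas by (intro measurable_pair_measure_countable1) auto
    from measurable_pair_swap[OF this]
    have "(\<lambda>(G, x). indicator (gball G n v) x :: ennreal) \<in> borel_measurable (?P \<Otimes>\<^sub>M count_space UNIV)"
      by simp
    then show "(\<lambda>G. \<integral>\<^sup>+x. indicator (gball G n v) x \<partial>count_space UNIV) \<in> borel_measurable ?P"
      by (rule borel_measurable_nn_integral)
  qed (use assms in simp)
  then show ?thesis
    by eventually_elim (auto simp: emeasure_count_space split: if_splits)
qed

text \<open>Once the set \<open>gball_lt G k v\<close> is fixed, reaching \<open>y\<close> is an event about edges that meet this set,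
  and the other two events are about edges that do not. So the three of them are independent
  given this set, and it remains to sum over its values, which are finite sets and therefore
  countably many. This is an inequality of van den Berg-Kesten type for two connections and an
  edge between them.\<close>

lemma perc_pr_split_at_edge:
  fixes q :: "int ^ 'n \<Rightarrow> ennreal"
  assumes sym: "\<And>x. q x = q (- x)" and \<beta>: "0 \<le> \<beta>" and yz: "y \<noteq> z"
    and fin: "AE G in percolation q \<beta>. finite (gball G k v)"
  shows "perc_pr q \<beta> (\<lambda>G. y \<in> gball G k v \<and> y \<notin> gball_lt G k v \<and> z \<notin> gball_lt G k v \<and> G {y, z} \<and>
        x \<in> gball (off (insert y (gball_lt G k v)) G) m z)
    \<le> reach_pr q \<beta> k v y * ennreal (connection_prob q \<beta> y z) *
      reach_pr q \<beta> m z x" (is "perc_pr q \<beta> ?L \<le> _")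
proof -
  let ?P = "percolation q \<beta>"
  define F where "F = {T :: (int ^ 'n) set. finite T \<and> y \<notin> T \<and> z \<notin> T}"
  have "F \<subseteq> Collect finite" by (auto simp: F_def)
  then have cF: "countable F" using countable_subset[OF _ countable_Collect_finite] by blast
  define A where "A T G \<longleftrightarrow> gball_lt G k v = T \<and> y \<in> gball G k v" for T G
  define B where "B T G \<longleftrightarrow> G {y, z} \<and> x \<in> gball (off (insert y T) G) m z" for T G
  have e: "{y, z} \<in> all_edges" using yz by simp
  have Am[measurable]: "Measurable.pred ?P (A T)" for T unfolding A_def by measurable
  have Bm[measurable]: "Measurable.pred ?P (B T)" for T
    unfolding B_def using pred_edge[OF e, of q \<beta>] by measurable
  have each: "perc_pr q \<beta> (\<lambda>G. A T G \<and> B T G) \<le> perc_pr q \<beta> (A T) *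
      (ennreal (connection_prob q \<beta> y z) * reach_pr q \<beta> m z x)" if T: "T \<in> F" for T
  proof -
    have dA: "depends_on {e. card e = 2 \<and> e \<inter> T \<noteq> {}} (A T)"
    proof (rule depends_onI)
      fix G G' :: "(int ^ 'n) set \<Rightarrow> bool"
      assume agree: "\<And>e. e \<in> {e. card e = 2 \<and> e \<inter> T \<noteq> {}} \<Longrightarrow> G e = G' e"
      have "A T G2" if "A T G1" "\<And>e. card e = 2 \<Longrightarrow> e \<inter> T \<noteq> {} \<Longrightarrow> G1 e = G2 e" for G1 G2
        using gball_explore[of G1 k v T G2] that by (simp add: A_def)
      from this[of G G'] this[of G' G] agree show "A T G = A T G'" by auto
    qed
    have d1: "depends_on {{y, z}} (\<lambda>G. G {y, z})"
      by (rule depends_onI) auto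
    have d2: "depends_on {e. card e = 2 \<and> e \<inter> insert y T = {}} (\<lambda>G. x \<in> gball (off (insert y T) G) m z)"
    proof (rule depends_onI)
      fix G G' :: "(int ^ 'n) set \<Rightarrow> bool"
      assume "\<And>e. e \<in> {e. card e = 2 \<and> e \<inter> insert y T = {}} \<Longrightarrow> G e = G' e"
      then have *: "off (insert y T) G {a, b} = off (insert y T) G' {a, b}" if "a \<noteq> b" for a b
        using that unfolding off_def by (cases "{a, b} \<inter> insert y T = {}") auto
      have "gball (off (insert y T) G) m z = gball (off (insert y T) G') m z"
        using gball_mono_config[of "off (insert y T) G" "off (insert y T) G'" m z]
          gball_mono_config[of "off (insert y T) G'" "off (insert y T) G" m z] * by blast
      then show "(x \<in> gball (off (insert y T) G) m z) = (x \<in> gball (off (insert y T) G') m z)" by simp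
    qed
    have dB: "depends_on ({{y, z}} \<union> {e. card e = 2 \<and> e \<inter> insert y T = {}}) (B T)"
      unfolding B_def
      by (intro depends_on_compose2[where h = "(\<and>)"] depends_on_mono[OF d1] depends_on_mono[OF d2]) auto
    have "perc_pr q \<beta> (\<lambda>G. A T G \<and> B T G) = perc_pr q \<beta> (A T) * perc_pr q \<beta> (B T)"
      using T by (intro perc_pr_indep[OF Am Bm dA dB]) (auto simp: F_def)
    also have "perc_pr q \<beta> (B T) = perc_pr q \<beta> (\<lambda>G. G {y, z}) *
        perc_pr q \<beta> (\<lambda>G. x \<in> gball (off (insert y T) G) m z)"
      unfolding B_def by (intro perc_pr_indep[OF pred_edge[OF e] _ d1 d2]) auto
    also have "perc_pr q \<beta> (\<lambda>G. G {y, z}) = ennreal (connection_prob q \<beta> y z)"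
      using perc_pr_edge(1)[where q = q, OF sym \<beta> yz] .
    also have "perc_pr q \<beta> (\<lambda>G. x \<in> gball (off (insert y T) G) m z) \<le> reach_pr q \<beta> m z x"
      by (intro perc_pr_mono pred_gball_percolation) (rule subsetD[OF gball_off_subset])
    finally show ?thesis by (simp add: mult_left_mono)
  qed
  have "perc_pr q \<beta> ?L \<le> perc_pr q \<beta> (\<lambda>G. \<exists>T\<in>F. A T G \<and> B T G)"
  proof (rule emeasure_mono_AE)
    show "AE G in ?P. G \<in> {G \<in> space ?P. ?L G} \<longrightarrow> G \<in> {G \<in> space ?P. \<exists>T\<in>F. A T G \<and> B T G}"
      using fin
    proof eventually_elim
      case (elim G)
      have "gball_lt G k v \<subseteq> gball G k v"
        using gball_mono[of _ k G v] by (auto simp: gball_lt_def intro: less_imp_le)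
      then have "finite (gball_lt G k v)" using elim finite_subset by blast
      then show ?case
        by (auto simp: F_def A_def B_def)
    qed
    show "{G \<in> space ?P. \<exists>T\<in>F. A T G \<and> B T G} \<in> sets ?P"
      using cF by measurable
  qed
  also have "\<dots> \<le> (\<integral>\<^sup>+T. perc_pr q \<beta> (\<lambda>G. A T G \<and> B T G) \<partial>count_space F)"
    using cF by (intro perc_pr_Bex_le) measurable
  also have "\<dots> \<le> (\<integral>\<^sup>+T. perc_pr q \<beta> (A T) *
      (ennreal (connection_prob q \<beta> y z) * reach_pr q \<beta> m z x) \<partial>count_space F)"
    by (intro nn_integral_mono each) simp
  also have "\<dots> = (\<integral>\<^sup>+T. perc_pr q \<beta> (A T) \<partial>count_space F) *
      (ennreal (connection_prob q \<beta> y z) * reach_pr q \<beta> m z x)"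
    by (intro nn_integral_multc) simp
  also have "(\<integral>\<^sup>+T. perc_pr q \<beta> (A T) \<partial>count_space F)
      = emeasure ?P (\<Union>T\<in>F. {G \<in> space ?P. A T G})"
    using cF by (intro emeasure_UN_countable[symmetric])
      (auto simp: disjoint_family_on_def A_def[abs_def])
  also have "\<dots> \<le> reach_pr q \<beta> k v y"
    by (intro emeasure_mono) (auto simp: A_def)
  finally show ?thesis by (simp add: mult.assoc mult_right_mono)
qed

context long_range_percolation
begin

text \<open>A union bound over the position of the long edge. Reading the connection behind this edge
  backwards, from \<open>x\<close>, turns both sums over its endpoints into mean sizes of balls.\<close>

lemma perc_pr_gball_le:
  assumes C: "\<And>\<beta> x y. 1 \<le> \<beta> \<Longrightarrow> x \<noteq> y \<Longrightarrow> connection_prob q \<beta> x y \<le> C * \<beta> * len (x - y) powr (- s)"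
    and C0: "0 \<le> C" and \<beta>: "1 \<le> \<beta>" and xv: "x \<noteq> v"
    and fin: "\<And>k. k < n \<Longrightarrow> mean_gball_size q \<beta> k v \<noteq> \<infinity>"
  shows "reach_pr q \<beta> n v x
    \<le> (\<Sum>k<n. mean_gball_size q \<beta> k v * mean_gball_size q \<beta> (n - 1 - k) x) *
      ennreal (C * \<beta> * real n powr s * len (x - v) powr (- s))"
proof -
  let ?P = "percolation q \<beta>"
  let ?c = "ennreal (C * \<beta> * real n powr s * len (x - v) powr (- s))"
  define Ev where "Ev k y z G \<longleftrightarrow> (y \<noteq> z \<and> len (x - v) \<le> real n * len (y - z)) \<and>
     (y \<in> gball G k v \<and> y \<notin> gball_lt G k v \<and> z \<notin> gball_lt G k v \<and> G {y, z} \<and>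
        x \<in> gball (off (insert y (gball_lt G k v)) G) (n - 1 - k) z)" for k y z G
  have lt[measurable]: "Measurable.pred ?P (\<lambda>G. w \<in> gball_lt G k v)" for w k
  proof -
    have "(\<lambda>G. w \<in> gball_lt G k v) = (\<lambda>G. \<exists>j\<in>{..<k}. w \<in> gball G j v)"
      by (simp add: gball_lt_def)
    also have "Measurable.pred ?P \<dots>" by measurable
    finally show ?thesis .
  qed
  have off_edge: "Measurable.pred ?P (\<lambda>G. off (insert y (gball_lt G k v)) G e)" if "card e = 2" for y k e
  proof -
    have [measurable]: "Measurable.pred ?P (\<lambda>G. G e)" using that by (intro pred_edge) (simp add: all_edges_def)
    have "(\<lambda>G. off (insert y (gball_lt G k v)) G e) = (\<lambda>G. G e \<and> (\<forall>w. w \<in> e \<longrightarrow> w \<noteq> y \<and> w \<notin> gball_lt G k v))"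
      by (auto simp: off_def fun_eq_iff)
    also have "Measurable.pred ?P \<dots>" by measurable
    finally show ?thesis .
  qed
  have [measurable]: "Measurable.pred ?P (Ev k y z)" for k y z
  proof (cases "y = z")
    case False
    then have [measurable]: "Measurable.pred ?P (\<lambda>G. G {y, z})" by (intro pred_edge) simp
    have [measurable]: "Measurable.pred ?P (\<lambda>G. x \<in> gball (off (insert y (gball_lt G k v)) G) (n - 1 - k) z)"
      using off_edge by (rule pred_gball)
    show ?thesis unfolding Ev_def by measurable
  qed (simp add: Ev_def[abs_def])
  have each: "perc_pr q \<beta> (Ev k y z)
      \<le> reach_pr q \<beta> k v y * (?c * reach_pr q \<beta> (n - 1 - k) x z)"
    if k: "k < n" for k y z
  proof (cases "y \<noteq> z \<and> len (x - v) \<le> real n * len (y - z)")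
    case True
    have "perc_pr q \<beta> (Ev k y z)
      \<le> reach_pr q \<beta> k v y * ennreal (connection_prob q \<beta> y z) *
        reach_pr q \<beta> (n - 1 - k) z x"
      using perc_pr_split_at_edge[OF q_sym _ _ AE_finite_gball[OF fin[OF k]], of y z x "n - 1 - k"]
        True \<beta> by (simp add: Ev_def[abs_def])
    also have "ennreal (connection_prob q \<beta> y z) \<le> ?c"
    proof (rule ennreal_leI)
      have l: "0 < len (x - v)" "0 < real n" "0 < len (y - z)"
        using xv k True by (auto intro!: len_pos)
      have "(real n * len (y - z)) powr (- s) \<le> len (x - v) powr (- s)"
        using True l s_pos by (intro powr_mono2') auto
      then have "real n powr s * (real n powr (- s) * len (y - z) powr (- s)) \<le> real n powr s * len (x - v) powr (- s)"
        using l by (intro mult_left_mono) (auto simp: powr_mult)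
      then have "len (y - z) powr (- s) \<le> real n powr s * len (x - v) powr (- s)"
        using l by (simp add: powr_minus field_simps)
      then have "C * \<beta> * len (y - z) powr (- s) \<le> C * \<beta> * (real n powr s * len (x - v) powr (- s))"
        using C0 \<beta> by (intro mult_left_mono) auto
      then show "connection_prob q \<beta> y z \<le> C * \<beta> * real n powr s * len (x - v) powr (- s)"
        using C[OF \<beta>, of y z] True by (simp add: mult.assoc)
    qed
    finally show ?thesis
      using gball_sym_iff[of x _ "n - 1 - k" z] by (simp add: mult.assoc mult_left_mono mult_right_mono)
  next
    case False
    then have "{G \<in> space ?P. Ev k y z G} = {}" by (auto simp: Ev_def)
    then have "perc_pr q \<beta> (Ev k y z) = 0" by (simp only: emeasure_empty)
    then show ?thesis by simp
  qed
  have "reach_pr q \<beta> n v x \<le> perc_pr q \<beta> (\<lambda>G. \<exists>k\<in>{..<n}. \<exists>y\<in>UNIV. \<exists>z\<in>UNIV. Ev k y z G)"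
  proof (rule perc_pr_mono)
    fix G assume "x \<in> gball G n v"
    from long_edge_on_geodesic[OF this xv] show "\<exists>k\<in>{..<n}. \<exists>y\<in>UNIV. \<exists>z\<in>UNIV. Ev k y z G"
      unfolding Ev_def by (metis UNIV_I lessThan_iff)
  qed measurable
  also have "\<dots> \<le> (\<integral>\<^sup>+k. perc_pr q \<beta> (\<lambda>G. \<exists>y\<in>UNIV. \<exists>z\<in>UNIV. Ev k y z G) \<partial>count_space {..<n})"
    by (rule perc_pr_Bex_le) (auto, measurable)
  also have "\<dots> \<le> (\<integral>\<^sup>+k. (\<integral>\<^sup>+y. (\<integral>\<^sup>+z. perc_pr q \<beta> (Ev k y z) \<partial>count_space UNIV) \<partial>count_space UNIV) \<partial>count_space {..<n})"
    by (intro nn_integral_mono order_trans[OF perc_pr_Bex_le] perc_pr_Bex_le) (auto, measurable)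
  also have "\<dots> \<le> (\<integral>\<^sup>+k. (\<integral>\<^sup>+y. (\<integral>\<^sup>+z. reach_pr q \<beta> k v y *
      (?c * reach_pr q \<beta> (n - 1 - k) x z) \<partial>count_space UNIV) \<partial>count_space UNIV) \<partial>count_space {..<n})"
    by (intro nn_integral_mono each) auto
  also have "\<dots> = (\<integral>\<^sup>+k. mean_gball_size q \<beta> k v * (?c * mean_gball_size q \<beta> (n - 1 - k) x) \<partial>count_space {..<n})"
    unfolding mean_gball_size_def
    by (simp add: nn_integral_cmult nn_integral_multc)
  also have "\<dots> = (\<Sum>k<n. mean_gball_size q \<beta> k v * mean_gball_size q \<beta> (n - 1 - k) x) * ?c"
    unfolding nn_integral_count_space_finite[OF finite_lessThan] sum_distrib_right
    by (intro sum.cong refl) (simp only: ac_simps)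
  finally show ?thesis .
qed

lemma nn_integral_len_shift:
  "(\<integral>\<^sup>+x. f (len (x - v)) \<partial>count_space UNIV) = (\<integral>\<^sup>+x. f (len x) \<partial>count_space UNIV)"
proof -
  have "bij_betw (\<lambda>x. x - v) UNIV UNIV"
    by (rule bij_betwI[where g = "\<lambda>x. x + v"]) auto
  then show ?thesis by (rule nn_integral_bij_count_space)
qed

text \<open>Induction on \<open>n\<close>. Bounding each probability by the minimum of \<open>1\<close> and the estimate of
  \<open>perc_pr_gball_le\<close> and summing over \<open>x\<close> gives a mean size of order \<open>A powr (CARD('n) / s)\<close>, where
  \<open>A\<close> is \<open>\<beta> * n powr s\<close> times a sum of products of mean sizes for radii that add up to \<open>n - 1\<close>. So
  the logarithms satisfy the recursion solved above, with \<open>\<mu> = CARD('n) / s\<close>; the exponent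
  \<open>\<sigma> = s + 1\<close> takes care of \<open>n powr s\<close> and of the number of summands.\<close>

theorem mean_gball_size_bound:
  fixes \<theta> :: real
  assumes \<theta>: "2 powr \<theta> = 2 * (real CARD('n) / s)"
  obtains K where "0 < K"
    "\<And>\<beta> n v. exp 1 \<le> \<beta> \<Longrightarrow>
       mean_gball_size q \<beta> n v \<le> ennreal (exp (K * ln \<beta> * real (n + 1) powr \<theta>))"
proof -
  define \<mu> where "\<mu> = real CARD('n) / s"
  have \<mu>: "1/2 < \<mu>" "\<mu> < 1" using s_gt s_lt s_pos by (auto simp: \<mu>_def field_simps)
  obtain C where C: "1 \<le> C"
    "\<And>\<beta> x y. 1 \<le> \<beta> \<Longrightarrow> x \<noteq> y \<Longrightarrow> connection_prob q \<beta> x y \<le> C * \<beta> * len (x - y) powr (- s)"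
    using connection_prob_upper by blast
  obtain C' where C': "0 < C'"
    "\<And>A. 1 \<le> A \<Longrightarrow> (\<integral>\<^sup>+x. ennreal (min 1 (A * len x powr (- s))) \<partial>count_space UNIV)
        \<le> ennreal (C' * A powr (real CARD('n) / s))"
    using sum_truncated_power_law[OF s_gt] by blast
  obtain K where K: "0 < K" "\<And>\<Lambda>. 1 \<le> \<Lambda> \<Longrightarrow> \<exists>h :: nat \<Rightarrow> real. 0 \<le> h 1 \<and> (\<forall>m\<ge>1. h m \<le> K * \<Lambda> * real m powr \<theta>) \<and>
       (\<forall>i\<ge>1. \<forall>j\<ge>1. h i + h j + (s + 1) * ln (real (i + j)) \<le> (h (i + j) - \<Lambda>) / \<mu>)"
    using growth_recursion_solution[OF \<mu>, of "s + 1" \<theta>] \<theta> s_pos unfolding \<mu>_def by auto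
  define L where "L = 2 + ln (1 + C') + ln C"
  have L: "2 \<le> L" using C C' by (simp add: L_def)
  have "mean_gball_size q \<beta> n v \<le> ennreal (exp (K * L * ln \<beta> * real (n + 1) powr \<theta>))"
    if \<beta>: "exp 1 \<le> \<beta>" for \<beta> n v
  proof -
    have \<beta>1: "1 \<le> \<beta>" using \<beta> exp_ge_add_one_self[of 1] by linarith
    have ln\<beta>: "1 \<le> ln \<beta>" using \<beta> \<beta>1 by (simp add: ln_ge_iff)
    define \<Lambda> where "\<Lambda> = L * ln \<beta>"
    have \<Lambda>: "1 \<le> \<Lambda>" using mult_mono[of 1 L 1 "ln \<beta>"] L ln\<beta> by (simp add: \<Lambda>_def)
    obtain h :: "nat \<Rightarrow> real" where h: "0 \<le> h 1" "\<And>m. 1 \<le> m \<Longrightarrow> h m \<le> K * \<Lambda> * real m powr \<theta>"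
       "\<And>i j. 1 \<le> i \<Longrightarrow> 1 \<le> j \<Longrightarrow> h i + h j + (s + 1) * ln (real (i + j)) \<le> (h (i + j) - \<Lambda>) / \<mu>"
      using K(2)[OF \<Lambda>] by metis
    have h0: "0 \<le> h m" if "1 \<le> m" for m
      using that
    proof (induction m rule: dec_induct)
      case base
      then show ?case using h(1) by simp
    next
      case (step m)
      have "0 \<le> (s + 1) * ln (real (m + 1))" using s_pos by simp
      then have "0 \<le> (h (m + 1) - \<Lambda>) / \<mu>" using h(3)[of m 1] step h(1) by simp
      then show ?case using \<mu> \<Lambda> by (simp add: zero_le_divide_iff)
    qed
    have "mean_gball_size q \<beta> n v \<le> ennreal (exp (h (n + 1)))"
    proof (induction n arbitrary: v rule: less_induct)
      case (less n)
      let ?S = "\<Sum>k<n. exp (h (k + 1)) * exp (h (n - k))"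
      let ?A = "C * \<beta> * real n powr s * ?S"
      show ?case
      proof (cases "n = 0")
        case True
        have "mean_gball_size q \<beta> n v = (\<integral>\<^sup>+x. perc_pr q \<beta> (\<lambda>G. x = v) \<partial>count_space UNIV)"
          by (simp add: mean_gball_size_def True)
        also have "\<dots> = (\<Sum>x\<in>{v}. perc_pr q \<beta> (\<lambda>G. x = v))"
          by (intro nn_integral_count_space') auto
        also have "\<dots> = ennreal 1"
          using emeasure_percolation_space[of q \<beta>] by simp
        also have "\<dots> \<le> ennreal (exp (h (n + 1)))" using h(1) True by (intro ennreal_leI) simp
        finally show ?thesis .
      next
        case False
        have fin: "mean_gball_size q \<beta> k w \<noteq> \<infinity>" if "k < n" for k w
          using less.IH[OF that, of w] by (auto simp: top_unique)
        have off_center: "reach_pr q \<beta> n v x \<le> ennreal (min 1 (?A * len (x - v) powr (- s)))"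
          if "x \<noteq> v" for x
        proof -
          have "reach_pr q \<beta> n v x
            \<le> (\<Sum>k<n. mean_gball_size q \<beta> k v * mean_gball_size q \<beta> (n - 1 - k) x) *
              ennreal (C * \<beta> * real n powr s * len (x - v) powr (- s))"
            using C(1) by (intro perc_pr_gball_le C(2) \<beta>1 that fin) auto
          also have "\<dots> \<le> (\<Sum>k<n. ennreal (exp (h (k + 1))) * ennreal (exp (h (n - k)))) *
              ennreal (C * \<beta> * real n powr s * len (x - v) powr (- s))"
          proof (intro mult_right_mono sum_mono mult_mono)
            fix k assume k: "k \<in> {..<n}"
            show "mean_gball_size q \<beta> k v \<le> ennreal (exp (h (k + 1)))" using k by (intro less.IH) simp
            have "mean_gball_size q \<beta> (n - 1 - k) x \<le> ennreal (exp (h (n - 1 - k + 1)))"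
              using k by (intro less.IH) simp
            then show "mean_gball_size q \<beta> (n - 1 - k) x \<le> ennreal (exp (h (n - k)))"
              using k by (simp add: Suc_diff_Suc)
          qed auto
          also have "\<dots> = ennreal (?A * len (x - v) powr (- s))"
            using C(1) \<beta>1 by (simp add: ennreal_mult[symmetric] sum_nonneg sum_ennreal ac_simps)
          finally have "reach_pr q \<beta> n v x \<le> ennreal (?A * len (x - v) powr (- s))" .
          moreover have "reach_pr q \<beta> n v x \<le> ennreal 1"
            using perc_pr_le_1[of q \<beta>] by simp
          ultimately show ?thesis by (simp add: min_def)
        qed
        have A1: "1 \<le> ?A"
        proof -
          have "1 * 1 \<le> exp (h (0 + 1)) * exp (h (n - 0))"
            using h0[of 1] h0[of n] False by (intro mult_mono) auto
          also have "\<dots> \<le> ?S"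
            using False by (intro member_le_sum[where f = "\<lambda>k. exp (h (k + 1)) * exp (h (n - k))"]) auto
          finally have S: "1 \<le> ?S" by simp
          have "1 \<le> real n powr s" using False s_pos by (intro ge_one_powr_ge_zero) auto
          then have "1 * 1 * 1 * 1 \<le> ?A" using C(1) \<beta>1 S by (intro mult_mono) auto
          then show ?thesis by simp
        qed
        (* The center is counted apart, as 0 powr (- s) is 0 and not infinite. *)
        have "mean_gball_size q \<beta> n v \<le> (\<integral>\<^sup>+x. indicator {v} x + ennreal (min 1 (?A * len (x - v) powr (- s))) \<partial>count_space UNIV)"
          unfolding mean_gball_size_def
        proof (intro nn_integral_mono)
          fix x
          show "reach_pr q \<beta> n v x \<le> indicator {v} x + ennreal (min 1 (?A * len (x - v) powr (- s)))"
          proof (cases "x = v")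
            case True
            have "reach_pr q \<beta> n v x \<le> 1"
              using perc_pr_le_1[of q \<beta>] by simp
            then show ?thesis using True by (simp add: add_increasing2)
          qed (use off_center in auto)
        qed
        also have "\<dots> = 1 + (\<integral>\<^sup>+x. ennreal (min 1 (?A * len (x - v) powr (- s))) \<partial>count_space UNIV)"
          by (subst nn_integral_add) (auto simp: emeasure_count_space_finite)
        also have "(\<integral>\<^sup>+x. ennreal (min 1 (?A * len (x - v) powr (- s))) \<partial>count_space UNIV)
            \<le> ennreal (C' * ?A powr \<mu>)"
          unfolding \<mu>_def using C'(2)[OF A1] nn_integral_len_shift[of "\<lambda>l. ennreal (min 1 (?A * l powr (- s)))" v]
          by simp
        also have "1 + ennreal (C' * ?A powr \<mu>) \<le> ennreal ((1 + C') * ?A powr \<mu>)"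
        proof -
          have "1 \<le> ?A powr \<mu>" using A1 \<mu> by (intro ge_one_powr_ge_zero) auto
          then have "ennreal (1 + C' * ?A powr \<mu>) \<le> ennreal ((1 + C') * ?A powr \<mu>)"
            by (intro ennreal_leI) (simp add: algebra_simps)
          then show ?thesis using C'(1) by (simp add: ennreal_plus)
        qed
        also have "\<dots> \<le> ennreal (exp (h (n + 1)))"
        proof (rule ennreal_leI)
          let ?X = "exp ((h (n + 1) - \<Lambda>) / \<mu>)"
          let ?Y = "?X * real (n + 1) powr (- (s + 1))"
          have "exp (h (k + 1)) * exp (h (n - k)) \<le> ?Y" if k: "k < n" for k
          proof -
            have "h (k + 1) + h (n - k) \<le> (h (n + 1) - \<Lambda>) / \<mu> - (s + 1) * ln (real (n + 1))"
              using h(3)[of "k + 1" "n - k"] k by (simp add: Suc_le_eq)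
            then have "h (k + 1) + h (n - k) \<le> (h (n + 1) - \<Lambda>) / \<mu> + - (s + 1) * ln (real (n + 1))"
              by (simp only: mult_minus_left diff_conv_add_uminus)
            then have "exp (h (k + 1) + h (n - k)) \<le> exp ((h (n + 1) - \<Lambda>) / \<mu> + - (s + 1) * ln (real (n + 1)))"
              by (simp only: exp_le_cancel_iff)
            moreover have "real (n + 1) powr (- (s + 1)) = exp (- (s + 1) * ln (real (n + 1)))"
              by (simp add: powr_def)
            ultimately show ?thesis by (simp only: exp_add)
          qed
          then have "?S \<le> (\<Sum>k<n. ?Y)"
            by (intro sum_mono) auto
          also have "\<dots> = real n * (?Y)" by simp
          also have "\<dots> \<le> real (n + 1) * (?Y)"
            by (intro mult_right_mono) auto
          finally have S: "?S \<le> real (n + 1) * (?Y)" .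
          have "real n powr s * ?S
              \<le> real (n + 1) powr s * (real (n + 1) * (?Y))"
            using S s_pos by (intro mult_mono powr_mono2) (auto intro!: sum_nonneg)
          also have "\<dots> = ?X"
          proof -
            have "real (n + 1) powr s * (real (n + 1) * real (n + 1) powr (- (s + 1)))
                = real (n + 1) powr s * (real (n + 1) powr 1 * real (n + 1) powr (- (s + 1)))" by simp
            also have "\<dots> = real (n + 1) powr (s + (1 + - (s + 1)))" by (simp only: powr_add)
            also have "\<dots> = 1" by simp
            finally show ?thesis by (metis mult.left_commute mult.right_neutral)
          qed
          finally have "?A \<le> C * \<beta> * ?X"
            using C(1) \<beta>1 mult_left_mono[of _ ?X "C * \<beta>"] by (simp add: mult.assoc)
          then have "?A powr \<mu> \<le> (C * \<beta> * ?X) powr \<mu>" using A1 \<mu> by (intro powr_mono2) auto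
          also have "\<dots> = (C * \<beta>) powr \<mu> * exp (h (n + 1) - \<Lambda>)"
            using C(1) \<beta>1 \<mu> by (simp add: powr_mult exp_powr_real)
          finally have "(1 + C') * ?A powr \<mu> \<le> (1 + C') * ((C * \<beta>) powr \<mu> * exp (h (n + 1) - \<Lambda>))"
            using C'(1) by (intro mult_left_mono) auto
          also have "\<dots> \<le> (1 + C') * ((C * \<beta>) powr 1 * exp (h (n + 1) - \<Lambda>))"
          proof -
            have "1 * 1 \<le> C * \<beta>" using C(1) \<beta>1 by (intro mult_mono) auto
            then show ?thesis using C'(1) \<mu> by (intro mult_left_mono mult_right_mono powr_mono) auto
          qed
          also have "\<dots> = exp (ln (1 + C') + ln C + ln \<beta> + (h (n + 1) - \<Lambda>))"
            using C'(1) C(1) \<beta>1 by (simp add: exp_add)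
          also have "\<dots> \<le> exp (h (n + 1))"
          proof -
            have nn: "0 \<le> ln (1 + C') + ln C" using C'(1) C(1) by simp
            have "ln (1 + C') + ln C + ln \<beta> \<le> (ln (1 + C') + ln C) * ln \<beta> + 2 * ln \<beta>"
              using mult_left_mono[OF ln\<beta> nn] ln\<beta> by simp
            also have "\<dots> = \<Lambda>" by (simp add: \<Lambda>_def L_def algebra_simps)
            finally show ?thesis by simp
          qed
          finally show "(1 + C') * ?A powr \<mu> \<le> exp (h (n + 1))" .
        qed
        finally show ?thesis by (simp add: add_left_mono)
      qed
    qed
    also have "\<dots> \<le> ennreal (exp (K * L * ln \<beta> * real (n + 1) powr \<theta>))"
      using h(2)[of "n + 1"] by (intro ennreal_leI) (simp add: \<Lambda>_def mult.assoc)
    finally show ?thesis .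
  qed
  then show ?thesis using K(1) L by (intro that[of "K * L"]) auto
qed

end

section \<open>Distances that use short edges only\<close>

definition graph_dist :: "('v set \<Rightarrow> bool) \<Rightarrow> 'v \<Rightarrow> 'v \<Rightarrow> nat" where
  "graph_dist G x y = (LEAST n. y \<in> gball G n x)"

lemma graph_dist_le: "y \<in> gball G n x \<Longrightarrow> graph_dist G x y \<le> n"
  unfolding graph_dist_def by (rule Least_le)

lemma graph_dist_attained: "y \<in> gball G n x \<Longrightarrow> y \<in> gball G (graph_dist G x y) x"
  unfolding graph_dist_def by (rule LeastI)

text \<open>The configuration with the open edges of length at most \<open>l\<close> and all edges between nearest
  neighbours. The latter are almost surely open anyway; including them makes distances finite
  for every configuration and bounds them by the \<open>l1_norm\<close>.\<close>

definition (in lattice_norm) short :: "real \<Rightarrow> ((int ^ 'n) set \<Rightarrow> bool) \<Rightarrow> (int ^ 'n) set \<Rightarrow> bool" where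
  "short l G e \<longleftrightarrow> (\<exists>x y. e = {x, y} \<and> nearest_neighbor_of_origin (x - y)) \<or>
     (G e \<and> (\<exists>x y. e = {x, y} \<and> x \<noteq> y \<and> len (x - y) \<le> l))"

definition l1_norm :: "int ^ 'n \<Rightarrow> nat" where
  "l1_norm x = nat (\<Sum>i\<in>UNIV. \<bar>x $ i\<bar>)"

lemma gball_l1_norm:
  fixes x y :: "int ^ 'n"
  assumes nn: "\<And>x y. nearest_neighbor_of_origin (x - y) \<Longrightarrow> G {x, y}"
  shows "y \<in> gball G (l1_norm (x - y)) x"
proof (induction "l1_norm (x - y)" arbitrary: y)
  case 0
  have "(\<Sum>i\<in>UNIV. \<bar>(x - y) $ i\<bar>) \<le> 0" using 0 by (simp add: l1_norm_def)
  moreover have "0 \<le> (\<Sum>i\<in>UNIV. \<bar>(x - y) $ i\<bar>)" by (intro sum_nonneg) simp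
  ultimately have "(\<Sum>i\<in>UNIV. \<bar>(x - y) $ i\<bar>) = 0" by (rule antisym)
  then have "x = y" by (simp add: sum_nonneg_eq_0_iff vec_eq_iff)
  then show ?case by (simp add: gball_center)
next
  case (Suc n)
  have nonneg: "0 \<le> (\<Sum>i\<in>UNIV. \<bar>v $ i\<bar>)" for v :: "int ^ 'n" by (intro sum_nonneg) simp
  have "\<exists>i. x $ i \<noteq> y $ i"
  proof (rule ccontr)
    assume "\<not> ?thesis"
    then show False using Suc(2) by (simp add: l1_norm_def)
  qed
  then obtain i where i: "x $ i \<noteq> y $ i" by blast
  define \<sigma> where "\<sigma> = sgn (x $ i - y $ i)"
  define z where "z = y + \<sigma> *s axis i 1"
  have \<sigma>: "\<sigma> = 1 \<or> \<sigma> = - 1" using i by (auto simp: \<sigma>_def sgn_if)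
  have zn: "z $ j = (if j = i then y $ i + \<sigma> else y $ j)" for j by (simp add: z_def axis_def)
  have zy: "z - y = axis i 1 \<or> z - y = - axis i 1"
    using \<sigma> by (auto simp: z_def vec_eq_iff axis_def)
  then have nnzy: "nearest_neighbor_of_origin (z - y)" by (auto simp: nearest_neighbor_of_origin_def)
  have "z \<noteq> y" using zy by (auto simp: axis_eq_0_iff)
  have "\<bar>(x - z) $ i\<bar> = \<bar>(x - y) $ i\<bar> - 1" using i by (auto simp: zn \<sigma>_def sgn_if)
  then have "(\<Sum>j\<in>UNIV. \<bar>(x - z) $ j\<bar>) = (\<Sum>j\<in>UNIV. \<bar>(x - y) $ j\<bar> - (if j = i then 1 else 0))"
    by (intro sum.cong) (auto simp: zn)
  also have "\<dots> = (\<Sum>j\<in>UNIV. \<bar>(x - y) $ j\<bar>) - 1" by (simp add: sum_subtractf)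
  finally have "l1_norm (x - z) = n" using Suc(2) by (simp add: l1_norm_def)
  then have "z \<in> gball G n x" using Suc(1)[of z] by simp
  then have "y \<in> gball G (Suc n) x" using nn[OF nnzy] \<open>z \<noteq> y\<close> by (rule_tac gball_step)
  then show ?case using Suc(2) by simp
qed

context lattice_norm
begin

lemma short_nn: "nearest_neighbor_of_origin (x - y) \<Longrightarrow> short l G {x, y}"
  unfolding short_def by blast

lemma short_mono: "l \<le> l' \<Longrightarrow> short l G e \<Longrightarrow> short l' G e"
  unfolding short_def by (elim disjE conjE exE) (blast, metis order_trans)

definition short_dist :: "real \<Rightarrow> ((int ^ 'n) set \<Rightarrow> bool) \<Rightarrow> int ^ 'n \<Rightarrow> int ^ 'n \<Rightarrow> nat" where
  "short_dist l G x y = graph_dist (short l G) x y"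

lemma short_dist_attained: "y \<in> gball (short l G) (short_dist l G x y) x"
  unfolding short_dist_def by (rule graph_dist_attained[OF gball_l1_norm]) (rule short_nn)

lemma short_dist_le_l1_norm: "short_dist l G x y \<le> l1_norm (x - y)"
  unfolding short_dist_def by (rule graph_dist_le[OF gball_l1_norm]) (rule short_nn)

lemma short_dist_le_iff: "short_dist l G x y \<le> n \<longleftrightarrow> y \<in> gball (short l G) n x"
  using short_dist_attained[of y l G x] gball_mono[of "short_dist l G x y" n "short l G" x]
    graph_dist_le[of y "short l G" n x] unfolding short_dist_def by blast

lemma short_dist_via_edge:
  assumes "l \<le> l'" "G {u, v}" "u \<noteq> v" "len (u - v) \<le> l'"
  shows "short_dist l' G x y \<le> short_dist l G x u + 1 + short_dist l G v y"
proof -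
  have sub: "gball (short l G) n a \<subseteq> gball (short l' G) n a" for n a
    using short_mono[OF assms(1)] by (intro gball_mono_config)
  have "u \<in> gball (short l' G) (short_dist l G x u) x" using short_dist_attained sub by blast
  moreover have "short l' G {u, v}" using assms unfolding short_def by blast
  ultimately have "v \<in> gball (short l' G) (Suc (short_dist l G x u)) x"
    using assms(3) gball_step by metis
  moreover have "y \<in> gball (short l' G) (short_dist l G v y) v" using short_dist_attained sub by blast
  ultimately have "y \<in> gball (short l' G) (Suc (short_dist l G x u) + short_dist l G v y) x"
    by (rule gball_trans)
  then show ?thesis unfolding short_dist_le_iff by simp
qed

definition short_edges :: "real \<Rightarrow> (int ^ 'n) set set" where
  "short_edges l = {e. \<exists>x y. e = {x, y} \<and> x \<noteq> y \<and> len (x - y) \<le> l}"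

lemma depends_on_short_dist: "depends_on (short_edges l) (\<lambda>G. short_dist l G x y)"
proof (rule depends_onI)
  fix G G' :: "(int ^ 'n) set \<Rightarrow> bool"
  assume "\<And>e. e \<in> short_edges l \<Longrightarrow> G e = G' e"
  then have "short l G = short l G'" by (auto simp: fun_eq_iff short_def short_edges_def)
  then show "short_dist l G x y = short_dist l G' x y" by (simp add: short_dist_def)
qed

lemma pred_gball_short [measurable]:
  "perc_event q \<beta> (\<lambda>G. x \<in> gball (short l G) n v)"
  by (rule pred_gball) (auto simp: short_def[abs_def] all_edges_def intro!: pred_intros_logic pred_edge)

lemma measurable_short_dist [measurable]:
  "(\<lambda>G. short_dist l G x y) \<in> measurable (percolation q \<beta>) (count_space UNIV)"
  unfolding short_dist_def graph_dist_def by measurable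

end

lemma perc_pr_no_edge_le:
  assumes sym: "\<And>x. q x = q (- x)" and \<beta>: "0 \<le> \<beta>"
    and "finite Q"
    and "\<And>e. e \<in> Q \<Longrightarrow> \<exists>x y. e = {x, y} \<and> x \<noteq> y \<and> 1 - connection_prob q \<beta> x y \<le> c"
    and c: "0 \<le> c"
  shows "perc_pr q \<beta> (\<lambda>G. \<forall>e\<in>Q. \<not> G e) \<le> ennreal (c ^ card Q)"
  using assms(3,4)
proof (induction Q rule: finite_induct)
  case empty
  then show ?case
    using emeasure_percolation_space[of q \<beta>] by simp
next
  case (insert e Q)
  obtain x y where e: "e = {x, y}" "x \<noteq> y" "1 - connection_prob q \<beta> x y \<le> c"
    using insert.prems by blast
  have all: "e' \<in> all_edges" if "e' \<in> insert e Q" for e'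
    using insert.prems[OF that] by auto
  have m[measurable]: "perc_event q \<beta> (\<lambda>G. \<not> G e')" if "e' \<in> insert e Q" for e'
    using all[OF that] by (intro pred_intros_logic pred_edge)
  have mQ: "perc_event q \<beta> (\<lambda>G. \<forall>e'\<in>Q. \<not> G e')"
    using insert.hyps(1) m by (intro pred_intros_finite) auto
  have "perc_pr q \<beta> (\<lambda>G. \<forall>e\<in>insert e Q. \<not> G e) = perc_pr q \<beta> (\<lambda>G. \<not> G e \<and> (\<forall>e\<in>Q. \<not> G e))"
    by simp
  also have "\<dots> = perc_pr q \<beta> (\<lambda>G. \<not> G e) * perc_pr q \<beta> (\<lambda>G. \<forall>e\<in>Q. \<not> G e)"
    using insert.hyps(2) m[of e] mQ
    by (intro perc_pr_indep[where J = "{e}" and K = Q]) (auto intro!: depends_onI)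
  also have "\<dots> \<le> ennreal c * ennreal (c ^ card Q)"
  proof (rule mult_mono)
    show "perc_pr q \<beta> (\<lambda>G. \<not> G e) \<le> ennreal c"
      unfolding e(1) perc_pr_edge(2)[where q = q, OF sym \<beta> e(2)] using e(3) by (rule ennreal_leI)
    show "perc_pr q \<beta> (\<lambda>G. \<forall>e\<in>Q. \<not> G e) \<le> ennreal (c ^ card Q)"
      by (rule insert.IH) (rule insert.prems, simp)
  qed auto
  also have "\<dots> = ennreal (c ^ card (insert e Q))"
    using c insert.hyps by (simp add: ennreal_mult)
  finally show ?case .
qed

context long_range_percolation
begin

lemma AE_short_subset:
  assumes \<beta>: "0 \<le> \<beta>"
  shows "AE G in percolation q \<beta>. \<forall>l n x. gball (short l G) n x \<subseteq> gball G n x"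
proof -
  have "AE G in percolation q \<beta>. \<forall>x y. nearest_neighbor_of_origin (x - y) \<longrightarrow> G {x, y}"
    unfolding AE_all_countable
  proof (intro allI)
    fix x y :: "int ^ 'n"
    show "AE G in percolation q \<beta>. nearest_neighbor_of_origin (x - y) \<longrightarrow> G {x, y}"
    proof (cases "nearest_neighbor_of_origin (x - y)")
      case True
      then have xy: "x \<noteq> y" by (auto simp: nearest_neighbor_of_origin_def axis_eq_0_iff)
      have "q (x - y) = \<infinity>" using admissible True unfolding admissible_q_def by blast
      then have "connection_prob q \<beta> x y = 1" by (simp add: connection_prob_def)
      then have "perc_pr q \<beta> (\<lambda>G. \<not> G {x, y}) = 0" using perc_pr_edge(2)[where q = q, OF q_sym \<beta> xy] by simp
      moreover have "perc_event q \<beta> (\<lambda>G. \<not> G {x, y})"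
        using xy by (intro pred_intros_logic pred_edge) simp
      ultimately show ?thesis by (intro AE_I[where N = "{G \<in> space (percolation q \<beta>). \<not> G {x, y}}"]) auto
    qed simp
  qed
  then show ?thesis
  proof eventually_elim
    case (elim G)
    show ?case
    proof (intro allI gball_mono_config)
      fix l n x y z assume "short l G {y, z}"
      then consider a b where "{y, z} = {a, b}" "nearest_neighbor_of_origin (a - b)" | "G {y, z}"
        unfolding short_def by blast
      then show "G {y, z}"
      proof cases
        case 1
        then show ?thesis using elim by metis
      qed
    qed
  qed
qed

definition mean_short_dist :: "real \<Rightarrow> real \<Rightarrow> int ^ 'n \<Rightarrow> int ^ 'n \<Rightarrow> ennreal" where
  "mean_short_dist \<beta> l x y = (\<integral>\<^sup>+G. of_nat (short_dist l G x y) \<partial>percolation q \<beta>)"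

text \<open>Consider the first open edge between \<open>U\<close> and \<open>V\<close>, in a fixed enumeration. All candidates are longer
  than \<open>l\<close>, so their states are independent of the distances at scale \<open>l\<close>, and the mean
  distances from the endpoints of the chosen edge to \<open>x\<close> and \<open>y\<close> are still at most \<open>F\<close>. If there is no
  open edge, the \<open>l1_norm\<close> is a bound.\<close>

lemma mean_short_dist_bridge:
  assumes ll': "l \<le> l'" and U: "finite U" and V: "finite V"
    and long: "\<And>u v. u \<in> U \<Longrightarrow> v \<in> V \<Longrightarrow> l < len (u - v) \<and> len (u - v) \<le> l'" and l0: "0 \<le> l"
    and FU: "\<And>u. u \<in> U \<Longrightarrow> mean_short_dist \<beta> l x u \<le> F"
    and FV: "\<And>v. v \<in> V \<Longrightarrow> mean_short_dist \<beta> l v y \<le> F"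
  shows "mean_short_dist \<beta> l' x y \<le> 2 * F + 1 +
    of_nat (l1_norm (x - y)) * perc_pr q \<beta> (\<lambda>G. \<forall>u\<in>U. \<forall>v\<in>V. \<not> G {u, v})"
proof -
  let ?P = "percolation q \<beta>"
  obtain p where p: "bij_betw p {..<card (U \<times> V)} (U \<times> V)"
    using ex_bij_betw_nat_finite[of "U \<times> V"] U V by (auto simp: atLeast0LessThan)
  define m where "m = card (U \<times> V)"
  define u v where "u i = fst (p i)" and "v i = snd (p i)" for i
  have uv: "u i \<in> U" "v i \<in> V" if "i < m" for i
    using bij_betwE[OF p] that by (auto simp: u_def v_def m_def mem_Times_iff)
  have neq: "u i \<noteq> v i" if "i < m" for i
    using long[OF uv[OF that]] l0 by auto
  (* The value m stands for the case that no candidate is open. *)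
  define first where "first G = (LEAST i. i < m \<longrightarrow> G {u i, v i})" for G :: "(int ^ 'n) set \<Rightarrow> bool"
  have first: "first G < m \<longrightarrow> G {u (first G), v (first G)}" "first G \<le> m" for G
    unfolding first_def by (rule LeastI[of _ m], simp) (rule Least_le, simp)
  have first_m: "\<forall>a\<in>U. \<forall>b\<in>V. \<not> G {a, b}" if "first G = m" for G
  proof (intro ballI notI)
    fix a b assume ab: "a \<in> U" "b \<in> V" "G {a, b}"
    then obtain i where i: "i < m" "p i = (a, b)"
      using bij_betw_imp_surj_on[OF p] unfolding m_def by (force simp: image_iff)
    then have "first G \<le> i" using ab(3) unfolding first_def by (intro Least_le) (simp add: u_def v_def)
    then show False using that i by simp
  qed
  have edge_m: "Measurable.pred ?P (\<lambda>G. i < m \<longrightarrow> G {u i, v i})" for i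
    using neq pred_edge[of "{u i, v i}" q \<beta>] by (cases "i < m") auto
  then have first_meas[measurable]: "first \<in> measurable ?P (count_space UNIV)"
    unfolding first_def by measurable
  define J where "J = {e. \<exists>a\<in>U. \<exists>b\<in>V. e = {a, b}}"
  have first_dep: "depends_on J first"
  proof (rule depends_onI)
    fix G G' :: "(int ^ 'n) set \<Rightarrow> bool"
    assume *: "\<And>e. e \<in> J \<Longrightarrow> G e = G' e"
    have "(i < m \<longrightarrow> G {u i, v i}) = (i < m \<longrightarrow> G' {u i, v i})" for i
      using uv[of i] *[of "{u i, v i}"] unfolding J_def by blast
    then show "first G = first G'" unfolding first_def by (intro arg_cong[where f = Least] ext)
  qed
  have disj: "J \<inter> short_edges l = {}"
  proof -
    have False if "a \<in> U" "b \<in> V" "{a, b} = {c, d}" "len (c - d) \<le> l" for a b c d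
      using long[OF that(1,2)] that(3,4) len_commute[of a b] by (auto simp: doubleton_eq_iff)
    then show ?thesis unfolding J_def short_edges_def by blast
  qed
  let ?T = "\<lambda>i G. indicator {G. first G = i} G :: ennreal"
  let ?D = "\<lambda>a b G. of_nat (short_dist l G a b) :: ennreal"
  let ?Z = "\<lambda>i G. ?T i G * ?D x (u i) G + ?T i G + ?T i G * ?D (v i) y G"
  let ?t = "\<lambda>i. \<integral>\<^sup>+G. ?T i G \<partial>?P"
  let ?none = "{G \<in> space ?P. \<forall>u\<in>U. \<forall>v\<in>V. \<not> G {u, v}}"
  let ?l1 = "of_nat (l1_norm (x - y)) :: ennreal"
  have T_meas[measurable]: "?T i \<in> borel_measurable ?P" for i
    by (rule borel_measurable_indicator') measurable
  have D_meas[measurable]: "?D a b \<in> borel_measurable ?P" for a b by measurable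
  have indep: "(\<integral>\<^sup>+G. ?T i G * ?D a b G \<partial>?P) = ?t i * mean_short_dist \<beta> l a b" for i a b
    unfolding mean_short_dist_def
  proof (rule nn_integral_percolation_indep[OF T_meas D_meas _ _ disj])
    show "depends_on J (?T i)"
    proof -
      have "depends_on J (\<lambda>G. indicator {i} (first G) :: ennreal)"
        by (rule depends_on_compose[OF first_dep])
      moreover have "(\<lambda>G. indicator {i} (first G)) = ?T i" by (auto simp: fun_eq_iff indicator_def)
      ultimately show ?thesis by (rule back_subst[where P = "depends_on J"])
    qed
    show "depends_on (short_edges l) (?D a b)" by (rule depends_on_compose[OF depends_on_short_dist])
  qed
  have pointwise: "of_nat (short_dist l' G x y)
      \<le> (\<Sum>i<m. ?Z i G) +
        ?l1 * indicator ?none G"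
    if G: "G \<in> space ?P" for G
  proof (cases "first G < m")
    case True
    define i where "i = first G"
    have i: "i < m" "G {u i, v i}" using True first by (auto simp: i_def)
    have "(of_nat (short_dist l' G x y) :: ennreal) \<le> of_nat (short_dist l G x (u i) + 1 + short_dist l G (v i) y)"
      using short_dist_via_edge[of l l' G "u i" "v i" x y] ll' i neq long[OF uv[OF i(1)]]
      unfolding of_nat_le_iff by blast
    also have "\<dots> = ?Z i G" by (simp add: i_def)
    also have "\<dots> \<le> (\<Sum>i<m. ?Z i G)"
      using i(1) by (intro member_le_sum[where f = "\<lambda>i. ?Z i G"]) auto
    finally show ?thesis by (simp add: add_increasing2)
  next
    case False
    then have "first G = m" using first(2)[of G] by simp
    then have "G \<in> ?none" using first_m G by blast
    moreover have "(of_nat (short_dist l' G x y) :: ennreal) \<le> of_nat (l1_norm (x - y))"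
      using short_dist_le_l1_norm unfolding of_nat_le_iff .
    ultimately show ?thesis by (simp add: add_increasing)
  qed
  have none_meas: "?none \<in> sets ?P"
  proof -
    have "Measurable.pred ?P (\<lambda>G. \<not> G {a, b})" if "a \<in> U" "b \<in> V" for a b
      using long[OF that] l0 by (intro pred_intros_logic pred_edge) auto
    then have "Measurable.pred ?P (\<lambda>G. \<forall>u\<in>U. \<forall>v\<in>V. \<not> G {u, v})"
      using U V by (intro pred_intros_finite) auto
    then show ?thesis by (simp add: pred_def)
  qed
  have sumT: "(\<Sum>i<m. ?t i) \<le> 1"
  proof -
    have "(\<Sum>i<m. ?t i) = (\<integral>\<^sup>+G. (\<Sum>i<m. ?T i G) \<partial>?P)"
      by (intro nn_integral_sum[symmetric]) measurable
    also have "\<dots> \<le> (\<integral>\<^sup>+G. 1 \<partial>?P)"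
    proof (intro nn_integral_mono)
      fix G
      have "(\<Sum>i<m. ?T i G) = (\<Sum>i<m. if i = first G then 1 else 0)"
        by (intro sum.cong) (auto simp: indicator_def)
      also have "\<dots> \<le> 1" by (subst sum.delta) auto
      finally show "(\<Sum>i<m. ?T i G) \<le> 1" .
    qed
    also have "\<dots> = 1" using emeasure_percolation_space[of q \<beta>] by simp
    finally show ?thesis .
  qed
  have "mean_short_dist \<beta> l' x y \<le> (\<integral>\<^sup>+G. (\<Sum>i<m. ?Z i G) +
        ?l1 * indicator ?none G \<partial>?P)"
    unfolding mean_short_dist_def[of \<beta> l'] by (intro nn_integral_mono pointwise)
  also have "\<dots> = (\<Sum>i<m. ?t i * mean_short_dist \<beta> l x (u i) + ?t i +
        ?t i * mean_short_dist \<beta> l (v i) y) +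
        ?l1 * emeasure ?P ?none"
    using none_meas
    by (subst nn_integral_add)
       (auto simp: nn_integral_sum nn_integral_add nn_integral_cmult indep intro!: borel_measurable_sum)
  also have "\<dots> \<le> (\<Sum>i<m. ?t i * (2 * F + 1)) +
        ?l1 * emeasure ?P ?none"
  proof (intro add_right_mono sum_mono)
    fix i assume i: "i \<in> {..<m}"
    have "?t i * mean_short_dist \<beta> l x (u i) + ?t i +
        ?t i * mean_short_dist \<beta> l (v i) y
      \<le> ?t i * F + ?t i + ?t i * F"
      using i uv by (intro add_mono mult_left_mono FU FV order_refl) auto
    also have "\<dots> = ?t i * (2 * F + 1)" by (simp add: algebra_simps mult_2)
    finally show "?t i * mean_short_dist \<beta> l x (u i) + ?t i +
        ?t i * mean_short_dist \<beta> l (v i) y \<le> ?t i * (2 * F + 1)" .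
  qed
  also have "(\<Sum>i<m. ?t i * (2 * F + 1)) \<le> 2 * F + 1"
    using mult_right_mono[OF sumT, of "2 * F + 1"] by (simp add: sum_distrib_right)
  finally show ?thesis by (simp add: add_right_mono)
qed

text \<open>The case of one candidate, where the distances to its endpoints vanish.\<close>

lemma mean_short_dist_edge:
  assumes \<beta>: "0 \<le> \<beta>" and xy: "x \<noteq> y" "len (x - y) \<le> l"
  shows "mean_short_dist \<beta> l x y \<le> 1 + of_nat (l1_norm (x - y)) * ennreal (1 - connection_prob q \<beta> x y)"
proof -
  have 0: "mean_short_dist \<beta> 0 v v \<le> 0" for v
  proof -
    have "short_dist 0 G v v = 0" for G using short_dist_le_iff[of 0 G v v 0] by simp
    then show ?thesis by (simp add: mean_short_dist_def)
  qed
  have "mean_short_dist \<beta> l x y \<le> 2 * 0 + 1 +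
    of_nat (l1_norm (x - y)) * perc_pr q \<beta> (\<lambda>G. \<forall>u\<in>{x}. \<forall>v\<in>{y}. \<not> G {u, v})"
    using xy len_pos[of "x - y"] 0 by (intro mean_short_dist_bridge[where l = 0]) auto
  then show ?thesis using perc_pr_edge(2)[where q = q, OF q_sym \<beta> xy(1)] by simp
qed

end

section \<open>Connecting points along a hierarchy of scales\<close>

lemma exp_ge_linear:
  fixes A b c x :: real
  assumes "0 < b" "0 < c" "0 \<le> A" "2 * A / (c * b\<^sup>2) \<le> x" "0 \<le> x"
  shows "A * x \<le> c * exp (b * x)"
proof -
  have "1 + b * x + (b * x)\<^sup>2 / 2 \<le> exp (b * x)"
    using assms by (intro exp_lower_Taylor_quadratic) auto
  moreover have "0 \<le> b * x" using assms by simp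
  ultimately have *: "(b * x)\<^sup>2 / 2 \<le> exp (b * x)" by linarith
  have "A \<le> x * (c * b\<^sup>2 / 2)" using assms by (simp add: field_simps)
  then have "A * x \<le> x * (c * b\<^sup>2 / 2) * x" using assms by (intro mult_right_mono) auto
  also have "\<dots> = c * ((b * x)\<^sup>2 / 2)" by (simp add: power2_eq_square)
  also have "\<dots> \<le> c * exp (b * x)" using * assms by (intro mult_left_mono) auto
  finally show ?thesis .
qed

text \<open>With \<open>g = 2 * CARD('n) / s\<close>, the logarithms of the distances at consecutive levels of the hierarchy
  have quotient \<open>g\<close> up to lower order. The term \<open>k + t\<close> makes each window slightly wider than the
  power \<open>1 / g\<close> of the distance that it has to bridge, see \<open>scale_step\<close>.\<close>

definition scale_exponent :: "real \<Rightarrow> real \<Rightarrow> nat \<Rightarrow> real" where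
  "scale_exponent g t k = g ^ k + real k + t"

lemma scale_exponent_le:
  assumes "1 \<le> g" "g \<le> 2" "0 \<le> t"
  shows "scale_exponent g t k \<le> (2 + t) * 2 ^ k"
proof -
  have "g ^ k \<le> 2 ^ k" using assms by (intro power_mono) auto
  moreover have "real k \<le> 2 ^ k" using of_nat_mono[OF less_imp_le[OF less_exp[of k]], where 'a = real] by simp
  moreover have "t * 1 \<le> t * 2 ^ k" using assms by (intro mult_left_mono) auto
  ultimately show ?thesis unfolding scale_exponent_def distrib_right by linarith
qed

lemma scale_exponent_Suc_le:
  assumes "1 \<le> g" "g \<le> 2" "0 \<le> t"
  shows "scale_exponent g t (Suc k) \<le> 3 * scale_exponent g t k"
proof -
  define P where "P = g ^ k"
  have "1 \<le> P" unfolding P_def using assms by (intro one_le_power)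
  moreover have "g * P \<le> 2 * P" using assms \<open>1 \<le> P\<close> by (intro mult_right_mono) auto
  moreover have "scale_exponent g t (Suc k) = g * P + (1 + real k) + t" "scale_exponent g t k = P + real k + t"
    by (simp_all add: scale_exponent_def P_def)
  ultimately show ?thesis using assms(3) of_nat_0_le_iff[of k, where 'a = real] by argo
qed

lemma scale_exponent_Suc_ge: "1 \<le> g \<Longrightarrow> scale_exponent g t k + 1 \<le> scale_exponent g t (Suc k)"
  using power_increasing[of k "Suc k" g] by (simp add: scale_exponent_def)

lemma scale_exponent_ge: "1 \<le> g \<Longrightarrow> 0 \<le> t \<Longrightarrow> 1 \<le> scale_exponent g t k \<and> g ^ k \<le> scale_exponent g t k"
  using one_le_power[of g k] of_nat_0_le_iff[of k] unfolding scale_exponent_def by linarith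

text \<open>The first two factors will be the largest possible distance at level \<open>i\<close>, and the third one will
  bound the probability that the windows at this level are not joined by an edge.\<close>

lemma doubly_exponential_dominates:
  fixes c \<delta> t K :: real
  assumes "0 < c" "0 < \<delta>" "0 \<le> t" "1 \<le> K"
  obtains a\<^sub>1 where "1 \<le> a\<^sub>1"
    "\<And>a g i. a\<^sub>1 \<le> a \<Longrightarrow> 1 \<le> g \<Longrightarrow> g \<le> 2 \<Longrightarrow> 1 \<le> i \<Longrightarrow>
       K * exp (a * scale_exponent g t i) * exp (- (c * exp (a * \<delta> * real i))) \<le> 1"
proof -
  define A where "A = ln K + 2 + t"
  have A: "0 \<le> A" "0 \<le> ln K" using assms by (auto simp: A_def)
  define a\<^sub>1 where "a\<^sub>1 = max 1 (max (2 * A / (c * (\<delta> / 2)\<^sup>2)) (2 * ln 2 / \<delta>))"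
  show ?thesis
  proof (rule that[of a\<^sub>1])
    show "1 \<le> a\<^sub>1" by (simp add: a\<^sub>1_def)
    fix a g :: real and i :: nat
    assume a: "a\<^sub>1 \<le> a" and g: "1 \<le> g" "g \<le> 2" and i: "1 \<le> i"
    have a': "1 \<le> a" "2 * A / (c * (\<delta> / 2)\<^sup>2) \<le> a" "2 * ln 2 / \<delta> \<le> a" using a by (auto simp: a\<^sub>1_def)
    define z where "z = exp (\<delta> / 2 * a)"
    have "ln 2 \<le> \<delta> / 2 * a" using a'(3) assms by (simp add: field_simps)
    then have "exp (ln 2) \<le> z" unfolding z_def by (simp only: exp_le_cancel_iff)
    then have z: "2 \<le> z" by simp
    have Az: "A * a \<le> c * z"
      unfolding z_def using assms a' A by (intro exp_ge_linear) auto
    have "ln K + a * scale_exponent g t i \<le> ln K * a * 2 ^ i + a * ((2 + t) * 2 ^ i)"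
    proof (intro add_mono mult_left_mono scale_exponent_le g assms)
      have "ln K * 1 * 1 \<le> ln K * a * 2 ^ i"
        using a' A by (intro mult_mono) auto
      then show "ln K \<le> ln K * a * 2 ^ i" by simp
    qed (use a' in auto)
    also have "\<dots> = A * a * 2 ^ i" by (simp add: A_def algebra_simps)
    also have "\<dots> \<le> c * z * z ^ i"
      using z assms by (intro mult_mono[OF Az power_mono[OF z]]) auto
    also have "\<dots> \<le> c * z ^ i * z ^ i"
      using z assms i power_increasing[of 1 i z] by (intro mult_right_mono mult_left_mono) auto
    also have "\<dots> = c * exp (a * \<delta> * real i)"
    proof -
      have "z ^ i = exp (real i * (\<delta> / 2 * a))" unfolding z_def by (rule exp_of_nat_mult[symmetric])
      then have "z ^ i * z ^ i = exp (real i * (\<delta> / 2 * a) + real i * (\<delta> / 2 * a))" by (simp only: exp_add)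
      also have "real i * (\<delta> / 2 * a) + real i * (\<delta> / 2 * a) = a * \<delta> * real i" by (simp add: field_simps)
      finally show ?thesis by simp
    qed
    finally have "exp (ln K + a * scale_exponent g t i + - (c * exp (a * \<delta> * real i))) \<le> exp 0"
      by simp
    then show "K * exp (a * scale_exponent g t i) * exp (- (c * exp (a * \<delta> * real i))) \<le> 1"
      using assms unfolding exp_add by simp
  qed
qed

context long_range_percolation
begin

definition scale_ratio :: real where "scale_ratio = 2 * real CARD('n) / s"

definition scale_shift :: real where "scale_shift = 2 * real CARD('n) / (2 * real CARD('n) - s)"

definition scale :: "real \<Rightarrow> nat \<Rightarrow> real" where
  "scale a k = exp (a * scale_exponent scale_ratio scale_shift k)"

lemma scale_ratio_bounds: "1 < scale_ratio" "scale_ratio < 2"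
  using s_gt s_lt s_pos by (auto simp: scale_ratio_def field_simps)

lemma scale_shift_pos: "0 < scale_shift"
  using s_lt by (simp add: scale_shift_def)

text \<open>The mean number of open edges between two windows of radius \<open>scale a k\<close> at distance
  \<open>scale a (Suc k)\<close> is the left-hand side, up to constants. It grows exponentially in \<open>k\<close>, so its
  negative exponential outweighs the doubly exponential scales.\<close>

lemma scale_step:
  "scale a k ^ CARD('n) * scale a k ^ CARD('n) * scale a (Suc k) powr (- s)
    = exp (a * (2 * real CARD('n) - s) * real (Suc k))"
proof -
  let ?d = "real CARD('n)"
  let ?w = "scale_exponent scale_ratio scale_shift"
  have eq: "2 * ?d * ?w k - s * ?w (Suc k) = (2 * ?d - s) * real (Suc k)"
  proof -
    have 1: "s * scale_ratio = 2 * ?d" using s_pos by (simp add: scale_ratio_def)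
    have 2: "(2 * ?d - s) * scale_shift = 2 * ?d" using s_lt by (simp add: scale_shift_def)
    have "2 * ?d * ?w k - s * ?w (Suc k)
        = (2 * ?d - s * scale_ratio) * scale_ratio ^ k + (2 * ?d - s) * real k + ((2 * ?d - s) * scale_shift - s)"
      by (simp add: scale_exponent_def algebra_simps)
    also have "\<dots> = (2 * ?d - s) * real (Suc k)" unfolding 1 2 by (simp add: algebra_simps)
    finally show ?thesis .
  qed
  have p: "scale a k ^ CARD('n) = exp (?d * (a * ?w k))"
    unfolding scale_def by (rule exp_of_nat_mult[symmetric])
  have "scale a (Suc k) powr (- s) = exp (- s * (a * ?w (Suc k)))"
    by (simp add: scale_def powr_def)
  then have "scale a k ^ CARD('n) * scale a k ^ CARD('n) * scale a (Suc k) powr (- s)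
      = exp (?d * (a * ?w k) + ?d * (a * ?w k) + - s * (a * ?w (Suc k)))"
    unfolding p by (simp only: exp_add)
  also have "?d * (a * ?w k) + ?d * (a * ?w k) + - s * (a * ?w (Suc k)) = a * (2 * ?d * ?w k - s * ?w (Suc k))"
    by (simp add: algebra_simps)
  finally show ?thesis unfolding eq by (simp add: mult.assoc)
qed

text \<open>Induction on the level \<open>k\<close>, where the bound \<open>F\<close> satisfies \<open>F' = 2 * F + 2\<close>: one unit for the edge
  that bridges the gap, and one for the possible absence of such an edge. Both the pair \<open>x\<close>, \<open>y\<close> and
  the windows around them are confined to annuli, so that the lengths of edges used
  at different levels do not overlap. On level \<open>0\<close> a direct edge is available with
  high probability, since the distances there are at most \<open>\<beta> powr (1 / (2 * s))\<close>.\<close>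

lemma mean_short_dist_scale:
  obtains \<kappa> c a\<^sub>1 where "0 < \<kappa>" "\<kappa> < 1" "0 < c" "1 \<le> a\<^sub>1"
    "\<And>r. exp a\<^sub>1 \<le> r \<Longrightarrow> c * r ^ CARD('n) \<le> real (card {x. \<kappa> * r \<le> len x \<and> len x < r})"
    "\<And>a \<beta> k x y. a\<^sub>1 \<le> a \<Longrightarrow> exp (2 * s * (a * (1 + scale_shift))) \<le> \<beta> \<Longrightarrow>
       \<kappa> * scale a k \<le> len (x - y) \<Longrightarrow> len (x - y) < scale a k \<Longrightarrow>
       mean_short_dist \<beta> (2 * scale a k) x y \<le> ennreal (4 * 2 ^ k - 2)"
proof -
  obtain \<kappa> c r\<^sub>1 where \<kappa>: "0 < \<kappa>" "\<kappa> < 1" and c: "0 < c" and r1: "1 \<le> r\<^sub>1"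
    and card: "\<And>r. r\<^sub>1 \<le> r \<Longrightarrow> c * r ^ CARD('n) \<le> real (card {x. \<kappa> * r \<le> len x \<and> len x < r})"
    using card_annulus_lower by blast
  obtain \<rho> where \<rho>: "1 \<le> \<rho>" "\<And>\<beta> x y. 0 \<le> \<beta> \<Longrightarrow> \<rho> \<le> len (x - y) \<Longrightarrow>
       1 - connection_prob q \<beta> x y \<le> exp (- (\<beta> / 2 * len (x - y) powr (- s)))"
    using connection_prob_lower by blast
  obtain K\<^sub>0 where K0: "0 < K\<^sub>0" "\<And>x. real_of_int (\<Sum>i\<in>UNIV. \<bar>x $ i\<bar>) \<le> K\<^sub>0 * len x"
    using len_ge_l1 by blast
  define K where "K = max 1 K\<^sub>0"
  have K: "1 \<le> K" by (simp add: K_def)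
  have l1: "real (l1_norm x) \<le> K * len x" for x
  proof -
    have "real (l1_norm x) = real_of_int (\<Sum>i\<in>UNIV. \<bar>x $ i\<bar>)"
      using sum_nonneg[of UNIV "\<lambda>i. \<bar>x $ i\<bar>"] by (simp add: l1_norm_def)
    also have "\<dots> \<le> K\<^sub>0 * len x" by (rule K0)
    also have "\<dots> \<le> K * len x" by (intro mult_right_mono) (auto simp: K_def)
    finally show ?thesis .
  qed
  (* c3 collects the constants in the mean number of open edges between two windows. *)
  define c\<^sub>3 where "c\<^sub>3 = 1/2 * 2 powr (- s) * c\<^sup>2"
  have c3: "0 < c\<^sub>3" using c by (simp add: c\<^sub>3_def)
  define \<delta> where "\<delta> = 2 * real CARD('n) - s"
  have \<delta>: "0 < \<delta>" using s_lt by (simp add: \<delta>_def)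
  obtain a\<^sub>0 where a0: "1 \<le> a\<^sub>0" "\<And>a g i. a\<^sub>0 \<le> a \<Longrightarrow> 1 \<le> g \<Longrightarrow> g \<le> 2 \<Longrightarrow> 1 \<le> i \<Longrightarrow>
       K * exp (a * scale_exponent g scale_shift i) * exp (- (c\<^sub>3 * exp (a * \<delta> * real i))) \<le> 1"
    using doubly_exponential_dominates[OF c3 \<delta> less_imp_le[OF scale_shift_pos] K] by blast
  (* From B on, the volume bound for annuli holds, the annuli only contain points to which the
     bound on edge probabilities applies, consecutive scales are far apart, and a missing direct
     edge costs at most one unit on average. *)
  define B where "B = Max {r\<^sub>1, \<rho> / \<kappa>, 5 / \<kappa>, 8 * K}"
  have B: "r\<^sub>1 \<le> B" "\<rho> / \<kappa> \<le> B" "5 / \<kappa> \<le> B" "8 * K \<le> B" by (auto simp: B_def)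
  define a\<^sub>1 where "a\<^sub>1 = max a\<^sub>0 (ln B)"
  have "0 < B" using B(1) r1 by linarith
  then have a1: "a\<^sub>0 \<le> a\<^sub>1" "B \<le> exp a\<^sub>1" by (auto simp: a\<^sub>1_def ln_le_cancel_iff[symmetric] simp del: ln_le_cancel_iff)
  let ?w = "scale_exponent scale_ratio scale_shift"
  have main: "mean_short_dist \<beta> (2 * scale a k) x y \<le> ennreal (4 * 2 ^ k - 2)"
    if a: "a\<^sub>1 \<le> a" and \<beta>: "exp (2 * s * (a * (1 + scale_shift))) \<le> \<beta>"
      and xy: "\<kappa> * scale a k \<le> len (x - y)" "len (x - y) < scale a k" for a \<beta> k x y
  proof -
    have a': "1 \<le> a" "a\<^sub>0 \<le> a" using a a1 a0 by auto
    have Ba: "B \<le> exp a" using a1(2) a by (meson exp_le_cancel_iff order_trans)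
    have \<beta>0: "0 \<le> \<beta>" and \<beta>1: "1 \<le> \<beta>"
    proof -
      have "1 \<le> exp (2 * s * (a * (1 + scale_shift)))" using s_pos a' scale_shift_pos by simp
      then show "1 \<le> \<beta>" using \<beta> by linarith
      then show "0 \<le> \<beta>" by simp
    qed
    have Mpos: "0 < scale a k" for k by (simp add: scale_def)
    have MB: "B \<le> scale a k" for k
    proof -
      have "a * 1 \<le> a * ?w k"
        using scale_exponent_ge[of scale_ratio scale_shift k] scale_ratio_bounds scale_shift_pos a'
        by (intro mult_left_mono) auto
      then have "exp a \<le> scale a k" by (simp add: scale_def)
      then show ?thesis using Ba by linarith
    qed
    have MS: "5 * scale a k \<le> \<kappa> * scale a (Suc k)" for k
    proof -
      have "a * (?w k + 1) \<le> a * ?w (Suc k)"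
        using scale_exponent_Suc_ge[of scale_ratio] scale_ratio_bounds a' by (intro mult_left_mono) auto
      then have "exp (a * ?w k + a) \<le> scale a (Suc k)" by (simp add: scale_def algebra_simps)
      then have "scale a k * exp a \<le> scale a (Suc k)" by (simp add: scale_def exp_add)
      moreover have "scale a k * (5 / \<kappa>) \<le> scale a k * exp a"
        using Ba B(3) Mpos[of k] by (intro mult_left_mono) auto
      ultimately have "scale a k * (5 / \<kappa>) \<le> scale a (Suc k)" by linarith
      then show ?thesis using \<kappa> by (simp add: field_simps)
    qed
    have \<rho>M: "\<rho> \<le> \<kappa> * scale a k" for k
    proof -
      have "\<rho> / \<kappa> \<le> scale a k" using B(2) MB[of k] by linarith
      then show ?thesis using \<kappa> by (simp add: field_simps)
    qed
    show ?thesis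
      using xy
    proof (induction k arbitrary: x y)
      case 0
      let ?M = "scale a 0"
      have pos: "0 < len (x - y)" using 0 mult_pos_pos[OF \<kappa>(1) Mpos[of 0]] by linarith
      have ne: "x \<noteq> y" using pos by auto
      have M: "?M = exp (a * (1 + scale_shift))" by (simp add: scale_def scale_exponent_def)
      have \<beta>M: "?M powr (2 * s) \<le> \<beta>" using \<beta> by (simp add: M powr_def ac_simps)
      have "1 \<le> ?M" using MB[of 0] B(1) r1 by linarith
      have "?M powr 1 \<le> ?M powr s" using \<open>1 \<le> ?M\<close> s_ge_1 by (intro powr_mono) auto
      also have "\<dots> = ?M powr (2 * s) * ?M powr (- s)" by (simp flip: powr_add)
      also have "\<dots> \<le> \<beta> * len (x - y) powr (- s)"
        using \<beta>M \<beta>0 0 pos s_pos by (intro mult_mono powr_mono2') auto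
      finally have "?M \<le> \<beta> * len (x - y) powr (- s)" using \<open>1 \<le> ?M\<close> by simp
      then have "exp (- (\<beta> / 2 * len (x - y) powr (- s))) \<le> exp (- (?M / 2))" by simp
      moreover have "\<rho> \<le> len (x - y)" using \<rho>M[of 0] 0(1) by linarith
      ultimately have p: "1 - connection_prob q \<beta> x y \<le> exp (- (?M / 2))"
        using \<rho>(2)[OF \<beta>0, of x y] by linarith
      have "mean_short_dist \<beta> (2 * ?M) x y \<le> 1 + of_nat (l1_norm (x - y)) * ennreal (1 - connection_prob q \<beta> x y)"
        using 0 Mpos[of 0] by (intro mean_short_dist_edge \<beta>0 ne) auto
      also have "\<dots> \<le> 1 + ennreal (K * ?M) * ennreal (exp (- (?M / 2)))"
      proof (intro add_left_mono mult_mono ennreal_leI p)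
        have "K * len (x - y) \<le> K * ?M" using K 0 by (intro mult_left_mono) auto
        then show "of_nat (l1_norm (x - y)) \<le> ennreal (K * ?M)"
          using l1[of "x - y"] by (simp add: ennreal_of_nat_eq_real_of_nat ennreal_leI)
      qed auto
      also have "\<dots> \<le> ennreal (1 + K * ?M * exp (- (?M / 2)))"
        using K Mpos[of 0] by (simp add: ennreal_mult ennreal_plus)
      also have "\<dots> \<le> ennreal 2"
      proof (rule ennreal_leI)
        have "8 * K \<le> ?M" using B(4) MB[of 0] by linarith
        then have "K * ?M \<le> 1 * exp (1/2 * ?M)"
          using K by (intro exp_ge_linear) (auto simp: power2_eq_square)
        then show "1 + K * ?M * exp (- (?M / 2)) \<le> 2" by (simp add: exp_minus field_simps)
      qed
      finally show ?case by simp
    next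
      case (Suc k)
      let ?M = "scale a k" and ?M' = "scale a (Suc k)"
      define ann where "ann z = {u. \<kappa> * ?M \<le> len (z - u) \<and> len (z - u) < ?M}" for z
      have ann_img: "ann z = (\<lambda>u. z - u) ` {x. \<kappa> * ?M \<le> len x \<and> len x < ?M}" for z
      proof
        show "ann z \<subseteq> (\<lambda>u. z - u) ` {x. \<kappa> * ?M \<le> len x \<and> len x < ?M}"
        proof
          fix u assume "u \<in> ann z"
          then show "u \<in> (\<lambda>u. z - u) ` {x. \<kappa> * ?M \<le> len x \<and> len x < ?M}"
            by (intro image_eqI[of _ _ "z - u"]) (auto simp: ann_def)
        qed
      qed (auto simp: ann_def)
      have fin: "finite (ann z)" for z
        unfolding ann_img using finite_ball[of ?M] by (intro finite_imageI) (rule finite_subset[rotated], auto)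
      have card_ann: "c * ?M ^ CARD('n) \<le> real (card (ann z))" for z
      proof -
        have "card (ann z) = card {x. \<kappa> * ?M \<le> len x \<and> len x < ?M}"
          unfolding ann_img by (intro card_image inj_onI) auto
        then show ?thesis using card[of ?M] MB[of k] B(1) by simp
      qed
      have M'M: "5 * ?M \<le> \<kappa> * ?M'" "5 * ?M \<le> ?M'"
      proof -
        show "5 * ?M \<le> \<kappa> * ?M'" by (rule MS)
        also have "\<dots> \<le> 1 * ?M'" using \<kappa> Mpos[of "Suc k"] by (intro mult_right_mono) auto
        finally show "5 * ?M \<le> ?M'" by simp
      qed
      have long: "3 * ?M < len (u - v) \<and> len (u - v) \<le> 2 * ?M'" if "u \<in> ann x" "v \<in> ann y" for u v
      proof -
        have ux: "len (x - u) < ?M" and vy: "len (y - v) < ?M" using that by (auto simp: ann_def)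
        have "len (x - y) \<le> len (x - u) + (len (u - v) + len (v - y))"
          using len_diff_triangle[of x y u] len_diff_triangle[of u y v] by linarith
        then have "3 * ?M < len (u - v)" using ux vy Suc.prems(1) M'M(1) len_commute[of v y] by linarith
        moreover have "len (u - v) \<le> len (u - x) + (len (x - y) + len (y - v))"
          using len_diff_triangle[of u v x] len_diff_triangle[of x v y] by linarith
        then have "len (u - v) \<le> 2 * ?M'"
          using ux vy Suc.prems(2) M'M(2) len_commute[of u x] Mpos[of k] by linarith
        ultimately show ?thesis ..
      qed
      have IH1: "mean_short_dist \<beta> (2 * ?M) x u \<le> ennreal (4 * 2 ^ k - 2)" if "u \<in> ann x" for u
        using that by (intro Suc.IH) (auto simp: ann_def)
      have IH2: "mean_short_dist \<beta> (2 * ?M) v y \<le> ennreal (4 * 2 ^ k - 2)" if "v \<in> ann y" for v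
        using that len_commute[of v y] by (intro Suc.IH) (auto simp: ann_def)
      define p where "p = exp (- (\<beta> / 2 * (2 * ?M') powr (- s)))"
      define Q where "Q = (\<lambda>(u, v). {u, v}) ` (ann x \<times> ann y)"
      have disj: "u \<noteq> v" if "u \<in> ann x" "v \<in> ann y" for u v
        using long[OF that] Mpos[of k] by auto
      have cardQ: "card Q = card (ann x) * card (ann y)"
      proof -
        have "inj_on (\<lambda>(u, v). {u, v}) (ann x \<times> ann y)"
          using disj by (intro inj_onI) (auto simp: doubleton_eq_iff)
        then show ?thesis unfolding Q_def by (simp add: card_image card_cartesian_product)
      qed
      have "perc_pr q \<beta> (\<lambda>G. \<forall>u\<in>ann x. \<forall>v\<in>ann y. \<not> G {u, v}) = perc_pr q \<beta> (\<lambda>G. \<forall>e\<in>Q. \<not> G e)"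
        by (simp add: Q_def)
      also have "\<dots> \<le> ennreal (p ^ card Q)"
      proof (rule perc_pr_no_edge_le[where q = q, OF q_sym \<beta>0])
        show "finite Q" unfolding Q_def using fin by simp
        show "0 \<le> p" by (simp add: p_def)
        fix e assume "e \<in> Q"
        then obtain u v where e: "e = {u, v}" "u \<in> ann x" "v \<in> ann y" by (auto simp: Q_def)
        have uv: "u \<noteq> v" "3 * ?M < len (u - v)" "len (u - v) \<le> 2 * ?M'" using disj long e by auto
        have "\<kappa> * ?M \<le> 1 * ?M" using \<kappa> Mpos[of k] by (intro mult_right_mono) auto
        then have "\<rho> \<le> len (u - v)" using \<rho>M[of k] uv(2) Mpos[of k] by linarith
        then have "1 - connection_prob q \<beta> u v \<le> exp (- (\<beta> / 2 * len (u - v) powr (- s)))"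
          by (rule \<rho>(2)[OF \<beta>0])
        also have "\<dots> \<le> p"
        proof -
          have "(2 * ?M') powr (- s) \<le> len (u - v) powr (- s)"
            using uv Mpos[of k] s_pos by (intro powr_mono2') auto
          then have "\<beta> / 2 * (2 * ?M') powr (- s) \<le> \<beta> / 2 * len (u - v) powr (- s)"
            using \<beta>0 by (intro mult_left_mono) auto
          then show ?thesis by (simp add: p_def)
        qed
        finally show "\<exists>x y. e = {x, y} \<and> x \<noteq> y \<and> 1 - connection_prob q \<beta> x y \<le> p" using e uv by blast
      qed
      also have "\<dots> \<le> ennreal (exp (- (c\<^sub>3 * exp (a * \<delta> * real (Suc k)))))"
      proof (rule ennreal_leI)
        have cards: "(c * ?M ^ CARD('n)) * (c * ?M ^ CARD('n)) \<le> real (card (ann x)) * real (card (ann y))"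
          using card_ann c Mpos[of k] by (intro mult_mono) auto
        then have "1/2 * (2 powr (- s) * ?M' powr (- s)) * ((c * ?M ^ CARD('n)) * (c * ?M ^ CARD('n)))
            \<le> \<beta> / 2 * (2 powr (- s) * ?M' powr (- s)) * (real (card (ann x)) * real (card (ann y)))"
          using \<beta>1 c Mpos[of k] by (intro mult_mono[OF _ cards] mult_right_mono) auto
        moreover have "1/2 * (2 powr (- s) * ?M' powr (- s)) * ((c * ?M ^ CARD('n)) * (c * ?M ^ CARD('n)))
            = c\<^sub>3 * (?M ^ CARD('n) * ?M ^ CARD('n) * ?M' powr (- s))"
          by (simp add: c\<^sub>3_def power2_eq_square)
        ultimately have "c\<^sub>3 * exp (a * \<delta> * real (Suc k))
            \<le> \<beta> / 2 * (2 powr (- s) * ?M' powr (- s)) * (real (card (ann x)) * real (card (ann y)))"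
          unfolding scale_step \<delta>_def by linarith
        also have "\<dots> = real (card Q) * (\<beta> / 2 * (2 * ?M') powr (- s))"
          using Mpos[of "Suc k"] by (simp add: cardQ powr_mult)
        finally have "- (real (card Q) * (\<beta> / 2 * (2 * ?M') powr (- s))) \<le> - (c\<^sub>3 * exp (a * \<delta> * real (Suc k)))"
          by simp
        moreover have "p ^ card Q = exp (- (real (card Q) * (\<beta> / 2 * (2 * ?M') powr (- s))))"
          unfolding p_def by (simp flip: exp_of_nat_mult)
        ultimately show "p ^ card Q \<le> exp (- (c\<^sub>3 * exp (a * \<delta> * real (Suc k))))"
          by (simp only: exp_le_cancel_iff)
      qed
      finally have none: "perc_pr q \<beta> (\<lambda>G. \<forall>u\<in>ann x. \<forall>v\<in>ann y. \<not> G {u, v})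
          \<le> ennreal (exp (- (c\<^sub>3 * exp (a * \<delta> * real (Suc k)))))" .
      have "mean_short_dist \<beta> (2 * ?M') x y \<le> 2 * ennreal (4 * 2 ^ k - 2) + 1 +
          of_nat (l1_norm (x - y)) * perc_pr q \<beta> (\<lambda>G. \<forall>u\<in>ann x. \<forall>v\<in>ann y. \<not> G {u, v})"
      proof (rule mean_short_dist_bridge[where l = "2 * ?M"])
        show "2 * ?M \<le> 2 * ?M'" using M'M(2) Mpos[of k] by linarith
        show "0 \<le> 2 * ?M" using Mpos[of k] by simp
        show "2 * ?M < len (u - v) \<and> len (u - v) \<le> 2 * ?M'" if "u \<in> ann x" "v \<in> ann y" for u v
          using long[OF that] Mpos[of k] by auto
      qed (use fin IH1 IH2 in auto)
      also have "\<dots> \<le> 2 * ennreal (4 * 2 ^ k - 2) + 1 +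
          ennreal (K * ?M') * ennreal (exp (- (c\<^sub>3 * exp (a * \<delta> * real (Suc k)))))"
      proof (intro add_left_mono mult_mono none)
        have "K * len (x - y) \<le> K * ?M'" using K Suc.prems by (intro mult_left_mono) auto
        then show "of_nat (l1_norm (x - y)) \<le> ennreal (K * ?M')"
          using l1[of "x - y"] by (simp add: ennreal_of_nat_eq_real_of_nat ennreal_leI)
      qed auto
      also have "ennreal (K * ?M') * ennreal (exp (- (c\<^sub>3 * exp (a * \<delta> * real (Suc k))))) \<le> ennreal 1"
      proof -
        have "K * ?M' * exp (- (c\<^sub>3 * exp (a * \<delta> * real (Suc k)))) \<le> 1"
          unfolding scale_def using scale_ratio_bounds a' by (intro a0(2)) auto
        then show ?thesis using K Mpos[of "Suc k"] by (subst ennreal_mult[symmetric]) (auto intro!: ennreal_leI)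
      qed
      also have "2 * ennreal (4 * 2 ^ k - 2) + 1 + ennreal 1 = ennreal (4 * 2 ^ Suc k - 2)"
      proof -
        define X :: real where "X = 4 * 2 ^ k - 2"
        have "(1::real) \<le> 2 ^ k" by simp
        then have X: "0 \<le> X" unfolding X_def by linarith
        have "ennreal (4 * 2 ^ Suc k - 2) = ennreal (2 * X + (1 + 1))" by (simp add: X_def)
        also have "\<dots> = ennreal (2 * X) + ennreal (1 + 1)" using X by (intro ennreal_plus) auto
        also have "\<dots> = 2 * ennreal X + (1 + 1)" using X by (simp add: ennreal_mult)
        finally show ?thesis by (simp add: X_def add.assoc)
      qed
      finally show ?case by (simp add: add_left_mono)
    qed
  qed
  show ?thesis
  proof (rule that[OF \<kappa> c _ _ main])
    show "1 \<le> a\<^sub>1" using a0 a1 by simp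
    show "c * r ^ CARD('n) \<le> real (card {x. \<kappa> * r \<le> len x \<and> len x < r})" if "exp a\<^sub>1 \<le> r" for r
      using that a1(2) B(1) by (intro card) linarith
  qed
qed


lemma short_dist_Markov:
  assumes \<beta>: "0 \<le> \<beta>" and n: "0 < n" and le: "mean_short_dist \<beta> l x y \<le> ennreal (real n / 2)"
  shows "ennreal (1/2) \<le> reach_pr q \<beta> n x y"
proof -
  let ?P = "percolation q \<beta>"
  interpret prob_space ?P by (rule prob_space_percolation)
  let ?S = "{G \<in> space ?P. y \<in> gball (short l G) n x}"
  let ?F = "{G \<in> space ?P. \<not> y \<in> gball (short l G) n x}"
  have S: "?S \<in> sets ?P" and F: "?F \<in> sets ?P" by measurable
  have "ennreal (real n) * emeasure ?P ?F = (\<integral>\<^sup>+G. of_nat n * indicator ?F G \<partial>?P)"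
    using F by (simp add: nn_integral_cmult ennreal_of_nat_eq_real_of_nat)
  also have "\<dots> \<le> mean_short_dist \<beta> l x y"
    unfolding mean_short_dist_def
  proof (intro nn_integral_mono)
    fix G
    show "of_nat n * indicator ?F G \<le> (of_nat (short_dist l G x y) :: ennreal)"
    proof (cases "G \<in> ?F")
      case True
      then have "n \<le> short_dist l G x y" using short_dist_le_iff[of l G x y n] by simp
      then show ?thesis using True by simp
    qed simp
  qed
  also note le
  finally have "ennreal (real n * prob ?F) \<le> ennreal (real n / 2)"
    using n by (simp add: emeasure_eq_measure ennreal_mult)
  then have "real n * prob ?F \<le> real n / 2" using n by (subst (asm) ennreal_le_iff) auto
  then have "prob ?F \<le> 1/2" using n by (simp add: field_simps)
  moreover have "prob ?S = 1 - prob ?F"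
  proof -
    have "?S = space ?P - ?F" by auto
    then show ?thesis using prob_compl[OF F] by simp
  qed
  moreover have "prob ?S \<le> prob {G \<in> space ?P. y \<in> gball G n x}"
  proof (rule finite_measure_mono_AE)
    show "AE G in ?P. G \<in> ?S \<longrightarrow> G \<in> {G \<in> space ?P. y \<in> gball G n x}"
      using AE_short_subset[OF \<beta>] by eventually_elim blast
  qed measurable
  ultimately have "1/2 \<le> prob {G \<in> space ?P. y \<in> gball G n x}" by linarith
  then show ?thesis unfolding emeasure_eq_measure by (rule ennreal_leI)
qed

lemma Delta_exp_pos: "0 < Delta_exp CARD('n) s"
  using scale_ratio_bounds by (simp add: Delta_exp_def scale_ratio_def)

lemma scale_ratio_powr_Delta: "scale_ratio powr Delta_exp CARD('n) s = 2"
proof -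
  have "Delta_exp CARD('n) s = ln 2 / ln scale_ratio"
    by (simp add: Delta_exp_def scale_ratio_def log_def)
  then show ?thesis using scale_ratio_bounds by (simp add: powr_def)
qed

text \<open>The number of levels is chosen such that \<open>ln r = a * scale_exponent g t k\<close> with \<open>a\<close> between two
  multiples of \<open>ln \<beta>\<close>. Then \<open>g ^ k\<close> is at most a multiple of \<open>ln r / ln \<beta>\<close>, and
  the mean distance is of order \<open>2 ^ k\<close>, which is the power \<open>Delta_exp\<close> of \<open>g ^ k\<close>.\<close>

theorem annulus_connected_quickly:
  obtains \<kappa> c C \<beta>\<^sub>1 where "0 < c" "0 < C" "1 < \<beta>\<^sub>1"
    "\<And>\<beta> r. \<beta>\<^sub>1 \<le> \<beta> \<Longrightarrow> \<beta> \<le> r \<Longrightarrow> c * r ^ CARD('n) \<le> real (card {x. \<kappa> * r \<le> len x \<and> len x < r})"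
    "\<And>\<beta> r. \<beta>\<^sub>1 \<le> \<beta> \<Longrightarrow> \<beta> \<le> r \<Longrightarrow>
       \<exists>n. real n \<le> C * (ln r / ln \<beta>) powr Delta_exp CARD('n) s \<and>
         (\<forall>x. \<kappa> * r \<le> len x \<and> len x < r \<longrightarrow> ennreal (1/2) \<le> reach_pr q \<beta> n 0 x)"
proof -
  obtain \<kappa> c a\<^sub>1 where *: "0 < \<kappa>" "\<kappa> < 1" "0 < c" "1 \<le> a\<^sub>1"
    "\<And>r. exp a\<^sub>1 \<le> r \<Longrightarrow> c * r ^ CARD('n) \<le> real (card {x. \<kappa> * r \<le> len x \<and> len x < r})"
    "\<And>a \<beta> k x y. a\<^sub>1 \<le> a \<Longrightarrow> exp (2 * s * (a * (1 + scale_shift))) \<le> \<beta> \<Longrightarrow>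
       \<kappa> * scale a k \<le> len (x - y) \<Longrightarrow> len (x - y) < scale a k \<Longrightarrow>
       mean_short_dist \<beta> (2 * scale a k) x y \<le> ennreal (4 * 2 ^ k - 2)"
    by (rule mean_short_dist_scale) (rule that; assumption)
  let ?\<Delta> = "Delta_exp CARD('n) s" and ?w = "scale_exponent scale_ratio scale_shift"
  define b where "b = 2 * s * (1 + scale_shift)"
  have b: "2 \<le> b"
  proof -
    have "2 * 1 * 1 \<le> b" unfolding b_def using s_ge_1 scale_shift_pos by (intro mult_mono) auto
    then show ?thesis by simp
  qed
  define \<beta>\<^sub>1 where "\<beta>\<^sub>1 = exp (3 * b * a\<^sub>1)"
  define C where "C = 8 * (3 * b) powr ?\<Delta>"
  have w1: "1 \<le> ?w k" "scale_ratio ^ k \<le> ?w k" for k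
    using scale_exponent_ge[of scale_ratio scale_shift k] scale_ratio_bounds scale_shift_pos by auto
  show ?thesis
  proof (rule that[of c C \<beta>\<^sub>1 \<kappa>])
    show "0 < c" by fact
    show "0 < C" using b by (simp add: C_def)
    show "1 < \<beta>\<^sub>1" using b *(4) by (simp add: \<beta>\<^sub>1_def)
    fix \<beta> r assume \<beta>: "\<beta>\<^sub>1 \<le> \<beta>" and r: "\<beta> \<le> r"
    have "1 * a\<^sub>1 \<le> 3 * b * a\<^sub>1" using b *(4) by (intro mult_right_mono) auto
    then have "exp a\<^sub>1 \<le> \<beta>\<^sub>1" by (simp add: \<beta>\<^sub>1_def)
    then show "c * r ^ CARD('n) \<le> real (card {x. \<kappa> * r \<le> len x \<and> len x < r})"
      using \<beta> r by (intro *(5)) linarith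
    have \<beta>pos: "0 < \<beta>" using \<beta> unfolding \<beta>\<^sub>1_def using exp_gt_zero[of "3 * b * a\<^sub>1"] by linarith
    then have rpos: "0 < r" using r by linarith
    have ln\<beta>: "3 * b * a\<^sub>1 \<le> ln \<beta>" using \<beta> \<beta>pos by (simp add: \<beta>\<^sub>1_def ln_ge_iff)
    have lnr: "ln \<beta> \<le> ln r" using r \<beta>pos by simp
    have "0 < 3 * b * a\<^sub>1" using b *(4) by simp
    then have ln\<beta>0: "0 < ln \<beta>" using ln\<beta> by linarith
    have ex: "\<exists>k. ln r * b \<le> ln \<beta> * ?w k"
    proof -
      obtain k where "ln r * b / ln \<beta> < real k" using reals_Archimedean2 by blast
      moreover have "real k \<le> ?w k"
        using scale_ratio_bounds scale_shift_pos by (simp add: scale_exponent_def add_nonneg_nonneg)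
      ultimately have "ln r * b / ln \<beta> \<le> ?w k" by linarith
      then show ?thesis using ln\<beta>0 by (auto simp: field_simps intro!: exI[of _ k])
    qed
    define k where "k = (LEAST k. ln r * b \<le> ln \<beta> * ?w k)"
    have k: "ln r * b \<le> ln \<beta> * ?w k" unfolding k_def using ex by (rule LeastI_ex)
    have k3: "ln \<beta> * ?w k \<le> 3 * (ln r * b)"
    proof (cases k)
      case 0
      have "?w 0 \<le> b"
      proof -
        have "1 * (1 + scale_shift) \<le> 2 * s * (1 + scale_shift)"
          using s_ge_1 scale_shift_pos by (intro mult_right_mono) auto
        then show ?thesis by (simp add: scale_exponent_def b_def)
      qed
      then have "ln \<beta> * ?w 0 \<le> ln r * b"
        using lnr ln\<beta>0 w1[of 0] by (intro mult_mono) auto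
      moreover have "0 \<le> ln r * b" using lnr ln\<beta>0 b by (intro mult_nonneg_nonneg) auto
      ultimately show ?thesis unfolding 0 by linarith
    next
      case (Suc j)
      then have "j < k" by simp
      from not_less_Least[OF this[unfolded k_def]] have "ln \<beta> * ?w j < ln r * b" by (simp only: not_le)
      moreover have "ln \<beta> * ?w k \<le> ln \<beta> * (3 * ?w j)"
        unfolding Suc using ln\<beta>0 scale_ratio_bounds scale_shift_pos
        by (intro mult_left_mono scale_exponent_Suc_le) auto
      ultimately show ?thesis by linarith
    qed
    define a where "a = ln r / ?w k"
    have aw: "a * ?w k = ln r" using w1(1)[of k] by (simp add: a_def)
    have sc: "scale a k = r" unfolding scale_def aw using rpos by (rule exp_ln)
    have ab: "a * b \<le> ln \<beta>"
    proof -
      have "a * b * ?w k = (a * ?w k) * b" by (simp only: mult.assoc mult.commute[of b])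
      also have "\<dots> = ln r * b" by (subst aw) (rule refl)
      also have "\<dots> \<le> ln \<beta> * ?w k" by (rule k)
      finally have "a * b * ?w k \<le> ln \<beta> * ?w k" .
      then show ?thesis using less_le_trans[OF zero_less_one w1(1)[of k]] by (rule mult_right_le_imp_le)
    qed
    have ab3: "ln \<beta> \<le> 3 * b * a"
    proof -
      have "ln \<beta> * ?w k \<le> 3 * (ln r * b)" by (rule k3)
      also have "\<dots> = 3 * ((a * ?w k) * b)" by (subst aw) (rule refl)
      also have "\<dots> = 3 * b * a * ?w k" by (simp only: mult.assoc mult.commute mult.left_commute)
      finally have "ln \<beta> * ?w k \<le> 3 * b * a * ?w k" .
      then show ?thesis using less_le_trans[OF zero_less_one w1(1)[of k]] by (rule mult_right_le_imp_le)
    qed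
    have a1: "a\<^sub>1 \<le> a"
    proof -
      have "3 * b * a\<^sub>1 \<le> 3 * b * a" using ab3 ln\<beta> by linarith
      then show ?thesis using b by simp
    qed
    have base: "exp (2 * s * (a * (1 + scale_shift))) \<le> \<beta>"
    proof -
      have "2 * s * (a * (1 + scale_shift)) \<le> ln \<beta>" using ab by (simp add: b_def ac_simps)
      then have "exp (2 * s * (a * (1 + scale_shift))) \<le> exp (ln \<beta>)" by (simp only: exp_le_cancel_iff)
      then show ?thesis using \<beta>pos by simp
    qed
    define n where "n = (8 * 2 ^ k :: nat)"
    have "real n \<le> C * (ln r / ln \<beta>) powr ?\<Delta>"
    proof -
      have "scale_ratio ^ k \<le> 3 * b * (ln r / ln \<beta>)"
      proof -
        have "ln \<beta> * scale_ratio ^ k \<le> ln \<beta> * ?w k" using w1(2)[of k] ln\<beta>0 by (intro mult_left_mono) auto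
        then have "ln \<beta> * scale_ratio ^ k \<le> 3 * b * ln r" using k3 by (simp add: ac_simps)
        then show ?thesis using ln\<beta>0 by (simp add: field_simps)
      qed
      then have "(scale_ratio ^ k) powr ?\<Delta> \<le> (3 * b * (ln r / ln \<beta>)) powr ?\<Delta>"
        using Delta_exp_pos scale_ratio_bounds by (intro powr_mono2) auto
      also have "(scale_ratio ^ k) powr ?\<Delta> = 2 ^ k"
      proof -
        have "(scale_ratio ^ k) powr ?\<Delta> = (scale_ratio powr ?\<Delta>) ^ k"
          using scale_ratio_bounds by (simp add: powr_powr mult.commute flip: powr_realpow)
        then show ?thesis by (simp add: scale_ratio_powr_Delta)
      qed
      also have "(3 * b * (ln r / ln \<beta>)) powr ?\<Delta> = (3 * b) powr ?\<Delta> * (ln r / ln \<beta>) powr ?\<Delta>"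
        by (rule powr_mult)
      finally show ?thesis by (simp add: n_def C_def)
    qed
    moreover have "ennreal (1/2) \<le> reach_pr q \<beta> n 0 x"
      if "\<kappa> * r \<le> len x \<and> len x < r" for x
    proof (rule short_dist_Markov)
      show "0 \<le> \<beta>" "0 < n" using \<beta>pos by (auto simp: n_def)
      have "mean_short_dist \<beta> (2 * scale a k) 0 x \<le> ennreal (4 * 2 ^ k - 2)"
        using that by (intro *(6) a1 base) (auto simp: sc)
      also have "\<dots> \<le> ennreal (real n / 2)" by (intro ennreal_leI) (simp add: n_def)
      finally show "mean_short_dist \<beta> (2 * scale a k) 0 x \<le> ennreal (real n / 2)" .
    qed
    ultimately show "\<exists>n. real n \<le> C * (ln r / ln \<beta>) powr ?\<Delta> \<and>
         (\<forall>x. \<kappa> * r \<le> len x \<and> len x < r \<longrightarrow> ennreal (1/2) \<le> reach_pr q \<beta> n 0 x)"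
      by blast
  qed
qed

end

section \<open>From distances to the limiting functions\<close>

lemma measurable_chem_dist [measurable]:
  "(\<lambda>G. chem_dist G x y) \<in> measurable (percolation q \<beta>) (count_space UNIV)"
proof -
  have "chem_dist G x y = (if \<exists>n. y \<in> gball G n x then enat (LEAST n. y \<in> gball G n x) else \<infinity>)" for G
  proof (cases "\<exists>n. y \<in> gball G n x")
    case True
    let ?m = "LEAST n. y \<in> gball G n x"
    have "chem_dist G x y \<le> enat ?m" unfolding chem_dist_le_iff using True by (rule LeastI_ex)
    moreover have "enat ?m \<le> chem_dist G x y"
    proof (cases "chem_dist G x y")
      case (enat k)
      then have "y \<in> gball G k x" unfolding chem_dist_le_iff[symmetric] by simp
      then have "?m \<le> k" by (rule Least_le)
      then show ?thesis by (simp add: enat)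
    qed simp
    ultimately show ?thesis using True by simp
  next
    case False
    then have "\<not> chem_dist G x y \<le> enat n" for n unfolding chem_dist_le_iff by blast
    then show ?thesis using False by (cases "chem_dist G x y") auto
  qed
  then have "(\<lambda>G. chem_dist G x y)
      = (\<lambda>G. if \<exists>n. y \<in> gball G n x then enat (LEAST n. y \<in> gball G n x) else \<infinity>)" by (rule ext)
  also have "\<dots> \<in> measurable (percolation q \<beta>) (count_space UNIV)" by measurable
  finally show ?thesis .
qed

lemma far_is_exceptional:
  fixes L :: real
  assumes "0 < L" "2 * L \<le> real n + 1" "\<not> D \<le> enat n"
  shows "ereal (1/2) < \<bar>ereal_of_enat D / ereal L - 1\<bar>"
proof (cases D)
  case (enat m)
  then have "real n + 1 \<le> real m" using assms(3) by simp
  then have "2 * L \<le> real m" using assms(2) by linarith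
  then have "2 \<le> real m / L" using assms(1) by (simp add: field_simps)
  then have "1/2 < \<bar>real m / L - 1\<bar>" by linarith
  moreover have "\<bar>ereal_of_enat D / ereal L - 1\<bar> = ereal \<bar>real m / L - 1\<bar>"
    using assms(1) by (simp add: enat one_ereal_def)
  ultimately show ?thesis by (simp only: less_ereal.simps)
qed (use assms(1) in simp)

lemma near_is_exceptional:
  fixes L :: real
  assumes "0 < L" "4 * real n \<le> L" "D \<le> enat n"
  shows "ereal (1/2) < \<bar>ereal_of_enat D / ereal L - 1\<bar>"
proof (cases D)
  case (enat m)
  then have "4 * real m \<le> L" using assms(2,3) by simp
  then have "real m / L \<le> 1/4" using assms(1) by (simp add: field_simps)
  then have "1/2 < \<bar>real m / L - 1\<bar>" by linarith
  moreover have "\<bar>ereal_of_enat D / ereal L - 1\<bar> = ereal \<bar>real m / L - 1\<bar>"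
    using assms(1) by (simp add: enat one_ereal_def)
  ultimately show ?thesis by (simp only: less_ereal.simps)
qed (use assms(3) in simp)

context long_range_percolation
begin

lemma lattice_ball_eq: "lattice_ball N 0 r = {x. len x < r}"
  by (simp add: lattice_ball_def flip: len_def)

definition exceptions_vanish :: "real \<Rightarrow> (real \<Rightarrow> real) \<Rightarrow> real \<Rightarrow> bool" where
  "exceptions_vanish \<beta> f \<epsilon> \<longleftrightarrow> tendsto_in_prob (percolation q \<beta>)
     (\<lambda>r G. r powr (- real CARD('n)) * real (card (exceptional_points N s f \<epsilon> r G))) 0 at_top"

text \<open>The properties of \<open>\<phi> \<beta>\<close>, for a single non-exceptional \<open>\<beta>\<close>, that both bounds rest on.\<close>

definition convergent_at :: "real \<Rightarrow> (real \<Rightarrow> real) \<Rightarrow> bool" where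
  "convergent_at \<beta> f \<longleftrightarrow> (\<forall>r>1. 0 < f r) \<and> (\<forall>r>1. f (r powr gamma_exp CARD('n) s) = f r) \<and>
     (\<forall>\<epsilon>>0. exceptions_vanish \<beta> f \<epsilon>)"

text \<open>The event \<open>B x\<close> forces \<open>x\<close> to be exceptional, and it does so for a positive fraction of the ball
  on average.\<close>

definition likely_exceptions :: "real \<Rightarrow> (real \<Rightarrow> real) \<Rightarrow> real \<Rightarrow> real \<Rightarrow> real \<Rightarrow> bool" where
  "likely_exceptions \<beta> f \<epsilon> a r \<longleftrightarrow> (\<exists>A B. A \<subseteq> lattice_ball N 0 r \<and>
     (\<forall>x\<in>A. perc_event q \<beta> (B x)) \<and>
     (\<forall>x\<in>A. \<forall>G. B x G \<longrightarrow> x \<in> exceptional_points N s f \<epsilon> r G) \<and>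
     ennreal (a * r ^ CARD('n)) \<le> (\<Sum>x\<in>A. perc_pr q \<beta> (B x)))"

text \<open>A first moment argument: there are at most \<open>C * r ^ CARD('n)\<close> exceptional points, so their
  number can only have a mean of the same order if it has this order with a probability that
  is bounded below.\<close>

lemma expected_exceptional_points_bound:
  assumes C: "0 < C" "\<And>r. 1 \<le> r \<Longrightarrow> real (card {x. len x < r}) \<le> C * r ^ CARD('n)"
    and r: "1 \<le> r" and a: "0 < a" and likely: "likely_exceptions \<beta> f \<epsilon> a r"
  shows "a / (2 * C) \<le> measure (percolation q \<beta>) {G \<in> space (percolation q \<beta>).
    \<bar>r powr (- real CARD('n)) * real (card (exceptional_points N s f \<epsilon> r G)) - 0\<bar> > a / 2}"
proof -
  let ?P = "percolation q \<beta>" and ?d = "CARD('n)"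
  interpret prob_space ?P by (rule prob_space_percolation)
  obtain A B where A: "A \<subseteq> lattice_ball N 0 r"
    and B: "\<And>x. x \<in> A \<Longrightarrow> Measurable.pred ?P (B x)"
    and exc: "\<And>x G. x \<in> A \<Longrightarrow> B x G \<Longrightarrow> x \<in> exceptional_points N s f \<epsilon> r G"
    and sum: "ennreal (a * r ^ ?d) \<le> (\<Sum>x\<in>A. perc_pr q \<beta> (B x))"
    using likely unfolding likely_exceptions_def by blast
  let ?X = "\<lambda>G. exceptional_points N s f \<epsilon> r G"
  let ?E = "{G \<in> space ?P. \<bar>r powr (- real ?d) * real (card (?X G)) - 0\<bar> > a / 2}"
  have fin: "finite (lattice_ball N 0 r)" unfolding lattice_ball_eq by (rule finite_ball)
  then have finA: "finite A" using A finite_subset by blast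
  have X_sub: "?X G \<subseteq> lattice_ball N 0 r" for G by (auto simp: exceptional_points_def)
  define far where "far D \<longleftrightarrow> \<bar>ereal_of_enat D / ereal (f r * ln r powr Delta_exp CARD('n) s) - 1\<bar> > ereal \<epsilon>" for D
  have cardX: "card (?X G) = (\<Sum>x\<in>lattice_ball N 0 r. if far (chem_dist G 0 x) then 1 else 0)" for G
  proof -
    have "?X G = lattice_ball N 0 r \<inter> {x. far (chem_dist G 0 x)}"
      by (auto simp: exceptional_points_def far_def)
    then show ?thesis using fin by (simp add: sum.If_cases)
  qed
  have [measurable]: "Measurable.pred ?P (\<lambda>G. far (chem_dist G 0 x))" for x
    by (rule measurable_compose[OF measurable_chem_dist]) simp
  have [measurable]: "(\<lambda>G. real (card (?X G))) \<in> borel_measurable ?P"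
    unfolding cardX by measurable
  have E: "?E \<in> sets ?P" by measurable
  have rpow: "r powr (- real ?d) = 1 / r ^ ?d" and rpos: "0 < r ^ ?d"
    using r by (auto simp: powr_minus powr_realpow divide_inverse)
  have E_iff: "G \<in> ?E \<longleftrightarrow> a / 2 * r ^ ?d < real (card (?X G))" if "G \<in> space ?P" for G
    using that rpos r unfolding rpow by (simp add: field_simps)
  have "ennreal (a * r ^ ?d) \<le> (\<Sum>x\<in>A. perc_pr q \<beta> (B x))" by (rule sum)
  also have "\<dots> = (\<integral>\<^sup>+G. (\<Sum>x\<in>A. indicator {G \<in> space ?P. B x G} G) \<partial>?P)"
    using B by (subst nn_integral_sum) (auto simp: pred_def)
  also have "\<dots> \<le> (\<integral>\<^sup>+G. ennreal (a / 2 * r ^ ?d) + ennreal (C * r ^ ?d) * indicator ?E G \<partial>?P)"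
  proof (intro nn_integral_mono)
    fix G assume G: "G \<in> space ?P"
    have count: "(\<Sum>x\<in>A. indicator {G \<in> space ?P. B x G} G) = ennreal (real (card {x \<in> A. B x G}))"
    proof -
      have "(\<Sum>x\<in>A. indicator {G \<in> space ?P. B x G} G) = (\<Sum>x\<in>A. if B x G then 1 else (0::ennreal))"
        using G by (intro sum.cong) auto
      also have "\<dots> = of_nat (card (A \<inter> {x. B x G}))" using finA by (simp add: sum.If_cases)
      also have "A \<inter> {x. B x G} = {x \<in> A. B x G}" by auto
      finally show ?thesis by (simp add: ennreal_of_nat_eq_real_of_nat)
    qed
    have sub: "{x \<in> A. B x G} \<subseteq> ?X G" using exc by blast
    have le: "card {x \<in> A. B x G} \<le> card (?X G)"
      using sub finite_subset[OF X_sub fin] by (intro card_mono)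
    have "card (?X G) \<le> card (lattice_ball N 0 r)" using X_sub fin by (intro card_mono)
    then have le2: "real (card (?X G)) \<le> C * r ^ ?d" using C(2)[OF r] unfolding lattice_ball_eq by linarith
    show "(\<Sum>x\<in>A. indicator {G \<in> space ?P. B x G} G)
        \<le> ennreal (a / 2 * r ^ ?d) + ennreal (C * r ^ ?d) * indicator ?E G"
    proof (cases "G \<in> ?E")
      case True
      have "real (card {x \<in> A. B x G}) \<le> C * r ^ ?d" using le le2 by linarith
      then have "ennreal (real (card {x \<in> A. B x G})) \<le> ennreal (C * r ^ ?d)" by (rule ennreal_leI)
      then show ?thesis unfolding count using True by (simp add: add_increasing)
    next
      case False
      then have "real (card {x \<in> A. B x G}) \<le> a / 2 * r ^ ?d" using E_iff[OF G] le by linarith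
      then have "ennreal (real (card {x \<in> A. B x G})) \<le> ennreal (a / 2 * r ^ ?d)" by (rule ennreal_leI)
      then show ?thesis unfolding count by (simp add: add_increasing2)
    qed
  qed
  also have "\<dots> = ennreal (a / 2 * r ^ ?d) + ennreal (C * r ^ ?d) * emeasure ?P ?E"
    using E emeasure_space_1 by (simp add: nn_integral_add nn_integral_cmult)
  also have "\<dots> = ennreal (a / 2 * r ^ ?d + C * r ^ ?d * prob ?E)"
    using a C rpos by (simp add: emeasure_eq_measure ennreal_mult ennreal_plus)
  finally have "a * r ^ ?d \<le> a / 2 * r ^ ?d + C * r ^ ?d * prob ?E"
    using a C rpos by (subst (asm) ennreal_le_iff) auto
  then have "r ^ ?d * (a / 2) \<le> r ^ ?d * (C * prob ?E)" by (simp add: algebra_simps)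
  then have "a / 2 \<le> C * prob ?E" using rpos by simp
  then show ?thesis using C by (simp add: field_simps)
qed

lemma no_persistent_exceptional_points:
  assumes conv: "exceptions_vanish \<beta> f \<epsilon>"
    and R: "filterlim R at_top sequentially" and a: "0 < a"
    and ev: "eventually (\<lambda>k. likely_exceptions \<beta> f \<epsilon> a (R k)) sequentially"
  shows False
proof -
  obtain C where C: "0 < C" "\<And>r. 1 \<le> r \<Longrightarrow> real (card {x. len x < r}) \<le> C * r ^ CARD('n)"
    using card_ball_upper by blast
  let ?m = "\<lambda>r. measure (percolation q \<beta>) {G \<in> space (percolation q \<beta>).
    \<bar>r powr (- real CARD('n)) * real (card (exceptional_points N s f \<epsilon> r G)) - 0\<bar> > a / 2}"
  have "0 < a / 2" using a by simp
  from conv[unfolded exceptions_vanish_def tendsto_in_prob_def, rule_format, OF this] have "(?m \<longlongrightarrow> 0) at_top" .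
  then have "((\<lambda>k. ?m (R k)) \<longlongrightarrow> 0) sequentially" using R by (rule filterlim_compose)
  moreover have "eventually (\<lambda>k. a / (2 * C) \<le> ?m (R k)) sequentially"
  proof -
    have "eventually (\<lambda>k. 1 \<le> R k) sequentially" using R unfolding filterlim_at_top by blast
    then show ?thesis using ev
    proof eventually_elim
      case (elim k)
      then show ?case using expected_exceptional_points_bound[OF C _ a] by blast
    qed
  qed
  ultimately have "a / (2 * C) \<le> 0" by (intro tendsto_lowerbound) auto
  then show False using a C(1) by (simp add: divide_le_0_iff)
qed

text \<open>The asymptotics only concern \<open>r\<close> tending to infinity, but the invariance of \<open>f\<close> carries each value
  \<open>f r\<close> out to a sequence that tends to infinity.\<close>

lemma log_periodic_sequence:
  assumes f: "convergent_at \<beta> f" and r: "1 < r"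
  obtains R where "filterlim R at_top sequentially" "\<And>k. f (R k) = f r" "\<And>k. 1 < R k"
proof
  let ?g = "scale_ratio"
  define R where "R k = r powr (?g ^ k)" for k :: nat
  have g: "1 < ?g" by (rule scale_ratio_bounds)
  have "1 < norm ?g" using g unfolding real_norm_def by linarith
  then have "filterlim (\<lambda>k. ?g ^ k) at_infinity sequentially"
    by (rule filterlim_realpow_sequentially_gt1)
  then have "filterlim (\<lambda>k. ?g ^ k) at_top sequentially"
    by (rule filterlim_at_infinity_imp_filterlim_at_top) (use g in auto)
  then have "filterlim (\<lambda>k. ln r * ?g ^ k) at_top sequentially"
    using r by (intro filterlim_tendsto_pos_mult_at_top[OF tendsto_const]) auto
  then have "filterlim (\<lambda>k. exp (ln r * ?g ^ k)) at_top sequentially"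
    by (rule filterlim_compose[OF exp_at_top])
  then show "filterlim R at_top sequentially" using r by (simp add: R_def[abs_def] powr_def mult.commute)
  show R1: "1 < R k" for k unfolding R_def using r g by (intro gr_one_powr) auto
  show "f (R k) = f r" for k
  proof (induction k)
    case 0
    then show ?case using r by (simp add: R_def)
  next
    case (Suc k)
    have "?g ^ Suc k * gamma_exp CARD('n) s = ?g ^ k"
      using s_pos by (simp add: scale_ratio_def gamma_exp_def)
    then have "R (Suc k) powr gamma_exp CARD('n) s = R k" by (simp only: R_def powr_powr)
    then show ?case using f R1[of "Suc k"] Suc unfolding convergent_at_def by metis
  qed
qed

text \<open>If \<open>f r\<close> were smaller, then with \<open>n\<close> about \<open>2 * f r * ln r powr Delta_exp\<close> the ball \<open>gball G n 0\<close>
  would have mean size at most \<open>sqrt r\<close>. So almost all points of the lattice ball would have a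
  distance of more than \<open>n\<close>, which makes them exceptional.\<close>

lemma convergent_lower_bound:
  obtains c where "0 < c" "\<And>\<beta> f r. exp 1 \<le> \<beta> \<Longrightarrow> convergent_at \<beta> f \<Longrightarrow> 1 < r \<Longrightarrow>
    c / ln \<beta> powr Delta_exp CARD('n) s \<le> f r"
proof -
  let ?\<Delta> = "Delta_exp CARD('n) s"
  define \<theta> where "\<theta> = 1 / ?\<Delta>"
  have \<theta>: "0 < \<theta>" "?\<Delta> * \<theta> = 1" using Delta_exp_pos by (auto simp: \<theta>_def)
  have "2 powr \<theta> = scale_ratio"
    using scale_ratio_bounds by (simp add: \<theta>_def Delta_exp_def scale_ratio_def)
  then have "2 powr \<theta> = 2 * (real CARD('n) / s)" by (simp add: scale_ratio_def)
  then obtain K where K: "0 < K" "\<And>\<beta> n v. exp 1 \<le> \<beta> \<Longrightarrow>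
       mean_gball_size q \<beta> n v \<le> ennreal (exp (K * ln \<beta> * real (n + 1) powr \<theta>))"
    using mean_gball_size_bound by blast
  obtain c\<^sub>0 where c0: "0 < c\<^sub>0" "\<And>r. 0 < r \<Longrightarrow> c\<^sub>0 * r ^ CARD('n) \<le> real (card {x. len x < r})"
    using card_ball_lower by blast
  (* Chosen such that K * ln \<beta> * (n + 1) powr \<theta> will be at most half of ln r. *)
  define c where "c = (1 / (2 * K)) powr ?\<Delta> / 4"
  have c: "0 < c" using K(1) by (simp add: c_def)
  have "c / ln \<beta> powr ?\<Delta> \<le> f r\<^sub>0"
    if \<beta>: "exp 1 \<le> \<beta>" and f: "convergent_at \<beta> f" and r0: "1 < r\<^sub>0" for \<beta> f r\<^sub>0
  proof (rule ccontr)
    assume "\<not> ?thesis"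
    then have small: "f r\<^sub>0 < c / ln \<beta> powr ?\<Delta>" by simp
    have ln\<beta>: "1 \<le> ln \<beta>" using \<beta> exp_gt_zero[of 1] by (subst ln_ge_iff) linarith+
    obtain R where R: "filterlim R at_top sequentially" "\<And>k. f (R k) = f r\<^sub>0" "\<And>k. 1 < R k"
      using log_periodic_sequence[OF f r0] by blast
    define \<psi> where "\<psi> = f r\<^sub>0"
    have \<psi>: "0 < \<psi>" using f r0 by (simp add: \<psi>_def convergent_at_def)
    (* From here on, sqrt r is negligible compared with the volume of the ball, and n is positive. *)
    define r\<^sub>2 where "r\<^sub>2 = max ((2 / c\<^sub>0)\<^sup>2) (exp ((1 / (2 * \<psi>)) powr \<theta>))"
    show False
    proof (rule no_persistent_exceptional_points[where f = f and \<beta> = \<beta> and \<epsilon> = "1/2" and R = R and a = "c\<^sub>0 / 2"])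
      show "exceptions_vanish \<beta> f (1/2)" using f by (simp add: convergent_at_def)
      show "filterlim R at_top sequentially" by (rule R)
      show "0 < c\<^sub>0 / 2" using c0 by simp
      have "eventually (\<lambda>k. r\<^sub>2 \<le> R k) sequentially" using R(1) unfolding filterlim_at_top by blast
      then show "eventually (\<lambda>k. likely_exceptions \<beta> f (1/2) (c\<^sub>0 / 2) (R k)) sequentially"
      proof eventually_elim
        case (elim k)
        define r where "r = R k"
        have r: "1 < r" "(2 / c\<^sub>0)\<^sup>2 \<le> r" "exp ((1 / (2 * \<psi>)) powr \<theta>) \<le> r"
          using elim R(3)[of k] by (auto simp: r_def r\<^sub>2_def)
        have lnr: "(1 / (2 * \<psi>)) powr \<theta> \<le> ln r" "0 < ln r" using r by (auto simp: ln_ge_iff)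
        define L where "L = \<psi> * ln r powr ?\<Delta>"
        have L: "0 < L" using \<psi> lnr by (simp add: L_def)
        have "((1 / (2 * \<psi>)) powr \<theta>) powr ?\<Delta> \<le> ln r powr ?\<Delta>"
          using lnr Delta_exp_pos by (intro powr_mono2) auto
        moreover have "((1 / (2 * \<psi>)) powr \<theta>) powr ?\<Delta> = 1 / (2 * \<psi>)"
          using \<psi> \<theta>(2) by (simp add: powr_powr mult.commute)
        ultimately have "1 / (2 * \<psi>) \<le> ln r powr ?\<Delta>" by (simp only:)
        then have L2: "1 \<le> 2 * L" using \<psi> by (simp add: L_def field_simps)
        define n where "n = nat \<lfloor>2 * L\<rfloor>"
        have n: "real n \<le> 2 * L" "2 * L \<le> real n + 1" using L unfolding n_def by linarith+
        have "real (n + 1) powr \<theta> \<le> (4 * L) powr \<theta>"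
          using n(1) L2 \<theta> by (intro powr_mono2) auto
        also have "\<dots> \<le> ((ln r / (2 * K * ln \<beta>)) powr ?\<Delta>) powr \<theta>"
        proof (intro powr_mono2)
          have "4 * L \<le> 4 * (c / ln \<beta> powr ?\<Delta>) * ln r powr ?\<Delta>"
            using small unfolding L_def \<psi>_def mult.assoc[symmetric] by (intro mult_right_mono mult_left_mono) auto
          also have "\<dots> = (1 / (2 * K)) powr ?\<Delta> * (ln r powr ?\<Delta> / ln \<beta> powr ?\<Delta>)" by (simp add: c_def)
          also have "\<dots> = (1 / (2 * K) * (ln r / ln \<beta>)) powr ?\<Delta>"
            using K(1) lnr ln\<beta> by (subst powr_mult) (auto simp: powr_divide)
          also have "1 / (2 * K) * (ln r / ln \<beta>) = ln r / (2 * K * ln \<beta>)" by simp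
          finally show "4 * L \<le> (ln r / (2 * K * ln \<beta>)) powr ?\<Delta>" .
        qed (use L \<theta> in auto)
        also have "\<dots> = ln r / (2 * K * ln \<beta>)"
          using lnr ln\<beta> K(1) \<theta>(2) by (simp add: powr_powr)
        finally have "K * ln \<beta> * real (n + 1) powr \<theta> \<le> K * ln \<beta> * (ln r / (2 * K * ln \<beta>))"
          using K(1) ln\<beta> by (intro mult_left_mono) auto
        also have "\<dots> = 1/2 * ln r" using K(1) ln\<beta> by simp
        finally have "exp (K * ln \<beta> * real (n + 1) powr \<theta>) \<le> exp (1/2 * ln r)" by (simp only: exp_le_cancel_iff)
        also have "\<dots> = sqrt r" using r by (simp add: powr_def flip: powr_half_sqrt)
        finally have mean: "mean_gball_size q \<beta> n 0 \<le> ennreal (sqrt r)"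
          using K(2)[OF \<beta>, of n 0] by (meson ennreal_leI order_trans)
        define A where "A = lattice_ball N 0 r"
        have finA: "finite A" unfolding A_def lattice_ball_eq by (rule finite_ball)
        interpret prob_space "percolation q \<beta>" by (rule prob_space_percolation)
        have compl: "perc_pr q \<beta> (\<lambda>G. \<not> x \<in> gball G n 0) + reach_pr q \<beta> n 0 x = 1" for x
        proof -
          have "perc_pr q \<beta> (\<lambda>G. \<not> x \<in> gball G n 0) + reach_pr q \<beta> n 0 x
              = emeasure (percolation q \<beta>) ({G \<in> space (percolation q \<beta>). \<not> x \<in> gball G n 0} \<union>
                  {G \<in> space (percolation q \<beta>). x \<in> gball G n 0})"
            by (intro plus_emeasure) (measurable, auto)
          also have "{G \<in> space (percolation q \<beta>). \<not> x \<in> gball G n 0} \<union>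
                  {G \<in> space (percolation q \<beta>). x \<in> gball G n 0} = space (percolation q \<beta>)" by auto
          finally show ?thesis by (simp add: emeasure_space_1)
        qed
        have part: "(\<Sum>x\<in>A. reach_pr q \<beta> n 0 x) \<le> ennreal (sqrt r)"
        proof -
          have "(\<Sum>x\<in>A. reach_pr q \<beta> n 0 x)
              = (\<integral>\<^sup>+x. reach_pr q \<beta> n 0 x * indicator A x \<partial>count_space UNIV)"
            using finA by (subst nn_integral_indicator_finite) auto
          also have "\<dots> \<le> mean_gball_size q \<beta> n 0"
            unfolding mean_gball_size_def by (intro nn_integral_mono) (auto split: split_indicator)
          finally show ?thesis using mean by (rule order_trans)
        qed
        have "ennreal (c\<^sub>0 * r ^ CARD('n)) \<le> ennreal (real (card A))"
          unfolding A_def lattice_ball_eq using r by (intro ennreal_leI c0) auto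
        also have "\<dots> = (\<Sum>x\<in>A. perc_pr q \<beta> (\<lambda>G. \<not> x \<in> gball G n 0) + reach_pr q \<beta> n 0 x)"
          unfolding compl by (simp add: ennreal_of_nat_eq_real_of_nat)
        also have "\<dots> \<le> (\<Sum>x\<in>A. perc_pr q \<beta> (\<lambda>G. \<not> x \<in> gball G n 0)) + ennreal (sqrt r)"
          unfolding sum.distrib using part by (rule add_left_mono)
        also have "ennreal (sqrt r) \<le> ennreal (c\<^sub>0 / 2 * r ^ CARD('n))"
        proof (rule ennreal_leI)
          have "sqrt ((2 / c\<^sub>0)\<^sup>2) \<le> sqrt r" using r(2) by (rule real_sqrt_le_mono)
          then have "2 / c\<^sub>0 \<le> sqrt r" using c0 by simp
          then have "1 \<le> c\<^sub>0 / 2 * sqrt r" using c0 by (simp add: field_simps)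
          then have "1 * sqrt r \<le> c\<^sub>0 / 2 * sqrt r * sqrt r" using r by (intro mult_right_mono) auto
          also have "\<dots> = c\<^sub>0 / 2 * r ^ 1" using r by simp
          also have "\<dots> \<le> c\<^sub>0 / 2 * r ^ CARD('n)"
            using r c0 by (intro mult_left_mono power_increasing) (auto simp: Suc_le_eq)
          finally show "sqrt r \<le> c\<^sub>0 / 2 * r ^ CARD('n)" by simp
        qed
        finally have sum_ge: "ennreal (c\<^sub>0 * r ^ CARD('n))
            \<le> (\<Sum>x\<in>A. perc_pr q \<beta> (\<lambda>G. \<not> x \<in> gball G n 0)) + ennreal (c\<^sub>0 / 2 * r ^ CARD('n))"
          by (simp add: add_left_mono)
        have half: "ennreal (c\<^sub>0 / 2 * r ^ CARD('n)) \<le> (\<Sum>x\<in>A. perc_pr q \<beta> (\<lambda>G. \<not> x \<in> gball G n 0))"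
        proof (cases "\<Sum>x\<in>A. perc_pr q \<beta> (\<lambda>G. \<not> x \<in> gball G n 0)")
          case (real t)
          have pos: "0 \<le> c\<^sub>0 / 2 * r ^ CARD('n)" using c0 r by simp
          have "ennreal (c\<^sub>0 * r ^ CARD('n)) \<le> ennreal (t + c\<^sub>0 / 2 * r ^ CARD('n))"
            using sum_ge pos real by (simp add: ennreal_plus)
          then have "c\<^sub>0 * r ^ CARD('n) \<le> t + c\<^sub>0 / 2 * r ^ CARD('n)"
            using real pos by (subst (asm) ennreal_le_iff) auto
          then have "c\<^sub>0 / 2 * r ^ CARD('n) \<le> t" by simp
          then show ?thesis unfolding real(2) by (rule ennreal_leI)
        next
          case top
          show ?thesis unfolding top by simp
        qed
        have "x \<in> exceptional_points N s f (1/2) r G" if "x \<in> A" "\<not> x \<in> gball G n 0" for x G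
        proof -
          have "f r * ln r powr ?\<Delta> = L" by (simp add: L_def \<psi>_def r_def R(2))
          then show ?thesis
            using that far_is_exceptional[OF L n(2), of "chem_dist G 0 x"]
            unfolding exceptional_points_def A_def chem_dist_le_iff by simp
        qed
        moreover have "perc_event q \<beta> (\<lambda>G. \<not> x \<in> gball G n 0)" for x by measurable
        ultimately show ?case unfolding likely_exceptions_def r_def[symmetric] using half
          by (intro exI[of _ A] exI[of _ "\<lambda>x G. \<not> x \<in> gball G n 0"]) (simp add: A_def)
      qed
    qed
  qed
  then show ?thesis using c that by blast
qed

text \<open>If \<open>f r\<close> were larger, then each point of the annulus would be exceptional with a probability of at
  least one half, because of its small distance.\<close>

lemma convergent_upper_bound:
  obtains C \<beta>\<^sub>1 where "0 < C" "1 < \<beta>\<^sub>1"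
    "\<And>\<beta> f r. \<beta>\<^sub>1 \<le> \<beta> \<Longrightarrow> convergent_at \<beta> f \<Longrightarrow> 1 < r \<Longrightarrow> f r \<le> C / ln \<beta> powr Delta_exp CARD('n) s"
proof -
  let ?\<Delta> = "Delta_exp CARD('n) s"
  obtain \<kappa> c C \<beta>\<^sub>1 where *: "0 < c" "0 < C" "1 < \<beta>\<^sub>1"
    "\<And>\<beta> r. \<beta>\<^sub>1 \<le> \<beta> \<Longrightarrow> \<beta> \<le> r \<Longrightarrow> c * r ^ CARD('n) \<le> real (card {x. \<kappa> * r \<le> len x \<and> len x < r})"
    "\<And>\<beta> r. \<beta>\<^sub>1 \<le> \<beta> \<Longrightarrow> \<beta> \<le> r \<Longrightarrow>
       \<exists>n. real n \<le> C * (ln r / ln \<beta>) powr ?\<Delta> \<and>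
         (\<forall>x. \<kappa> * r \<le> len x \<and> len x < r \<longrightarrow> ennreal (1/2) \<le> reach_pr q \<beta> n 0 x)"
    by (rule annulus_connected_quickly) (rule that; assumption)
  have "f r\<^sub>0 \<le> 4 * C / ln \<beta> powr ?\<Delta>"
    if \<beta>: "\<beta>\<^sub>1 \<le> \<beta>" and f: "convergent_at \<beta> f" and r0: "1 < r\<^sub>0" for \<beta> f r\<^sub>0
  proof (rule ccontr)
    assume "\<not> ?thesis"
    then have large: "4 * C / ln \<beta> powr ?\<Delta> < f r\<^sub>0" by simp
    have ln\<beta>: "0 < ln \<beta>" using \<beta> *(3) by simp
    obtain R where R: "filterlim R at_top sequentially" "\<And>k. f (R k) = f r\<^sub>0" "\<And>k. 1 < R k"
      using log_periodic_sequence[OF f r0] by blast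
    show False
    proof (rule no_persistent_exceptional_points[where f = f and \<beta> = \<beta> and \<epsilon> = "1/2" and R = R and a = "c / 2"])
      show "exceptions_vanish \<beta> f (1/2)" using f by (simp add: convergent_at_def)
      show "filterlim R at_top sequentially" by (rule R)
      show "0 < c / 2" using * by simp
      have "eventually (\<lambda>k. \<beta> \<le> R k) sequentially" using R(1) unfolding filterlim_at_top by blast
      then show "eventually (\<lambda>k. likely_exceptions \<beta> f (1/2) (c / 2) (R k)) sequentially"
      proof eventually_elim
        case (elim k)
        define r where "r = R k"
        have r: "1 < r" "\<beta> \<le> r" using elim R(3)[of k] by (auto simp: r_def)
        obtain n where n: "real n \<le> C * (ln r / ln \<beta>) powr ?\<Delta>"
          "\<And>x. \<kappa> * r \<le> len x \<Longrightarrow> len x < r \<Longrightarrow> ennreal (1/2) \<le> reach_pr q \<beta> n 0 x"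
          using *(5)[OF \<beta> r(2)] by blast
        define A where "A = {x. \<kappa> * r \<le> len x \<and> len x < r}"
        define L where "L = f r\<^sub>0 * ln r powr ?\<Delta>"
        have L0: "0 < L" using f r0 r by (simp add: L_def convergent_at_def)
        have "4 * real n \<le> 4 * (C * (ln r / ln \<beta>) powr ?\<Delta>)" using n(1) by simp
        also have "\<dots> = 4 * C / ln \<beta> powr ?\<Delta> * ln r powr ?\<Delta>" using r ln\<beta> by (simp add: powr_divide)
        also have "\<dots> \<le> L" unfolding L_def using large by (intro mult_right_mono) auto
        finally have nL: "4 * real n \<le> L" .
        have "ennreal (c / 2 * r ^ CARD('n)) \<le> ennreal (real (card A) * (1/2))"
          using *(4)[OF \<beta> r(2)] by (intro ennreal_leI) (simp add: A_def)
        also have "\<dots> = ennreal (\<Sum>x\<in>A. 1/2)" by simp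
        also have "\<dots> = (\<Sum>x\<in>A. ennreal (1/2))" by (rule sum_ennreal[symmetric]) simp
        also have "\<dots> \<le> (\<Sum>x\<in>A. reach_pr q \<beta> n 0 x)"
          by (intro sum_mono n(2)) (auto simp: A_def)
        finally have half: "ennreal (c / 2 * r ^ CARD('n)) \<le> (\<Sum>x\<in>A. reach_pr q \<beta> n 0 x)" .
        have AB: "A \<subseteq> lattice_ball N 0 r" by (auto simp: A_def lattice_ball_eq)
        have "x \<in> exceptional_points N s f (1/2) r G" if "x \<in> A" "x \<in> gball G n 0" for x G
        proof -
          have "f r * ln r powr ?\<Delta> = L" by (simp add: L_def r_def R(2))
          then show ?thesis
            using that AB near_is_exceptional[OF L0 nL, of "chem_dist G 0 x"]
            unfolding exceptional_points_def chem_dist_le_iff by auto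
        qed
        moreover have "perc_event q \<beta> (\<lambda>G. x \<in> gball G n 0)" for x by measurable
        ultimately show ?case unfolding likely_exceptions_def r_def[symmetric] using half AB
          by (intro exI[of _ A] exI[of _ "\<lambda>x G. x \<in> gball G n 0"]) simp
      qed
    qed
  qed
  then show ?thesis using *(2,3) by (intro that[of "4 * C" \<beta>\<^sub>1]) auto
qed

end

theorem corollary1p4:
  fixes N :: "real ^ 'n \<Rightarrow> real"
    and s :: real
    and q :: "int ^ 'n \<Rightarrow> ennreal"
    and \<phi> :: "real \<Rightarrow> real \<Rightarrow> real"
  assumes "real CARD('n) < s" and "s < 2 * real CARD('n)"
    and "is_norm N"
    and "admissible_q N s q"
    and "is_phi_family N s q \<phi>"
  shows "\<exists>c C \<beta>\<^sub>1. 0 < c \<and> 0 < C \<and> 1 < \<beta>\<^sub>1 \<and>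
    (\<forall>\<beta>>\<beta>\<^sub>1. \<forall>r>1.
       c / ln \<beta> powr Delta_exp CARD('n) s \<le> \<phi> \<beta> r \<and>
       \<phi> \<beta> r \<le> C / ln \<beta> powr Delta_exp CARD('n) s)"
proof -
  interpret long_range_percolation N s q
    using assms(1-4) by unfold_locales
  let ?\<Delta> = "Delta_exp CARD('n) s"
  obtain c where c: "0 < c" "\<And>\<beta> f r. exp 1 \<le> \<beta> \<Longrightarrow> convergent_at \<beta> f \<Longrightarrow> 1 < r \<Longrightarrow> c / ln \<beta> powr ?\<Delta> \<le> f r"
    by (rule convergent_lower_bound) (rule that; assumption)
  obtain C b where C: "0 < C" "1 < b"
    "\<And>\<beta> f r. b \<le> \<beta> \<Longrightarrow> convergent_at \<beta> f \<Longrightarrow> 1 < r \<Longrightarrow> f r \<le> C / ln \<beta> powr ?\<Delta>"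
    by (rule convergent_upper_bound) (rule that; assumption)
  note \<phi> = assms(5)[unfolded is_phi_family_def, THEN conjunct2]
  have pos: "\<forall>\<beta>>0. \<forall>r>1. \<phi> \<beta> r > 0" by (rule \<phi>[THEN conjunct1])
  have per: "\<forall>\<beta>>0. \<forall>r>1. \<phi> \<beta> (r powr gamma_exp CARD('n) s) = \<phi> \<beta> r"
    by (rule \<phi>[THEN conjunct2, THEN conjunct1])
  have mono: "\<forall>r>1. antimono_on {0<..} (\<lambda>\<beta>. \<phi> \<beta> r)"
    by (rule \<phi>[THEN conjunct2, THEN conjunct2, THEN conjunct1])
  obtain \<Sigma> where S: "countable \<Sigma> \<and> \<Sigma> \<subseteq> {0<..} \<and>
        (\<forall>\<beta> \<in> {0<..} - \<Sigma>.
           (\<forall>r>1. isCont (\<lambda>b. \<phi> b r) \<beta>) \<and>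
           (\<forall>\<epsilon>>0. tendsto_in_prob (percolation q \<beta>)
              (\<lambda>r G. r powr (- real CARD('n)) * real (card (exceptional_points N s (\<phi> \<beta>) \<epsilon> r G)))
              0 at_top))"
    by (rule exE[OF \<phi>[THEN conjunct2, THEN conjunct2, THEN conjunct2, THEN conjunct2]])
  have \<Sigma>0: "countable \<Sigma>" using S by (rule conjunct1)
  have \<Sigma>: "convergent_at \<beta> (\<phi> \<beta>)" if "0 < \<beta>" "\<beta> \<notin> \<Sigma>" for \<beta>
    unfolding convergent_at_def exceptions_vanish_def
  proof (intro conjI)
    show "\<forall>r>1. 0 < \<phi> \<beta> r" using pos that(1) by blast
    show "\<forall>r>1. \<phi> \<beta> (r powr gamma_exp CARD('n) s) = \<phi> \<beta> r" using per that(1) by blast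
    have "\<beta> \<in> {0<..} - \<Sigma>" using that by simp
    from bspec[OF S[THEN conjunct2, THEN conjunct2] this]
    show "\<forall>\<epsilon>>0. tendsto_in_prob (percolation q \<beta>)
      (\<lambda>r G. r powr (- real CARD('n)) * real (card (exceptional_points N s (\<phi> \<beta>) \<epsilon> r G))) 0 at_top"
      by (rule conjunct2)
  qed
  have anti: "\<phi> \<beta>' r \<le> \<phi> \<beta> r" if "0 < \<beta>" "\<beta> \<le> \<beta>'" "1 < r" for \<beta> \<beta>' r
  proof -
    have "antimono_on {0<..} (\<lambda>\<beta>. \<phi> \<beta> r)" using mono that(3) by blast
    from monotone_onD[OF this, of \<beta> \<beta>'] show ?thesis using that(1,2) by simp
  qed
  define \<beta>\<^sub>1 where "\<beta>\<^sub>1 = max (exp 1) (b\<^sup>2)"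
  have \<beta>1: "exp 1 \<le> \<beta>\<^sub>1" "b\<^sup>2 \<le> \<beta>\<^sub>1" by (auto simp: \<beta>\<^sub>1_def)
  have e1: "(1::real) < exp 1" by simp
  have avoid: "\<exists>\<beta>'. x < \<beta>' \<and> \<beta>' < y \<and> \<beta>' \<notin> \<Sigma>" if "x < y" for x y :: real
  proof (rule ccontr)
    assume "\<not> ?thesis"
    then have "{x<..<y} \<subseteq> \<Sigma>" by auto
    then have "countable {x<..<y}" using \<Sigma>0 countable_subset[of "{x<..<y}" \<Sigma>] by simp
    then show False using that uncountable_open_interval by blast
  qed
  have "c / 2 powr ?\<Delta> / ln \<beta> powr ?\<Delta> \<le> \<phi> \<beta> r \<and> \<phi> \<beta> r \<le> C * 2 powr ?\<Delta> / ln \<beta> powr ?\<Delta>"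
    if \<beta>: "\<beta>\<^sub>1 < \<beta>" and r: "1 < r" for \<beta> r
  proof
    have \<beta>e: "1 < \<beta>" "exp 1 \<le> \<beta>" using \<beta> \<beta>1 e1 by linarith+
    have ln\<beta>: "0 < ln \<beta>" using \<beta>e by simp
    have "\<beta> * 1 < \<beta> * \<beta>" using \<beta>e by (intro mult_strict_left_mono) auto
    (* Passing from \<beta> to its square or to its square root only changes ln \<beta> by a factor of 2, which
       leaves enough room to avoid the exceptional set. *)
    then obtain \<beta>' where \<beta>': "\<beta> < \<beta>'" "\<beta>' < \<beta> * \<beta>" "\<beta>' \<notin> \<Sigma>" using avoid[of \<beta> "\<beta> * \<beta>"] by auto
    have "ln \<beta>' \<le> ln (\<beta> * \<beta>)" using \<beta>' \<beta>e by (intro ln_mono) auto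
    then have l2: "ln \<beta>' \<le> 2 * ln \<beta>" using \<beta>e by (simp add: ln_mult)
    have "0 < ln \<beta>'" using \<beta>' \<beta>e by simp
    have "c / 2 powr ?\<Delta> / ln \<beta> powr ?\<Delta> = c / (2 * ln \<beta>) powr ?\<Delta>" using ln\<beta> by (simp add: powr_mult)
    also have "\<dots> \<le> c / ln \<beta>' powr ?\<Delta>"
      using l2 \<open>0 < ln \<beta>'\<close> c(1) Delta_exp_pos by (intro divide_left_mono powr_mono2 mult_pos_pos) auto
    also have "\<dots> \<le> \<phi> \<beta>' r" using \<beta>' \<beta>e r by (intro c(2) \<Sigma>) auto
    also have "\<dots> \<le> \<phi> \<beta> r" using \<beta>' \<beta>e r by (intro anti) auto
    finally show "c / 2 powr ?\<Delta> / ln \<beta> powr ?\<Delta> \<le> \<phi> \<beta> r" .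
    have "b\<^sup>2 < \<beta>" using \<beta> \<beta>1 by linarith
    then have "sqrt (b\<^sup>2) < sqrt \<beta>" by (rule real_sqrt_less_mono)
    then have bs: "b < sqrt \<beta>" using C(2) by simp
    have s1: "1 < sqrt \<beta>" using \<beta>e by simp
    have "sqrt \<beta> * 1 < sqrt \<beta> * sqrt \<beta>" using s1 by (intro mult_strict_left_mono) auto
    then have "sqrt \<beta> < \<beta>" using \<beta>e by simp
    then obtain \<beta>'' where \<beta>'': "sqrt \<beta> < \<beta>''" "\<beta>'' < \<beta>" "\<beta>'' \<notin> \<Sigma>" using avoid by blast
    have "ln (sqrt \<beta>) \<le> ln \<beta>''" using \<beta>'' s1 by (intro ln_mono) auto
    then have l3: "ln \<beta> / 2 \<le> ln \<beta>''" using \<beta>e by (simp add: ln_sqrt)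
    have p: "0 < \<beta>''" "b \<le> \<beta>''" using \<beta>''(1) s1 bs by linarith+
    have "\<phi> \<beta> r \<le> \<phi> \<beta>'' r" using \<beta>''(2) p r by (intro anti) auto
    also have "\<dots> \<le> C / ln \<beta>'' powr ?\<Delta>" using \<beta>''(3) p r by (intro C(3) \<Sigma>) auto
    also have "\<dots> \<le> C / (ln \<beta> / 2) powr ?\<Delta>"
      using l3 ln\<beta> C(1) Delta_exp_pos by (intro divide_left_mono powr_mono2 mult_pos_pos) auto
    also have "\<dots> = C * 2 powr ?\<Delta> / ln \<beta> powr ?\<Delta>" using ln\<beta> by (simp add: powr_divide)
    finally show "\<phi> \<beta> r \<le> C * 2 powr ?\<Delta> / ln \<beta> powr ?\<Delta>" .
  qed
  moreover have "0 < c / 2 powr ?\<Delta>" "0 < C * 2 powr ?\<Delta>" using c(1) C(1) by simp_all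
  moreover have "1 < \<beta>\<^sub>1" using \<beta>1(1) e1 by linarith
  ultimately show ?thesis by blast
qed

end
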